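(* Let $0\le k_1\le k_2$ be integers and $\alpha_1,\alpha_2\in\mathbb{R}$ with $\min\{\alpha_1,\alpha_2,\alpha_1+\alpha_2\}>-d$ and with $\alpha_i=0$ whenever $k_i>d$. Then, as $t\to\infty$, $$\mathrm{Cov}\big(\mathcal{V}_{k_1}^{(\alpha_1)},\mathcal{V}_{k_2}^{(\alpha_2)}\big)=\sum_{m=1}^{k_1+1}\frac{\mu_{k_1,k_2:m}^{(\alpha_1,\alpha_2)}}{m!\,(k_1-m+1)!\,(k_2-m+1)!}\;t^{k_1+k_2-m+2}\,\delta_t^{(d+\alpha_1)k_1+(d+\alpha_2)k_2-d(m-1)}\,(1+o(1)).$$ In particular, for an integer $k\ge0$ and $\alpha\in\mathbb{R}$ with $2\alpha>-d$ (and $\alpha=0$ if $k>d$), $$\mathrm{Var}\,\mathcal{V}_k^{(\alpha)}=\sum_{m=1}^{k+1}\frac{\mu_{k,k:m}^{(\alpha,\alpha)}}{m!\,((k-m+1)!)^2}\;t^{2k-m+2}\,\delta_t^{2(d+\alpha)k-d(m-1)}\,(1+o(1)).$$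
   Context: Fix $d\ge 1$ and a compact convex set $W\subset\mathbb{R}^d$ of volume $1$. For $t>0$ let $\eta_t$ be a Poisson point process on $W$ with constant intensity $t$ (intensity measure $t\,dx$ on $W$), and let $\delta_t>0$ be real numbers with $\delta_t\to0$ as $t\to\infty$. Let $B^d$ be the unit ball of $\mathbb{R}^d$ centered at the origin. For $s>0$ and points $x_0,\dots,x_k\in\mathbb{R}^d$, $\Delta_s[x_0,\dots,x_k]$ denotes the $k$-dimensional volume of the convex hull of $x_0,\dots,x_k$ if $\|x_i-x_j\|\le s$ for all $i,j$, and $0$ otherwise. The power $\Delta_s[x_0,\dots,x_k]^\alpha$ is understood as the $\alpha$-th power of this volume times the indicator that all pairwise distances are at most $s$ (so it is $0$ if some pairwise distance exceeds $s$, also for $\alpha\le 0$; for $\alpha=0$ it is this indicator). For $k>d$ only $\alpha=0$ is used, and $\Delta_s[x_0,\dots,x_k]^0$ is the indicator that all pairwise distances are at most $s$. For $k=0$, $\Delta_s[x_0]=1$. The volume-power functional of the Vietoris-Rips complex is $$\mathcal{V}_k^{(\alpha)}=\frac1{(k+1)!}\sum_{(x_0,\dots,x_k)\in\eta_{t,\neq}^{k+1}}\Delta_{\delta_t}[x_0,\dots,x_k]^\alpha,$$ where $\eta_{t,\neq}^{k+1}$ is the set of $(k+1)$-tuples of distinct points of $\eta_t$. For $k_1\le k_2$ and $1\le m\le k_1+1$, $$\mu_{k_1,k_2:m}^{(\alpha_1,\alpha_2)}=\int_{(B^d)^{k_1+k_2+1-m}}\Delta_1[0,\{x_l\}_{l=1}^{k_1}]^{\alpha_1}\,\Delta_1[0,\{x_l\}_{l=k_1-m+2}^{k_1+k_2-m+1}]^{\alpha_2}\,dx_1\cdots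 dx_{k_1+k_2-m+1},$$ where $\{x_l\}_{l=a}^{b}$ stands for the points $x_a,\dots,x_b$ (no points if $b<a$; an integral over no variables equals the integrand). *)

theory Defs
  imports "HOL-Probability.Probability"
begin

text \<open>A Poisson point process on \<open>W\<close> with intensity measure \<open>t dx\<close> on \<open>W\<close>. The intensity
  measure is finite and has no atoms, so the process is almost surely finite and simple and is
  represented by the random finite set of its points. The law of the counts is written out
  because sets of volume zero, where the parameter is \<open>0\<close>, are included.\<close>

definition poisson_process_on ::
    "'w measure \<Rightarrow> ('w \<Rightarrow> 'a::euclidean_space set) \<Rightarrow> 'a set \<Rightarrow> real \<Rightarrow> bool" where
  "poisson_process_on M \<eta> W t \<longleftrightarrow>
     prob_space M \<and>
     (\<forall>\<omega>\<in>space M. finite (\<eta> \<omega>) \<and> \<eta> \<omega> \<subseteq> W) \<and>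
     (\<forall>B\<in>sets borel. (\<lambda>\<omega>. card (\<eta> \<omega> \<inter> B)) \<in> measurable M (count_space UNIV)) \<and>
     (\<forall>B\<in>sets borel. \<forall>n. measure M {\<omega>\<in>space M. card (\<eta> \<omega> \<inter> B) = n} =
        (t * measure lborel (B \<inter> W)) ^ n / fact n * exp (- (t * measure lborel (B \<inter> W)))) \<and>
     (\<forall>F. finite F \<and> F \<subseteq> sets borel \<and> disjoint F \<longrightarrow>
        prob_space.indep_vars M (\<lambda>_. count_space UNIV) (\<lambda>B \<omega>. card (\<eta> \<omega> \<inter> B)) F)"

text \<open>The \<open>k\<close>-dimensional volume of a set \<open>S\<close> contained in a \<open>k\<close>-dimensional affine subspace:
  the \<open>k\<close>-dimensional Lebesgue measure of \<open>S\<close> in Cartesian coordinates (origin \<open>p\<close>, orthonormal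
  frame \<open>b\<close>) of such a subspace. The value does not depend on the coordinates. If \<open>S\<close> lies in a
  subspace of smaller dimension it is \<open>0\<close>, and a single point has \<open>0\<close>-dimensional volume \<open>1\<close>.
  For \<open>k > DIM('a)\<close> no frame exists and the value is unspecified.\<close>

definition k_volume :: "nat \<Rightarrow> 'a::euclidean_space set \<Rightarrow> real" where
  "k_volume k S = (THE v. \<exists>p b.
     (\<forall>i<k. \<forall>j<k. b i \<bullet> b j = (if i = j then 1 else 0)) \<and>
     S \<subseteq> (\<lambda>c. p + (\<Sum>i<k. c i *\<^sub>R b i)) ` UNIV \<and>
     v = measure (\<Pi>\<^sub>M i\<in>{..<k}. lborel)
           {c \<in> {..<k} \<rightarrow>\<^sub>E (UNIV :: real set). p + (\<Sum>i<k. c i *\<^sub>R b i) \<in> S})"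

text \<open>\<open>\<Delta>\<^sub>s[x\<^sub>0,\<dots>,x\<^sub>k]\<^sup>\<alpha>\<close> for \<open>xs = [x\<^sub>0,\<dots>,x\<^sub>k]\<close>. The case \<open>\<alpha> = 0\<close> is separate since
  \<open>0 powr 0 = 0\<close>. For \<open>\<alpha> < 0\<close> a degenerate simplex gets the value \<open>0 powr \<alpha> = 0\<close>; such tuples
  form a null set.\<close>

definition rips_vol_pow :: "real \<Rightarrow> real \<Rightarrow> 'a::euclidean_space list \<Rightarrow> real" where
  "rips_vol_pow s \<alpha> xs =
     (if \<forall>x\<in>set xs. \<forall>y\<in>set xs. dist x y \<le> s
      then (if \<alpha> = 0 then 1 else k_volume (length xs - 1) (convex hull (set xs)) powr \<alpha>)
      else 0)"

definition rips_functional :: "real \<Rightarrow> nat \<Rightarrow> real \<Rightarrow> 'a::euclidean_space set \<Rightarrow> real" where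
  "rips_functional s k \<alpha> X =
     1 / fact (k + 1) *
     (\<Sum>xs | length xs = k + 1 \<and> distinct xs \<and> set xs \<subseteq> X. rips_vol_pow s \<alpha> xs)"

text \<open>The integrand is nonnegative but the integral may diverge for negative exponents, so
  it is taken in \<open>[0,\<infinity>]\<close>. The first argument only fixes the space.\<close>

definition rips_mu ::
    "'a::euclidean_space itself \<Rightarrow> nat \<Rightarrow> nat \<Rightarrow> nat \<Rightarrow> real \<Rightarrow> real \<Rightarrow> ennreal" where
  "rips_mu T k\<^sub>1 k\<^sub>2 m \<alpha>\<^sub>1 \<alpha>\<^sub>2 =
     (\<integral>\<^sup>+x. ennreal (rips_vol_pow 1 \<alpha>\<^sub>1 ((0::'a) # map x [1..<k\<^sub>1 + 1]) *
                   rips_vol_pow 1 \<alpha>\<^sub>2 ((0::'a) # map x [k\<^sub>1 + 2 - m..<k\<^sub>1 + k\<^sub>2 + 2 - m])) *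
            indicator ({1..k\<^sub>1 + k\<^sub>2 + 1 - m} \<rightarrow>\<^sub>E cball 0 1) x
      \<partial>(\<Pi>\<^sub>M l\<in>{1..k\<^sub>1 + k\<^sub>2 + 1 - m}. lborel))"

text \<open>Covariance with values in the extended reals: the Bochner integral of a function that is
  not integrable is \<open>0\<close>, so it cannot express an infinite second moment. The covariance is the mean
  of the product of the centred variables, that mean being taken in the extended reals. If one of
  the means is infinite then centring is meaningless and the value is \<open>\<infinity>\<close> by convention
  (the variables considered are nonnegative).\<close>

definition ext_mean :: "'w measure \<Rightarrow> ('w \<Rightarrow> real) \<Rightarrow> ereal" where
  "ext_mean M X =
     enn2ereal (\<integral>\<^sup>+\<omega>. ennreal (X \<omega>) \<partial>M) - enn2ereal (\<integral>\<^sup>+\<omega>. ennreal (- X \<omega>) \<partial>M)"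

definition ext_cov :: "'w measure \<Rightarrow> ('w \<Rightarrow> real) \<Rightarrow> ('w \<Rightarrow> real) \<Rightarrow> ereal" where
  "ext_cov M X Y =
     (if integrable M X \<and> integrable M Y
      then ext_mean M (\<lambda>\<omega>. (X \<omega> - integral\<^sup>L M X) * (Y \<omega> - integral\<^sup>L M Y))
      else \<infinity>)"

abbreviation ext_var :: "'w measure \<Rightarrow> ('w \<Rightarrow> real) \<Rightarrow> ereal" where
  "ext_var M X \<equiv> ext_cov M X X"

lemma ext_mean_eq_integral:
  assumes "integrable M X"
  shows "ext_mean M X = ereal (integral\<^sup>L M X)"
proof -
  have fin: "(\<integral>\<^sup>+\<omega>. ennreal (X \<omega>) \<partial>M) \<noteq> \<infinity>" "(\<integral>\<^sup>+\<omega>. ennreal (- X \<omega>) \<partial>M) \<noteq> \<infinity>"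
    using assms unfolding real_integrable_def by auto
  then obtain a b where ab: "0 \<le> a" "(\<integral>\<^sup>+\<omega>. ennreal (X \<omega>) \<partial>M) = ennreal a"
      "0 \<le> b" "(\<integral>\<^sup>+\<omega>. ennreal (- X \<omega>) \<partial>M) = ennreal b"
    by (metis ennreal_cases infinity_ennreal_def)
  show ?thesis
    unfolding ext_mean_def real_lebesgue_integral_def[OF assms]
    using ab by (simp add: enn2ereal_ennreal)
qed

lemma (in prob_space) ext_cov_eq_covariance:
  assumes "integrable M X" "integrable M Y" "integrable M (\<lambda>\<omega>. X \<omega> * Y \<omega>)"
  shows "ext_cov M X Y =
           ereal (expectation (\<lambda>\<omega>. (X \<omega> - expectation X) * (Y \<omega> - expectation Y)))"
proof -
  have "integrable M (\<lambda>\<omega>. X \<omega> * Y \<omega> - expectation Y * X \<omega> - expectation X * Y \<omega>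
          + expectation X * expectation Y)"
    using assms by auto
  then have "integrable M (\<lambda>\<omega>. (X \<omega> - expectation X) * (Y \<omega> - expectation Y))"
    by (simp add: algebra_simps)
  then show ?thesis
    using assms by (simp add: ext_cov_def ext_mean_eq_integral)
qed

lemma (in prob_space) ext_var_eq_variance:
  assumes "integrable M X" "integrable M (\<lambda>\<omega>. (X \<omega>)\<^sup>2)"
  shows "ext_var M X = ereal (variance X)"
  using ext_cov_eq_covariance[of X X] assms by (simp add: power2_eq_square)

end

theory Submission
  imports Defs
begin

text \<open>
  The functional is a sum of a weight \<open>F\<close> over the \<open>(k + 1)\<close>-point subsets of the process. The product
  of two such sums is a sum of \<open>F S * G T\<close> over pairs of subsets, sorted by the size \<open>m\<close> of \<open>S \<inter> T\<close>.
  A pair with overlap \<open>m\<close> is the image of an injective tuple of \<open>n = k\<^sub>1 + k\<^sub>2 + 2 - m\<close> points in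
  \<open>m! (k\<^sub>1 + 1 - m)! (k\<^sub>2 + 1 - m)!\<close> ways (\<open>card_overlap_fibre\<close>), and the expected sum of a function over
  the injective \<open>n\<close>-tuples of a Poisson process is \<open>t ^ n\<close> times its integral over \<open>W ^ n\<close>
  (\<open>campbell_formula\<close>). For \<open>m = 0\<close> the integral is the product of those that give the two means, so the
  covariance is the sum of the terms with \<open>m \<ge> 1\<close>.

  In such a term fix a common point \<open>y\<close> of the two simplices and substitute \<open>y + \<delta> x\<close> for every other
  point. Translation invariance and homogeneity of the volume turn the integrand into that of \<open>\<mu>\<close> and
  give the power of \<open>\<delta>\<close>. All points have distance at most \<open>\<delta>\<close> from \<open>y\<close>, so the condition that they lie
  in \<open>W\<close> is void if the ball of radius \<open>\<delta>\<close> around \<open>y\<close> is contained in \<open>W\<close>. Hence every term lies between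
  the claimed one multiplied by the volume of the set of these \<open>y\<close> and the claimed one multiplied by
  the volume \<open>1\<close> of \<open>W\<close> (\<open>intensity_scaling_bounds\<close>). The first volume tends to \<open>1\<close>, because the boundary
  of a convex set is a null set, and since it is the same for all \<open>m\<close> the sum of the terms has a common
  factor \<open>1 + o(1)\<close>.

  All integrals are taken in \<open>[0,\<infinity>]\<close>, and the estimates cover divergent \<open>\<mu>\<close> as well. Only the centring
  needs finite means. A mean is finite if the integral of the weight over simplices with one vertex
  at the origin is. The coefficient \<open>\<mu>\<close> for \<open>m = 1\<close> is the product of two such integrals, both
  positive, so an infinite mean makes the right-hand side infinite as well.

  The weight is a power of the \<open>k\<close>-dimensional volume, which has to be measurable in the vertices,
  homogeneous and positive on a set of positive measure. All this follows from the formula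
  \<open>k_volume_simplex\<close>: the volume is a constant divided by the Lebesgue measure of the set of all
  \<open>c \<in> \<real>\<^sup>k\<close> such that the linear combination of the edge vectors with coefficients \<open>c\<close> has norm at most \<open>1\<close>.
\<close>

section \<open>Linear parametrisations of a subspace\<close>

interpretation lborel_PiM: product_sigma_finite "\<lambda>_. lborel :: 'b::euclidean_space measure"
  by standard

text \<open>The same substitution rule serves for coordinate vectors and for tuples of points: it gives the
  translations and dilations of \<open>\<real>\<^sup>k\<close> and the localisation of an integral at a base point.\<close>

lemma nn_integral_PiM_lborel_affine:
  fixes a :: "'i \<Rightarrow> 'b::euclidean_space" and s :: real
  assumes [simp]: "finite I" and s: "s \<noteq> 0"
    and [measurable]: "f \<in> borel_measurable (\<Pi>\<^sub>M i\<in>I. lborel)"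
  shows "(\<integral>\<^sup>+x. f x \<partial>(\<Pi>\<^sub>M i\<in>I. lborel)) =
           ennreal (\<bar>s\<bar> ^ (DIM('b) * card I)) *
           (\<integral>\<^sup>+x. f (\<lambda>i\<in>I. a i + s *\<^sub>R x i) \<partial>(\<Pi>\<^sub>M i\<in>I. lborel))"
proof -
  let ?P = "\<Pi>\<^sub>M i\<in>I. (lborel :: 'b measure)"
  define T where "T = (\<lambda>x. \<lambda>i\<in>I. a i + s *\<^sub>R x i)"
  have [measurable]: "T \<in> measurable ?P ?P" unfolding T_def by measurable
  define c where "c = ennreal (\<bar>s\<bar> ^ DIM('b))"
  have ck: "ennreal (\<bar>s\<bar> ^ (DIM('b) * card I)) = c ^ card I"
    unfolding c_def by (simp add: power_mult ennreal_power)
  have one: "emeasure lborel A = c * emeasure lborel ((\<lambda>x. a i + s *\<^sub>R x) -` A)" if A[measurable]: "A \<in> sets lborel" for A :: "'b set" and i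
  proof -
    have "emeasure lborel A = emeasure (density (distr lborel borel (\<lambda>x. a i + s *\<^sub>R x)) (\<lambda>_. c)) A"
      using lborel_affine[OF s, of "a i"] unfolding c_def by simp
    also have "\<dots> = c * emeasure (distr lborel borel (\<lambda>x. a i + s *\<^sub>R x)) A"
      using A by (subst emeasure_density) (auto simp: nn_integral_cmult)
    also have "emeasure (distr lborel borel (\<lambda>x. a i + s *\<^sub>R x)) A = emeasure lborel ((\<lambda>x. a i + s *\<^sub>R x) -` A)"
      using A by (subst emeasure_distr) auto
    finally show ?thesis .
  qed
  have "density (distr ?P ?P T) (\<lambda>_. c ^ card I) = ?P"
  proof (rule lborel_PiM.PiM_eqI)
    fix A :: "'i \<Rightarrow> 'b set" assume A: "\<And>i. i \<in> I \<Longrightarrow> A i \<in> sets lborel"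
    have S: "Pi\<^sub>E I A \<in> sets ?P" using A by (intro sets_PiM_I_finite) auto
    have "emeasure (density (distr ?P ?P T) (\<lambda>_. c ^ card I)) (Pi\<^sub>E I A) = c ^ card I * emeasure (distr ?P ?P T) (Pi\<^sub>E I A)"
      using S by (subst emeasure_density) (auto simp: nn_integral_cmult)
    also have "emeasure (distr ?P ?P T) (Pi\<^sub>E I A) = emeasure ?P (T -` (Pi\<^sub>E I A) \<inter> space ?P)"
      using S by (subst emeasure_distr) auto
    also have "T -` (Pi\<^sub>E I A) \<inter> space ?P = (\<Pi>\<^sub>E i\<in>I. (\<lambda>x. a i + s *\<^sub>R x) -` A i)"
      by (auto simp: T_def space_PiM PiE_iff)
    also have "emeasure ?P \<dots> = (\<Prod>i\<in>I. emeasure lborel ((\<lambda>x. a i + s *\<^sub>R x) -` A i))"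
      using A by (intro lborel_PiM.emeasure_PiM) (auto intro!: measurable_sets_borel[of _ borel])
    also have "c ^ card I * \<dots> = (\<Prod>i\<in>I. emeasure lborel (A i))"
    proof -
      have "(\<Prod>i\<in>I. emeasure lborel (A i)) = (\<Prod>i\<in>I. c * emeasure lborel ((\<lambda>x. a i + s *\<^sub>R x) -` A i))"
        by (rule prod.cong) (auto intro: one A)
      then show ?thesis by (simp add: prod.distrib)
    qed
    finally show "emeasure (density (distr ?P ?P T) (\<lambda>_. c ^ card I)) (Pi\<^sub>E I A) = (\<Prod>i\<in>I. emeasure lborel (A i))" .
  qed auto
  then have "(\<integral>\<^sup>+x. f x \<partial>?P) = (\<integral>\<^sup>+x. f x \<partial>(density (distr ?P ?P T) (\<lambda>_. c ^ card I)))" by simp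
  also have "\<dots> = c ^ card I * (\<integral>\<^sup>+x. f (T x) \<partial>?P)"
    by (subst nn_integral_density) (auto simp: nn_integral_cmult nn_integral_distr)
  finally show ?thesis unfolding ck T_def .
qed

abbreviation coords :: "nat \<Rightarrow> (nat \<Rightarrow> real) measure" where
  "coords k \<equiv> \<Pi>\<^sub>M i\<in>{..<k}. lborel"

definition lincomb :: "nat \<Rightarrow> (nat \<Rightarrow> 'a::real_vector) \<Rightarrow> (nat \<Rightarrow> real) \<Rightarrow> 'a" where
  "lincomb k v c = (\<Sum>i<k. c i *\<^sub>R v i)"

lemma lincomb_measurable [measurable]:
  "lincomb k (v :: nat \<Rightarrow> 'a::euclidean_space) \<in> borel_measurable (coords k)"
  unfolding lincomb_def by measurable

lemma lincomb_add: "lincomb k v (\<lambda>i. c i + c' i) = lincomb k v c + lincomb k v c'"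
  by (simp add: lincomb_def scaleR_add_left sum.distrib)

lemma lincomb_restrict_add:
  "lincomb k v (\<lambda>i\<in>{..<k}. c i + c' i) = lincomb k v c + lincomb k v c'"
  by (simp add: lincomb_def scaleR_add_left sum.distrib)

lemma nn_integral_lincomb_translate:
  fixes v :: "nat \<Rightarrow> 'a::euclidean_space"
  assumes [measurable]: "f \<in> borel_measurable borel" 
  shows "(\<integral>\<^sup>+c. f (lincomb k v c) \<partial>coords k) = (\<integral>\<^sup>+c. f (lincomb k v a + lincomb k v c) \<partial>coords k)"
  using nn_integral_PiM_lborel_affine[of "{..<k}" 1 "\<lambda>c. f (lincomb k v c)" a]
  by (simp add: lincomb_restrict_add)

text \<open>Two parametrisations of the same subspace push Lebesgue measure to measures on it that are
  invariant under its translations, so the two measures are proportional. The proof integrates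
  \<open>1\<^sub>A x * 1\<^sub>B y\<close>, for the unit ball \<open>B\<close>, over both parametrisations: translate \<open>x\<close> by \<open>y\<close>, then \<open>y\<close> by \<open>- x\<close>,
  and use that \<open>B\<close> is symmetric.\<close>

lemma lincomb_exchange:
  fixes v b :: "nat \<Rightarrow> 'a::euclidean_space"
  assumes vb: "range (lincomb k v) = range (lincomb k b)"
    and A[measurable]: "A \<in> sets borel"
  shows "emeasure (coords k) {c \<in> space (coords k). lincomb k v c \<in> A} *
         emeasure (coords k) {c \<in> space (coords k). norm (lincomb k b c) \<le> 1} =
         emeasure (coords k) {c \<in> space (coords k). lincomb k b c \<in> A} *
         emeasure (coords k) {c \<in> space (coords k). norm (lincomb k v c) \<le> 1}"
proof -
  interpret pair_sigma_finite "coords k" "coords k"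
    by (intro pair_sigma_finite.intro lborel_PiM.sigma_finite) auto
  define B where "B = cball (0::'a) 1"
  have B[measurable]: "B \<in> sets borel" unfolding B_def by simp
  have sym: "x - y \<in> B \<longleftrightarrow> y - x \<in> B" for x y by (simp add: B_def norm_minus_commute)
  have *: "(\<integral>\<^sup>+c. indicator S (lincomb k u c) \<partial>coords k) = emeasure (coords k) {c \<in> space (coords k). lincomb k u c \<in> S}"
    if [measurable]: "S \<in> sets borel" for S and u :: "nat \<Rightarrow> 'a"
  proof -
    have "(\<integral>\<^sup>+c. indicator S (lincomb k u c) \<partial>coords k) =
          (\<integral>\<^sup>+c. indicator {c \<in> space (coords k). lincomb k u c \<in> S} c \<partial>coords k)"
      by (intro nn_integral_cong) (simp split: split_indicator)
    then show ?thesis by simp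
  qed
  have "(\<integral>\<^sup>+c. indicator A (lincomb k v c) \<partial>coords k) * (\<integral>\<^sup>+e. indicator B (lincomb k b e) \<partial>coords k) =
      (\<integral>\<^sup>+e. (\<integral>\<^sup>+c. indicator A (lincomb k v c) \<partial>coords k) * indicator B (lincomb k b e) \<partial>coords k)"
    by (rule nn_integral_cmult[symmetric]) measurable
  also have "\<dots> = (\<integral>\<^sup>+e. (\<integral>\<^sup>+c. indicator A (lincomb k b e + lincomb k v c) \<partial>coords k) * indicator B (lincomb k b e) \<partial>coords k)"
  proof (rule nn_integral_cong)
    fix e
    from vb obtain a where "lincomb k b e = lincomb k v a" by (metis rangeE rangeI)
    then show "(\<integral>\<^sup>+c. indicator A (lincomb k v c) \<partial>coords k) * indicator B (lincomb k b e) = (\<integral>\<^sup>+c. indicator A (lincomb k b e + lincomb k v c) \<partial>coords k) * indicator B (lincomb k b e)"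
      using nn_integral_lincomb_translate[of "indicator A" k v a] by simp
  qed
  also have "\<dots> = (\<integral>\<^sup>+e. (\<integral>\<^sup>+c. indicator A (lincomb k b e + lincomb k v c) * indicator B (lincomb k b e) \<partial>coords k) \<partial>coords k)"
    by (intro nn_integral_cong nn_integral_multc[symmetric]) measurable
  also have "\<dots> = (\<integral>\<^sup>+c. (\<integral>\<^sup>+e. indicator A (lincomb k b e + lincomb k v c) * indicator B (lincomb k b e) \<partial>coords k) \<partial>coords k)"
    by (rule Fubini') measurable
  also have "\<dots> = (\<integral>\<^sup>+c. (\<integral>\<^sup>+e. indicator A (lincomb k b e) * indicator B (lincomb k b e - lincomb k v c) \<partial>coords k) \<partial>coords k)"
  proof (rule nn_integral_cong)
    fix c
    from vb obtain a where a: "lincomb k v c = lincomb k b a" by (metis rangeE rangeI)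
    show "(\<integral>\<^sup>+e. indicator A (lincomb k b e + lincomb k v c) * indicator B (lincomb k b e) \<partial>coords k) =
          (\<integral>\<^sup>+e. indicator A (lincomb k b e) * indicator B (lincomb k b e - lincomb k v c) \<partial>coords k)"
      using nn_integral_lincomb_translate[of "\<lambda>x. indicator A x * indicator B (x - lincomb k v c)" k b a] a
      by (simp add: add.commute)
  qed
  also have "\<dots> = (\<integral>\<^sup>+e. (\<integral>\<^sup>+c. indicator A (lincomb k b e) * indicator B (lincomb k b e - lincomb k v c) \<partial>coords k) \<partial>coords k)"
    by (rule Fubini'[symmetric]) measurable
  also have "\<dots> = (\<integral>\<^sup>+e. indicator A (lincomb k b e) * (\<integral>\<^sup>+c. indicator B (lincomb k b e - lincomb k v c) \<partial>coords k) \<partial>coords k)"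
    by (intro nn_integral_cong nn_integral_cmult) measurable
  also have "\<dots> = (\<integral>\<^sup>+e. indicator A (lincomb k b e) * (\<integral>\<^sup>+c. indicator B (lincomb k v c) \<partial>coords k) \<partial>coords k)"
  proof (rule nn_integral_cong)
    fix e
    from vb obtain a where a: "lincomb k b e = lincomb k v a" by (metis rangeE rangeI)
    have "(\<integral>\<^sup>+c. indicator B (lincomb k b e - lincomb k v c) \<partial>coords k) = (\<integral>\<^sup>+c. indicator B (lincomb k v c - lincomb k b e) \<partial>coords k)"
      by (intro nn_integral_cong) (simp add: indicator_def sym)
    also have "\<dots> = (\<integral>\<^sup>+c. indicator B (lincomb k v c) \<partial>coords k)"
      using nn_integral_lincomb_translate[of "\<lambda>x. indicator B (x - lincomb k b e)" k v a] a by simp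
    finally show "indicator A (lincomb k b e) * (\<integral>\<^sup>+c. indicator B (lincomb k b e - lincomb k v c) \<partial>coords k) = indicator A (lincomb k b e) * (\<integral>\<^sup>+c. indicator B (lincomb k v c) \<partial>coords k)" by simp
  qed
  also have "\<dots> = (\<integral>\<^sup>+e. indicator A (lincomb k b e) \<partial>coords k) * (\<integral>\<^sup>+c. indicator B (lincomb k v c) \<partial>coords k)"
    by (rule nn_integral_multc) measurable
  finally show ?thesis by (simp add: * B_def)
qed

text \<open>Independence of the indexed family: a repeated vector makes it dependent.\<close>

definition lin_indep :: "nat \<Rightarrow> (nat \<Rightarrow> 'a::real_vector) \<Rightarrow> bool" where
  "lin_indep k v \<longleftrightarrow> (\<forall>c. lincomb k v c = 0 \<longrightarrow> (\<forall>i<k. c i = 0))"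

definition orthonormal_frame :: "nat \<Rightarrow> (nat \<Rightarrow> 'a::real_inner) \<Rightarrow> bool" where
  "orthonormal_frame k b \<longleftrightarrow> (\<forall>i<k. \<forall>j<k. b i \<bullet> b j = (if i = j then 1 else 0))"

lemma lincomb_diff: "lincomb k v (\<lambda>i. c i - c' i) = lincomb k v c - lincomb k v c'"
  by (simp add: lincomb_def scaleR_diff_left sum_subtractf)

lemma lincomb_scale: "lincomb k v (\<lambda>i. r * c i) = r *\<^sub>R lincomb k v c"
  by (simp add: lincomb_def scaleR_sum_right)

lemma lincomb_indep_inj:
  assumes "lin_indep k v" "lincomb k v c = lincomb k v c'" "i < k"
  shows "c i = c' i"
proof -
  have "lincomb k v (\<lambda>i. c i - c' i) = 0" using assms by (simp add: lincomb_diff)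
  then show ?thesis using assms unfolding lin_indep_def by fastforce
qed

lemma range_lincomb: "range (lincomb k v) = span (v ` {..<k})"
proof
  show "range (lincomb k v) \<subseteq> span (v ` {..<k})"
    unfolding lincomb_def by (intro image_subsetI span_sum span_scale span_base imageI)
  show "span (v ` {..<k}) \<subseteq> range (lincomb k v)"
  proof (rule span_minimal)
    show "v ` {..<k} \<subseteq> range (lincomb k v)"
    proof (rule image_subsetI)
      fix i assume "i \<in> {..<k}"
      then have "v i = lincomb k v (\<lambda>j. if j = i then 1 else 0)"
        by (simp add: lincomb_def if_distrib[of "\<lambda>x. x *\<^sub>R _"] sum.delta cong: if_cong)
      then show "v i \<in> range (lincomb k v)" by blast
    qed
    show "subspace (range (lincomb k v))"
    proof (rule subspaceI)
      have "lincomb k v (\<lambda>_. 0) = 0" by (simp add: lincomb_def)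
      then show "0 \<in> range (lincomb k v)" by (metis rangeI)
    next
      fix x y assume "x \<in> range (lincomb k v)" "y \<in> range (lincomb k v)"
      then show "x + y \<in> range (lincomb k v)" by (auto simp flip: lincomb_add)
    next
      fix c x assume "x \<in> range (lincomb k v)"
      then show "c *\<^sub>R x \<in> range (lincomb k v)" by (auto simp flip: lincomb_scale)
    qed
  qed
qed

lemma dim_lin_indep:
  fixes v :: "nat \<Rightarrow> 'a::euclidean_space"
  assumes "lin_indep k v"
  shows "dim (v ` {..<k}) = k"
proof -
  have single: "v i = lincomb k v (\<lambda>j. if j = i then 1 else 0)" if "i < k" for i
    using that by (simp add: lincomb_def if_distrib[of "\<lambda>x. x *\<^sub>R _"] sum.delta cong: if_cong)
  have inj: "inj_on v {..<k}"
  proof (rule inj_onI)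
    fix i j assume ij: "i \<in> {..<k}" "j \<in> {..<k}" "v i = v j"
    then have "lincomb k v (\<lambda>l. if l = i then 1 else 0) = lincomb k v (\<lambda>l. if l = j then 1 else 0)"
      using single by auto
    from lincomb_indep_inj[OF assms this, of i] ij show "i = j" by (auto split: if_splits)
  qed
  have "independent (v ` {..<k})"
  proof -
    have "\<forall>x\<in>v ` {..<k}. u x = 0" if u: "(\<Sum>x\<in>v ` {..<k}. u x *\<^sub>R x) = 0" for u
    proof -
      have "lincomb k v (\<lambda>i. u (v i)) = 0"
        using u inj by (simp add: lincomb_def sum.reindex)
      then show ?thesis using assms unfolding lin_indep_def by auto
    qed
    then show ?thesis by (subst independent_explicit) auto
  qed
  then show ?thesis using inj by (simp add: dim_eq_card_independent card_image)
qed

lemma frame_inner_lincomb: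
  assumes "orthonormal_frame k b" "i < k"
  shows "lincomb k b c \<bullet> b i = c i"
  using assms by (simp add: lincomb_def inner_sum_left orthonormal_frame_def if_distrib[of "(*) _"] sum.delta cong: if_cong)

lemma frame_lin_indep: "orthonormal_frame k b \<Longrightarrow> lin_indep k b"
  unfolding lin_indep_def by (metis frame_inner_lincomb inner_zero_left)

lemma frame_norm_lincomb:
  assumes "orthonormal_frame k b"
  shows "norm (lincomb k b c) ^ 2 = (\<Sum>i<k. (c i)\<^sup>2)"
proof -
  have "norm (lincomb k b c) ^ 2 = lincomb k b c \<bullet> (\<Sum>i<k. c i *\<^sub>R b i)"
    by (simp add: power2_norm_eq_inner lincomb_def)
  also have "\<dots> = (\<Sum>i<k. (c i)\<^sup>2)"
    by (simp add: inner_sum_right frame_inner_lincomb[OF assms] power2_eq_square)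
  finally show ?thesis .
qed

text \<open>A basis of the span is extended to \<open>k\<close> independent vectors, whose span has an orthonormal basis.\<close>

lemma frame_exists:
  fixes v :: "nat \<Rightarrow> 'a::euclidean_space"
  assumes "k \<le> DIM('a)"
  shows "\<exists>b. orthonormal_frame k b \<and> range (lincomb k v) \<subseteq> range (lincomb k b)"
proof -
  obtain B where B: "B \<subseteq> span (v ` {..<k})" "independent B" "span (v ` {..<k}) \<subseteq> span B"
      "card B = dim (span (v ` {..<k}))"
    by (rule basis_exists[of "span (v ` {..<k})"])
  have cB: "card B \<le> k"
    using dim_le_card'[of "v ` {..<k}"] card_image_le[of "{..<k}" v] B(4) by (simp add: dim_span)
  obtain C where C: "B \<subseteq> C" "independent C" "UNIV \<subseteq> span C"
    by (rule maximal_independent_subset_extend[OF subset_UNIV B(2)])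
  have fC: "finite C" using C(2) independent_bound by blast
  have "card C = DIM('a)"
  proof -
    have "span C = UNIV" using C(3) by auto
    then have "dim C = DIM('a)" by (metis dim_UNIV dim_span)
    then show ?thesis using dim_eq_card_independent[OF C(2)] by simp
  qed
  then obtain T where T: "B \<subseteq> T" "T \<subseteq> C" "card T = k"
    using exists_subset_between[of B k C] cB assms C(1) fC by metis
  have dT: "dim (span T) = k"
    using dim_eq_card_independent[OF independent_mono[OF C(2) T(2)]] T(3) by (simp add: dim_span)
  obtain E where E: "pairwise orthogonal E" "\<And>x. x \<in> E \<Longrightarrow> norm x = 1"
     "independent E" "card E = k" "span E = span T"
  proof (rule orthonormal_basis_subspace[OF subspace_span[of T]])
    fix E assume "pairwise orthogonal E" "\<And>x. x \<in> E \<Longrightarrow> norm x = 1" "independent E"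
      "card E = dim (span T)" "span E = span T"
    then show thesis using that[of E] dT by simp
  qed
  have "finite E" using E(3) independent_bound by blast
  then obtain b where b: "bij_betw b {..<k} E"
    using ex_bij_betw_nat_finite[of E] unfolding E(4) atLeast0LessThan by blast
  have "orthonormal_frame k b"
    unfolding orthonormal_frame_def
  proof (intro allI impI)
    fix i j assume ij: "i < k" "j < k"
    then have bE: "b i \<in> E" "b j \<in> E" using bij_betwE[OF b] by auto
    show "b i \<bullet> b j = (if i = j then 1 else 0)"
    proof (cases "i = j")
      case True then show ?thesis using E(2)[OF bE(1)] by (simp add: norm_eq_1)
    next
      case False
      then have "b i \<noteq> b j" using inj_on_contraD[OF bij_betw_imp_inj_on[OF b]] ij by simp
      then show ?thesis using False pairwiseD[OF E(1) bE] by (simp add: orthogonal_def)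
    qed
  qed
  moreover have "range (lincomb k v) \<subseteq> range (lincomb k b)"
  proof -
    have "b ` {..<k} = E" using b by (simp add: bij_betw_def)
    moreover have "span (v ` {..<k}) \<subseteq> span T"
      using B(3) span_mono[OF T(1)] by blast
    ultimately show ?thesis using E(5) by (simp add: range_lincomb)
  qed
  ultimately show ?thesis by blast
qed

lemma emeasure_coords_box:
  assumes "\<And>i. i < k \<Longrightarrow> l i \<le> u i"
  shows "(\<Pi>\<^sub>E i\<in>{..<k}. {l i..u i}) \<in> sets (coords k)"
    and "emeasure (coords k) (\<Pi>\<^sub>E i\<in>{..<k}. {l i..u i}) = (\<Prod>i<k. ennreal (u i - l i))"
proof -
  show "emeasure (coords k) (\<Pi>\<^sub>E i\<in>{..<k}. {l i..u i}) = (\<Prod>i<k. ennreal (u i - l i))"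
    using assms by (subst lborel_PiM.emeasure_PiM) (auto intro!: prod.cong)
  show "(\<Pi>\<^sub>E i\<in>{..<k}. {l i..u i}) \<in> sets (coords k)"
    by (intro sets_PiM_I_finite) auto
qed

text \<open>Its measure is inversely proportional to the volume of the parallelepiped spanned by \<open>v\<close>, and it is
  infinite if and only if \<open>v\<close> is dependent. So it plays the part of a Gram determinant that needs no
  choice of coordinates.\<close>

definition unit_preimage :: "nat \<Rightarrow> (nat \<Rightarrow> 'a::real_normed_vector) \<Rightarrow> (nat \<Rightarrow> real) set" where
  "unit_preimage k v = {c \<in> space (coords k). norm (lincomb k v c) \<le> 1}"

lemma unit_preimage_sets [measurable, simp]:
  "unit_preimage k (v :: nat \<Rightarrow> 'a::euclidean_space) \<in> sets (coords k)"
  unfolding unit_preimage_def by measurable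

lemma norm_lincomb_le: "norm (lincomb k v c) \<le> (\<Sum>i<k. \<bar>c i\<bar> * norm (v i))"
  unfolding lincomb_def by (rule order_trans[OF norm_sum]) simp

lemma unit_preimage_box:
  fixes v :: "nat \<Rightarrow> 'a::euclidean_space"
  obtains r where "r > 0" "r < 1" "(\<Pi>\<^sub>E i\<in>{..<k}. {0..r}) \<subseteq> unit_preimage k v"
proof
  define N where "N = (\<Sum>i<k. norm (v i))"
  define r where "r = 1 / (2 + N)"
  have N: "N \<ge> 0" unfolding N_def by (intro sum_nonneg) auto
  show "r > 0" "r < 1" using N by (auto simp: r_def)
  show "(\<Pi>\<^sub>E i\<in>{..<k}. {0..r}) \<subseteq> unit_preimage k v"
  proof
    fix c assume c: "c \<in> (\<Pi>\<^sub>E i\<in>{..<k}. {0..r})"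
    have "norm (lincomb k v c) \<le> (\<Sum>i<k. \<bar>c i\<bar> * norm (v i))" by (rule norm_lincomb_le)
    also have "\<dots> \<le> (\<Sum>i<k. r * norm (v i))"
      using c by (intro sum_mono mult_right_mono) (auto simp: PiE_iff)
    also have "\<dots> = r * N" by (simp add: N_def sum_distrib_left)
    also have "\<dots> \<le> 1" using N by (simp add: r_def)
    finally show "c \<in> unit_preimage k v" using c by (auto simp: unit_preimage_def space_PiM PiE_iff)
  qed
qed

lemma emeasure_unit_preimage_pos:
  fixes v :: "nat \<Rightarrow> 'a::euclidean_space"
  shows "emeasure (coords k) (unit_preimage k v) > 0"
proof -
  obtain r where r: "r > 0" "r < 1" "(\<Pi>\<^sub>E i\<in>{..<k}. {0..r}) \<subseteq> unit_preimage k v"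
    by (rule unit_preimage_box)
  have "0 < (\<Prod>i<k. ennreal (r - 0))" using r by (simp add: ennreal_power)
  also have "\<dots> = emeasure (coords k) (\<Pi>\<^sub>E i\<in>{..<k}. {0..r})"
    using r by (intro emeasure_coords_box(2)[symmetric]) auto
  also have "\<dots> \<le> emeasure (coords k) (unit_preimage k v)"
    using r by (intro emeasure_mono) auto
  finally show ?thesis .
qed

lemma emeasure_unit_preimage_finite:
  fixes v :: "nat \<Rightarrow> 'a::euclidean_space"
  assumes "\<And>c i. norm (lincomb k v c) \<le> 1 \<Longrightarrow> i < k \<Longrightarrow> \<bar>c i\<bar> \<le> K"
  shows "emeasure (coords k) (unit_preimage k v) < \<infinity>"
proof -
  have sub: "unit_preimage k v \<subseteq> (\<Pi>\<^sub>E i\<in>{..<k}. {-\<bar>K\<bar>..\<bar>K\<bar>})"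
  proof
    fix c assume c: "c \<in> unit_preimage k v"
    then have "\<bar>c i\<bar> \<le> K" if "i < k" for i using assms that by (auto simp: unit_preimage_def)
    then have "- \<bar>K\<bar> \<le> c i \<and> c i \<le> \<bar>K\<bar>" if "i < k" for i using that by fastforce
    then show "c \<in> (\<Pi>\<^sub>E i\<in>{..<k}. {-\<bar>K\<bar>..\<bar>K\<bar>})"
      using c by (auto simp: unit_preimage_def space_PiM PiE_iff)
  qed
  have "emeasure (coords k) (unit_preimage k v) \<le> emeasure (coords k) (\<Pi>\<^sub>E i\<in>{..<k}. {-\<bar>K\<bar>..\<bar>K\<bar>})"
    using sub by (intro emeasure_mono emeasure_coords_box) auto
  also have "\<dots> = (\<Prod>i<k. ennreal (\<bar>K\<bar> - -\<bar>K\<bar>))" by (rule emeasure_coords_box(2)) auto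
  also have "\<dots> < \<infinity>" by (simp add: power_less_top_ennreal)
  finally show ?thesis .
qed

lemma frame_unit_preimage_finite:
  fixes b :: "nat \<Rightarrow> 'a::euclidean_space"
  assumes "orthonormal_frame k b"
  shows "emeasure (coords k) (unit_preimage k b) < \<infinity>"
proof (rule emeasure_unit_preimage_finite[where K=1])
  fix c i assume c: "norm (lincomb k b c) \<le> 1" "i < k"
  have "norm (b i) = 1" using assms c by (simp add: orthonormal_frame_def norm_eq_1)
  then show "\<bar>c i\<bar> \<le> 1"
    using Cauchy_Schwarz_ineq2[of "lincomb k b c" "b i"] c frame_inner_lincomb[OF assms c(2), of c] by simp
qed

text \<open>Each coordinate with respect to an independent family is a linear function of the inner products
  with the frame, and these are at most \<open>1\<close> in absolute value on the unit ball.\<close>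

lemma indep_unit_preimage_finite:
  fixes v :: "nat \<Rightarrow> 'a::euclidean_space"
  assumes b: "orthonormal_frame k b" and v: "lin_indep k v"
    and r: "range (lincomb k v) = range (lincomb k b)"
  shows "emeasure (coords k) (unit_preimage k v) < \<infinity>"
proof -
  have "\<exists>a. \<forall>j<k. b j = lincomb k v (a j)"
  proof -
    have "b j \<in> range (lincomb k b)" if "j < k" for j
      unfolding range_lincomb by (rule span_base) (use that in simp)
    then have "b j \<in> range (lincomb k v)" if "j < k" for j using r that by simp
    then have "\<forall>j. \<exists>a. j < k \<longrightarrow> b j = lincomb k v a" by blast
    then show ?thesis by metis
  qed
  then obtain a where a: "\<And>j. j < k \<Longrightarrow> b j = lincomb k v (a j)" by blast
  define K where "K = (\<Sum>i<k. \<Sum>j<k. \<bar>a j i\<bar>)"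
  show ?thesis
  proof (rule emeasure_unit_preimage_finite[where K=K])
    fix c i assume c: "norm (lincomb k v c) \<le> 1" "i < k"
    define e where "e = (\<lambda>j. lincomb k v c \<bullet> b j)"
    obtain e' where e': "lincomb k v c = lincomb k b e'" using r by blast
    have ee: "e j = e' j" if "j < k" for j
      unfolding e_def e' using frame_inner_lincomb[OF b that] .
    have "lincomb k b e' = (\<Sum>j<k. e j *\<^sub>R b j)"
      unfolding lincomb_def using ee by (intro sum.cong) auto
    then have "lincomb k v c = (\<Sum>j<k. e j *\<^sub>R b j)" using e' by simp
    also have "\<dots> = (\<Sum>j<k. e j *\<^sub>R lincomb k v (a j))" using a by (intro sum.cong) auto
    also have "\<dots> = lincomb k v (\<lambda>i. \<Sum>j<k. e j * a j i)"
      unfolding lincomb_def by (simp add: scaleR_sum_left scaleR_sum_right) (rule sum.swap)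
    finally have ci: "c i = (\<Sum>j<k. e j * a j i)" using lincomb_indep_inj[OF v _ c(2)] by blast
    have e1: "\<bar>e j\<bar> \<le> 1" if "j < k" for j
    proof -
      have "norm (b j) = 1" using b that by (simp add: orthonormal_frame_def norm_eq_1)
      then show ?thesis
        unfolding e_def using Cauchy_Schwarz_ineq2[of "lincomb k v c" "b j"] c(1) by simp
    qed
    have "\<bar>c i\<bar> \<le> (\<Sum>j<k. \<bar>e j * a j i\<bar>)" unfolding ci by (rule sum_abs)
    also have "\<dots> \<le> (\<Sum>j<k. \<bar>a j i\<bar>)"
      using e1 by (intro sum_mono) (auto simp: abs_mult intro: mult_left_le_one_le)
    also have "\<dots> \<le> K" unfolding K_def
      using c(2) by (intro member_le_sum[of i "{..<k}" "\<lambda>i. \<Sum>j<k. \<bar>a j i\<bar>"]) (auto intro: sum_nonneg)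
    finally show "\<bar>c i\<bar> \<le> K" .
  qed
qed

text \<open>The set is invariant under translation by a linear relation, so that it contains infinitely many
  disjoint translates of a small box.\<close>

lemma dep_unit_preimage_infinite:
  fixes v :: "nat \<Rightarrow> 'a::euclidean_space"
  assumes "\<not> lin_indep k v"
  shows "emeasure (coords k) (unit_preimage k v) = \<infinity>"
proof -
  obtain a0 i0 where a0: "lincomb k v a0 = 0" "i0 < k" "a0 i0 \<noteq> 0"
    using assms unfolding lin_indep_def by blast
  define a where "a i = 1 / a0 i0 * a0 i" for i
  have a: "lincomb k v a = 0" "a i0 = 1" unfolding a_def using a0 by (simp_all only: lincomb_scale) auto
  obtain r where r: "r > 0" "r < 1" "(\<Pi>\<^sub>E i\<in>{..<k}. {0..r}) \<subseteq> unit_preimage k v"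
    by (rule unit_preimage_box)
  \<comment> \<open>The boxes are disjoint because coordinate \<open>i0\<close> of \<open>a\<close> is \<open>1\<close> and \<open>r < 1\<close>.\<close>
  define U where "U n = (\<Pi>\<^sub>E i\<in>{..<k}. {real n * a i..real n * a i + r})" for n :: nat
  have U: "U n \<in> sets (coords k)" "emeasure (coords k) (U n) = ennreal r ^ k" for n
    unfolding U_def using r emeasure_coords_box[of k "\<lambda>i. real n * a i" "\<lambda>i. real n * a i + r"] by auto
  have Usub: "U n \<subseteq> unit_preimage k v" for n
  proof
    fix c assume c: "c \<in> U n"
    define c' where "c' = (\<lambda>i\<in>{..<k}. c i - real n * a i)"
    have "c' \<in> (\<Pi>\<^sub>E i\<in>{..<k}. {0..r})" using c by (simp add: U_def c'_def PiE_iff diff_le_eq add.commute)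
    then have "norm (lincomb k v c') \<le> 1" using r by (auto simp: unit_preimage_def)
    moreover have "lincomb k v c' = lincomb k v (\<lambda>i. c i - real n * a i)" by (simp add: lincomb_def c'_def)
    moreover have "\<dots> = lincomb k v c" by (simp add: lincomb_diff lincomb_scale a)
    ultimately show "c \<in> unit_preimage k v" using c by (auto simp: U_def unit_preimage_def space_PiM PiE_iff)
  qed
  have disj: "disjoint_family U"
    unfolding disjoint_family_on_def
  proof (intro ballI impI)
    fix m n :: nat assume "m \<noteq> n"
    have False if "c \<in> U m" "c \<in> U n" for c
    proof -
      have "c i0 \<in> {real m..real m + r}" "c i0 \<in> {real n..real n + r}"
        using that a0(2) a(2) by (auto simp: U_def PiE_iff dest: bspec[of _ _ i0])
      then show False using \<open>m \<noteq> n\<close> r(2) by auto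
    qed
    then show "U m \<inter> U n = {}" by blast
  qed
  have "\<infinity> = (\<Sum>n. emeasure (coords k) (U n))"
  proof -
    have "ennreal r ^ k \<noteq> 0" using r by simp
    then show ?thesis unfolding U
      by (simp add: suminf_eq_SUP SUP_mult_right_ennreal[symmetric] ennreal_SUP_of_nat_eq_top ennreal_top_mult)
  qed
  also have "\<dots> = emeasure (coords k) (\<Union>n. U n)"
    using U disj by (intro suminf_emeasure) auto
  also have "\<dots> \<le> emeasure (coords k) (unit_preimage k v)"
    using Usub by (intro emeasure_mono) auto
  finally show ?thesis by (simp add: top.extremum_unique)
qed

lemma emeasure_hyperplane_coords:
  assumes "i0 < k" "w i0 \<noteq> (0::real)"
  shows "emeasure (coords k) {c \<in> space (coords k). (\<Sum>i<k. c i * w i) = \<beta>} = 0"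
proof -
  let ?I = "{..<k} - {i0}"
  have ins: "insert i0 ?I = {..<k}" using assms by auto
  define H where "H = {c \<in> space (coords k). (\<Sum>i<k. c i * w i) = \<beta>}"
  have [measurable]: "H \<in> sets (coords k)" unfolding H_def by measurable
  have H': "H \<in> sets (\<Pi>\<^sub>M i\<in>insert i0 ?I. lborel)" unfolding ins by measurable
  have "emeasure (coords k) H = (\<integral>\<^sup>+c. indicator H c \<partial>(\<Pi>\<^sub>M i\<in>insert i0 ?I. lborel))"
    unfolding ins by simp
  also have "\<dots> = (\<integral>\<^sup>+x. (\<integral>\<^sup>+y. indicator H (x(i0 := y)) \<partial>lborel) \<partial>(\<Pi>\<^sub>M i\<in>?I. lborel))"
    by (rule lborel_PiM.product_nn_integral_insert) (use H' in simp_all)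
  also have "\<dots> = (\<integral>\<^sup>+x. 0 \<partial>(\<Pi>\<^sub>M i\<in>?I. (lborel :: real measure)))"
  proof (rule nn_integral_cong)
    fix x assume x: "x \<in> space (\<Pi>\<^sub>M i\<in>?I. (lborel :: real measure))"
    define y0 where "y0 = (\<beta> - (\<Sum>i\<in>?I. x i * w i)) / w i0"
    have "(\<integral>\<^sup>+y. indicator H (x(i0 := y)) \<partial>lborel) \<le> (\<integral>\<^sup>+y. indicator {y0} y \<partial>lborel)"
    proof (rule nn_integral_mono)
      fix y
      have "y = y0" if "x(i0 := y) \<in> H"
      proof -
        have "(\<Sum>i<k. (x(i0 := y)) i * w i) = y * w i0 + (\<Sum>i\<in>?I. (x(i0 := y)) i * w i)"
          using assms(1) by (subst sum.remove[of _ i0]) simp_all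
        also have "(\<Sum>i\<in>?I. (x(i0 := y)) i * w i) = (\<Sum>i\<in>?I. x i * w i)" by (intro sum.cong) auto
        finally have "y * w i0 = \<beta> - (\<Sum>i\<in>?I. x i * w i)" using that by (simp add: H_def)
        then show "y = y0" unfolding y0_def using assms(2) by (metis nonzero_mult_div_cancel_right)
      qed
      then show "indicator H (x(i0 := y)) \<le> (indicator {y0} y :: ennreal)"
        by (cases "x(i0 := y) \<in> H") simp_all
    qed
    also have "\<dots> = 0" by simp
    finally show "(\<integral>\<^sup>+y. indicator H (x(i0 := y)) \<partial>lborel) = 0" by simp
  qed
  finally show ?thesis by (simp add: H_def)
qed

section \<open>The volume of a simplex\<close>

text \<open>The factors are the volume \<open>1 / k!\<close> of the standard simplex and the volume of the unit ball of \<open>\<real>\<^sup>k\<close>.\<close>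

definition simplex_const :: "nat \<Rightarrow> real" where
  "simplex_const k =
     measure (coords k) {c \<in> space (coords k). (\<forall>i<k. 0 \<le> c i) \<and> (\<Sum>i<k. c i) \<le> 1} *
     measure (coords k) {c \<in> space (coords k). (\<Sum>i<k. (c i)\<^sup>2) \<le> 1}"

lemma convex_hull_lincomb:
  fixes x :: "nat \<Rightarrow> 'a::euclidean_space"
  shows "convex hull (x ` {..k}) =
    {x 0 + lincomb k (\<lambda>i. x (Suc i) - x 0) c |c. (\<forall>i<k. 0 \<le> c i) \<and> (\<Sum>i<k. c i) \<le> 1}" (is "_ = ?R")
proof
  show "convex hull (x ` {..k}) \<subseteq> ?R"
  proof (rule hull_minimal)
    show "x ` {..k} \<subseteq> ?R"
    proof (rule image_subsetI)
      fix j assume j: "j \<in> {..k}"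
      show "x j \<in> ?R"
      proof (cases j)
        case 0
        then show ?thesis by (intro CollectI exI[of _ "\<lambda>_. 0"]) (simp add: lincomb_def)
      next
        case (Suc i)
        then show ?thesis using j
          by (intro CollectI exI[of _ "\<lambda>l. if l = i then 1 else 0"])
            (auto simp: lincomb_def if_distrib[of "\<lambda>x. x *\<^sub>R _"] sum.delta cong: if_cong)
      qed
    qed
    show "convex ?R"
    proof (rule convexI)
      fix y z and u v :: real assume uv: "0 \<le> u" "0 \<le> v" "u + v = 1" and "y \<in> ?R" "z \<in> ?R"
      then obtain c e where c: "y = x 0 + lincomb k (\<lambda>i. x (Suc i) - x 0) c" "\<forall>i<k. 0 \<le> c i" "(\<Sum>i<k. c i) \<le> 1"
        and e: "z = x 0 + lincomb k (\<lambda>i. x (Suc i) - x 0) e" "\<forall>i<k. 0 \<le> e i" "(\<Sum>i<k. e i) \<le> 1" by blast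
      have "u *\<^sub>R y + v *\<^sub>R z = (u + v) *\<^sub>R x 0 + lincomb k (\<lambda>i. x (Suc i) - x 0) (\<lambda>i. u * c i + v * e i)"
        by (simp add: c(1) e(1) lincomb_add lincomb_scale algebra_simps)
      moreover have "(\<Sum>i<k. u * c i + v * e i) \<le> 1"
      proof -
        have "(\<Sum>i<k. u * c i + v * e i) = u * (\<Sum>i<k. c i) + v * (\<Sum>i<k. e i)"
          by (simp add: sum.distrib sum_distrib_left)
        also have "\<dots> \<le> u * 1 + v * 1" using uv c e by (intro add_mono mult_left_mono) auto
        finally show ?thesis using uv by simp
      qed
      ultimately show "u *\<^sub>R y + v *\<^sub>R z \<in> ?R" using uv c e
        by (intro CollectI exI[of _ "\<lambda>i. u * c i + v * e i"]) auto
    qed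
  qed
  show "?R \<subseteq> convex hull (x ` {..k})"
  proof safe
    fix c assume c: "\<forall>i<k. 0 \<le> c i" "(\<Sum>i<k. c i) \<le> (1::real)"
    define u where "u i = (case i of 0 \<Rightarrow> 1 - (\<Sum>i<k. c i) | Suc j \<Rightarrow> c j)" for i
    have u0: "u 0 = 1 - (\<Sum>i<k. c i)" and uS: "u (Suc i) = c i" for i by (auto simp: u_def)
    have "(\<Sum>i\<le>k. u i *\<^sub>R x i) \<in> convex hull (x ` {..k})"
    proof (rule convex_sum)
      show "sum u {..k} = 1" by (subst sum.atMost_shift) (simp add: u0 uS)
      show "0 \<le> u i" if "i \<in> {..k}" for i using that c by (cases i) (auto simp: u0 uS)
    qed (auto intro: hull_inc)
    also have "(\<Sum>i\<le>k. u i *\<^sub>R x i) = x 0 + lincomb k (\<lambda>i. x (Suc i) - x 0) c"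
      by (subst sum.atMost_shift)
        (simp add: u0 uS lincomb_def scaleR_diff_left scaleR_diff_right sum_subtractf scaleR_sum_left)
    finally show "x 0 + lincomb k (\<lambda>i. x (Suc i) - x 0) c \<in> convex hull (x ` {..k})" .
  qed
qed

text \<open>If the edge vectors are independent then the simplex is, in edge coordinates, the standard simplex,
  and \<open>lincomb_exchange\<close> compares edge coordinates with frame coordinates. If they are dependent then
  the simplex lies in a hyperplane of the subspace and has measure \<open>0\<close>, while the denominator is the
  measure of a set of infinite measure, which is \<open>0\<close> as a real number, so that the quotient is \<open>0\<close> too.\<close>

lemma frame_volume_simplex:
  fixes x :: "nat \<Rightarrow> 'a::euclidean_space"
  assumes b: "orthonormal_frame k b" and S: "S = convex hull (x ` {..k})"
    and sub: "S \<subseteq> range (\<lambda>c. p + lincomb k b c)"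
  shows "measure (coords k) {c \<in> space (coords k). p + lincomb k b c \<in> S} =
    simplex_const k / measure (coords k) (unit_preimage k (\<lambda>i. x (Suc i) - x 0))"
proof -
  define v where "v = (\<lambda>i. x (Suc i) - x 0)"
  have xS: "x j \<in> S" if "j \<le> k" for j using that unfolding S by (auto intro: hull_inc)
  then have "x j \<in> range (\<lambda>c. p + lincomb k b c)" if "j \<le> k" for j using that sub by blast
  then have "\<forall>j. \<exists>c. j \<le> k \<longrightarrow> x j = p + lincomb k b c" by blast
  then obtain e where e: "\<And>j. j \<le> k \<Longrightarrow> x j = p + lincomb k b (e j)" by metis
  have [measurable]: "S \<in> sets borel"
    unfolding S by (intro borel_compact compact_convex_hull finite_imp_compact) auto
  have vb: "v i = lincomb k b (\<lambda>j. e (Suc i) j - e 0 j)" if "i < k" for i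
    using that by (simp add: v_def e lincomb_diff)
  have rsub: "range (lincomb k v) \<subseteq> range (lincomb k b)"
  proof -
    have "v ` {..<k} \<subseteq> span (b ` {..<k})"
      unfolding range_lincomb[symmetric] using vb by auto
    then show ?thesis unfolding range_lincomb by (rule span_minimal) simp
  qed
  let ?m = "emeasure (coords k)"
  show ?thesis
  proof (cases "lin_indep k v")
    case True
    have r: "range (lincomb k v) = range (lincomb k b)"
      using rsub dim_lin_indep[OF True] dim_lin_indep[OF frame_lin_indep[OF b]]
      unfolding range_lincomb by (intro subspace_dim_equal) auto
    define A where "A = (\<lambda>y. x 0 + y) -` S"
    have A[measurable]: "A \<in> sets borel" unfolding A_def by (rule measurable_sets_borel[of _ borel]) measurable
    have vA: "{c \<in> space (coords k). lincomb k v c \<in> A} = {c \<in> space (coords k). (\<forall>i<k. 0 \<le> c i) \<and> (\<Sum>i<k. c i) \<le> 1}"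
      (is "?X = ?Y")
    proof
      show "?Y \<subseteq> ?X" unfolding A_def S convex_hull_lincomb v_def by auto
      show "?X \<subseteq> ?Y"
      proof
        fix c assume c: "c \<in> ?X"
        then obtain c' where c': "lincomb k v c = lincomb k v c'" "\<forall>i<k. 0 \<le> c' i" "(\<Sum>i<k. c' i) \<le> 1"
          unfolding A_def S convex_hull_lincomb v_def by auto
        have "\<And>i. i < k \<Longrightarrow> c i = c' i" using lincomb_indep_inj[OF True c'(1)] .
        then have "(\<forall>i<k. 0 \<le> c i) \<and> (\<Sum>i<k. c i) \<le> 1" using c'(2,3) by simp
        then show "c \<in> ?Y" using c by simp
      qed
    qed
    have bA: "?m {c \<in> space (coords k). lincomb k b c \<in> A} = ?m {c \<in> space (coords k). p + lincomb k b c \<in> S}"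
    proof -
      have "?m {c \<in> space (coords k). p + lincomb k b c \<in> S} = (\<integral>\<^sup>+c. indicator {c \<in> space (coords k). p + lincomb k b c \<in> S} c \<partial>coords k)"
        by simp
      also have "\<dots> = (\<integral>\<^sup>+c. indicator {y. p + y \<in> S} (lincomb k b c) \<partial>coords k)"
        by (intro nn_integral_cong) (simp split: split_indicator)
      also have "\<dots> = (\<integral>\<^sup>+c. indicator {y. p + y \<in> S} (lincomb k b (e 0) + lincomb k b c) \<partial>coords k)"
        by (rule nn_integral_lincomb_translate) measurable
      also have "\<dots> = (\<integral>\<^sup>+c. indicator {c \<in> space (coords k). lincomb k b c \<in> A} c \<partial>coords k)"
        by (intro nn_integral_cong) (simp add: A_def e[of 0] add.assoc split: split_indicator)
      finally show ?thesis by simp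
    qed
    have ub: "unit_preimage k b = {c \<in> space (coords k). (\<Sum>i<k. (c i)\<^sup>2) \<le> 1}"
      unfolding unit_preimage_def frame_norm_lincomb[OF b, symmetric] by (simp add: abs_square_le_1)
    have ex: "?m {c \<in> space (coords k). lincomb k v c \<in> A} * ?m (unit_preimage k b) =
              ?m {c \<in> space (coords k). lincomb k b c \<in> A} * ?m (unit_preimage k v)"
      unfolding unit_preimage_def using lincomb_exchange[OF r A] .
    have pos: "measure (coords k) (unit_preimage k v) > 0"
      using emeasure_unit_preimage_pos[of k v] indep_unit_preimage_finite[OF b True r]
      by (simp add: measure_def enn2real_positive_iff)
    have "measure (coords k) {c \<in> space (coords k). lincomb k v c \<in> A} * measure (coords k) (unit_preimage k b) =
          measure (coords k) {c \<in> space (coords k). lincomb k b c \<in> A} * measure (coords k) (unit_preimage k v)"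
      using arg_cong[OF ex, of enn2real] unfolding enn2real_mult measure_def .
    then show ?thesis
      using pos unfolding vA ub simplex_const_def v_def[symmetric]
      by (simp add: field_simps measure_def bA)
  next
    case False
    then have R: "measure (coords k) (unit_preimage k v) = 0"
      using dep_unit_preimage_infinite[OF False] by (simp add: measure_def)
    have "span (v ` {..<k}) \<noteq> span (b ` {..<k})"
    proof
      assume eq: "span (v ` {..<k}) = span (b ` {..<k})"
      have "lin_indep k v"
      proof (rule ccontr)
        assume "\<not> lin_indep k v"
        then obtain a i0 where a: "lincomb k v a = 0" "i0 < k" "a i0 \<noteq> 0" unfolding lin_indep_def by blast
        let ?V = "v ` ({..<k} - {i0})"
        have "a i0 *\<^sub>R v i0 + (\<Sum>i\<in>{..<k} - {i0}. a i *\<^sub>R v i) = 0"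
          using a unfolding lincomb_def by (subst (asm) sum.remove[of _ i0]) auto
        then have "a i0 *\<^sub>R v i0 = - (\<Sum>i\<in>{..<k} - {i0}. a i *\<^sub>R v i)" by (simp add: eq_neg_iff_add_eq_0)
        then have "a i0 *\<^sub>R v i0 \<in> span ?V"
          by (simp only:) (rule span_neg, rule span_sum, rule span_scale, rule span_base, rule imageI)
        then have "(1 / a i0) *\<^sub>R (a i0 *\<^sub>R v i0) \<in> span ?V" by (rule span_scale)
        then have "v i0 \<in> span ?V" using a by simp
        then have "v ` {..<k} \<subseteq> span ?V" by (auto intro: span_base)
        then have "span (v ` {..<k}) \<subseteq> span ?V" by (rule span_minimal) simp
        then have "dim (b ` {..<k}) \<le> dim ?V" unfolding eq by (metis dim_span dim_subset)
        also have "\<dots> \<le> card ({..<k} - {i0})"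
          using dim_le_card'[of ?V] card_image_le[of "{..<k} - {i0}" v] by simp
        also have "\<dots> < k" using a(2) by simp
        finally show False using dim_lin_indep[OF frame_lin_indep[OF b]] by simp
      qed
      then show False using False by simp
    qed
    then have "span (v ` {..<k}) \<subset> span (b ` {..<k})" using rsub unfolding range_lincomb by blast
    \<comment> \<open>A normal vector of the span of the edges inside the span of the frame.\<close>
    then obtain w where w: "w \<noteq> 0" "w \<in> span (b ` {..<k})" "\<And>y. y \<in> span (v ` {..<k}) \<Longrightarrow> orthogonal w y"
      using orthogonal_to_subspace_exists_gen by metis
    define \<beta> where "\<beta> = (x 0 - p) \<bullet> w"
    have "\<exists>i0<k. b i0 \<bullet> w \<noteq> 0"
    proof (rule ccontr)
      assume "\<not> ?thesis"
      then have *: "b i \<bullet> w = 0" if "i < k" for i using that by blast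
      from w(2) obtain c where "w = lincomb k b c" unfolding range_lincomb[symmetric] by blast
      then have "w \<bullet> w = lincomb k b c \<bullet> w" by simp
      also have "\<dots> = 0" using * by (simp add: lincomb_def inner_sum_left)
      finally show False using w by simp
    qed
    then obtain i0 where i0: "i0 < k" "b i0 \<bullet> w \<noteq> 0" by blast
    have "{c \<in> space (coords k). p + lincomb k b c \<in> S} \<subseteq> {c \<in> space (coords k). (\<Sum>i<k. c i * (b i \<bullet> w)) = \<beta>}"
    proof safe
      fix c assume "p + lincomb k b c \<in> S"
      then obtain c' where c': "p + lincomb k b c = x 0 + lincomb k v c'"
        unfolding S convex_hull_lincomb v_def by blast
      have "lincomb k v c' \<in> span (v ` {..<k})" unfolding range_lincomb[symmetric] by blast
      from w(3)[OF this] have "lincomb k v c' \<bullet> w = 0" by (simp add: orthogonal_def inner_commute)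
      moreover have "lincomb k b c = x 0 - p + lincomb k v c'" using c' by (simp add: algebra_simps)
      ultimately have "lincomb k b c \<bullet> w = \<beta>" by (simp add: \<beta>_def inner_add_left)
      then show "(\<Sum>i<k. c i * (b i \<bullet> w)) = \<beta>" by (simp add: lincomb_def inner_sum_left)
    qed
    then have "?m {c \<in> space (coords k). p + lincomb k b c \<in> S} \<le> ?m {c \<in> space (coords k). (\<Sum>i<k. c i * (b i \<bullet> w)) = \<beta>}"
      by (rule emeasure_mono) measurable
    also have "\<dots> = 0" using i0 by (rule emeasure_hyperplane_coords[of i0 k "\<lambda>i. b i \<bullet> w"])
    finally show ?thesis using R unfolding v_def by (simp add: measure_def)
  qed
qed

text \<open>All frames give the same value by \<open>frame_volume_simplex\<close>, and a frame exists because \<open>k\<close> does not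
  exceed the dimension.\<close>

lemma k_volume_simplex:
  fixes x :: "nat \<Rightarrow> 'a::euclidean_space"
  assumes k: "k \<le> DIM('a)"
  shows "k_volume k (convex hull (x ` {..k})) =
    simplex_const k / measure (coords k) (unit_preimage k (\<lambda>i. x (Suc i) - x 0))"
proof -
  define S where "S = convex hull (x ` {..k})"
  have sp: "{c \<in> {..<k} \<rightarrow>\<^sub>E (UNIV :: real set). P c} = {c \<in> space (coords k). P c}" for P
    by (simp add: space_PiM)
  show ?thesis
    unfolding k_volume_def sp S_def[symmetric] lincomb_def[symmetric] orthonormal_frame_def[symmetric]
  proof (rule the_equality)
    obtain b where b: "orthonormal_frame k b"
        "range (lincomb k (\<lambda>i. x (Suc i) - x 0)) \<subseteq> range (lincomb k b)"
      using frame_exists[OF k] by blast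
    have sub: "S \<subseteq> range (\<lambda>c. x 0 + lincomb k b c)"
    proof
      fix y assume "y \<in> S"
      then obtain c where y: "y = x 0 + lincomb k (\<lambda>i. x (Suc i) - x 0) c"
        unfolding S_def convex_hull_lincomb by blast
      have "lincomb k (\<lambda>i. x (Suc i) - x 0) c \<in> range (lincomb k b)"
        by (rule subsetD[OF b(2) rangeI])
      then obtain c' where "lincomb k (\<lambda>i. x (Suc i) - x 0) c = lincomb k b c'" by (rule rangeE)
      then show "y \<in> range (\<lambda>c. x 0 + lincomb k b c)" using y by simp
    qed
    show "\<exists>p b. orthonormal_frame k b \<and> S \<subseteq> range (\<lambda>c. p + lincomb k b c) \<and>
       simplex_const k / measure (coords k) (unit_preimage k (\<lambda>i. x (Suc i) - x 0)) =
       measure (coords k) {c \<in> space (coords k). p + lincomb k b c \<in> S}"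
      by (intro exI[of _ "x 0"] exI[of _ b] conjI b(1) sub frame_volume_simplex[OF b(1) S_def sub, symmetric])
  next
    fix v :: real
    assume "\<exists>p b. orthonormal_frame k (b :: nat \<Rightarrow> 'a) \<and> S \<subseteq> range (\<lambda>c. p + lincomb k b c) \<and>
       v = measure (coords k) {c \<in> space (coords k). p + lincomb k b c \<in> S}"
    then obtain p and b :: "nat \<Rightarrow> 'a" where b: "orthonormal_frame k b" "S \<subseteq> range (\<lambda>c. p + lincomb k b c)"
      and v: "v = measure (coords k) {c \<in> space (coords k). p + lincomb k b c \<in> S}"
      by (elim exE conjE)
    show "v = simplex_const k / measure (coords k) (unit_preimage k (\<lambda>i. x (Suc i) - x 0))"
      unfolding v by (rule frame_volume_simplex[OF b(1) S_def b(2)])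
  qed
qed

text \<open>A function of the vertex set rather than of a list of vertices, so that the functional is a sum over
  subsets of the process.\<close>

definition simplex_weight :: "real \<Rightarrow> nat \<Rightarrow> real \<Rightarrow> 'a::euclidean_space set \<Rightarrow> real" where
  "simplex_weight s k \<alpha> S =
     (if \<forall>x\<in>S. \<forall>y\<in>S. dist x y \<le> s
      then (if \<alpha> = 0 then 1 else k_volume k (convex hull S) powr \<alpha>) else 0)"

lemma rips_vol_pow_eq_weight:
  "rips_vol_pow s \<alpha> xs = simplex_weight s (length xs - 1) \<alpha> (set xs)"
  by (simp add: rips_vol_pow_def simplex_weight_def)

lemma simplex_weight_nonneg [simp]: "0 \<le> simplex_weight s k \<alpha> S"
  by (simp add: simplex_weight_def)

text \<open>By \<open>k_volume_simplex\<close> the volume is a constant divided by the measure of a section of a measurable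
  set.\<close>

lemma simplex_weight_measurable:
  fixes \<sigma> :: "nat \<Rightarrow> 'i"
  assumes "finite I" and \<sigma>: "\<And>j. j \<le> k \<Longrightarrow> \<sigma> j \<in> I" and k: "\<alpha> \<noteq> 0 \<Longrightarrow> k \<le> DIM('a)"
  shows "(\<lambda>z. simplex_weight s k \<alpha> (z ` \<sigma> ` {..k}) ) \<in> borel_measurable (\<Pi>\<^sub>M i\<in>I. (lborel :: 'a::euclidean_space measure))"
proof -
  let ?P = "\<Pi>\<^sub>M i\<in>I. (lborel :: 'a measure)"
  interpret C: sigma_finite_measure "coords k" by (rule lborel_PiM.sigma_finite) simp
  have comp: "(\<lambda>z. z (\<sigma> j)) \<in> borel_measurable ?P" if "j \<le> k" for j
    using measurable_component_singleton[OF \<sigma>[OF that], of "\<lambda>_. lborel :: 'a measure"] by simp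
  have vol: "(\<lambda>z. k_volume k (convex hull (z ` \<sigma> ` {..k}))) \<in> borel_measurable ?P" if "k \<le> DIM('a)"
  proof -
    have *: "k_volume k (convex hull (z ` \<sigma> ` {..k})) = simplex_const k /
       enn2real (emeasure (coords k) (unit_preimage k (\<lambda>i. z (\<sigma> (Suc i)) - z (\<sigma> 0))))" for z :: "'i \<Rightarrow> 'a"
      using k_volume_simplex[OF that, of "\<lambda>i. z (\<sigma> i)"] by (simp add: image_image measure_def)
    have [measurable]: "(\<lambda>x. fst x (\<sigma> j)) \<in> borel_measurable (?P \<Otimes>\<^sub>M coords k)" if "j \<le> k" for j
      using measurable_compose[OF measurable_fst comp[OF that]] .
    have "(\<lambda>x. lincomb k (\<lambda>i. fst x (\<sigma> (Suc i)) - fst x (\<sigma> 0)) (snd x)) \<in> borel_measurable (?P \<Otimes>\<^sub>M coords k)"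
      unfolding lincomb_def by (intro borel_measurable_sum borel_measurable_scaleR borel_measurable_diff) measurable
    note [measurable] = this
    have "(\<lambda>x. norm (lincomb k (\<lambda>i. fst x (\<sigma> (Suc i)) - fst x (\<sigma> 0)) (snd x))) \<in> borel_measurable (?P \<Otimes>\<^sub>M coords k)"
      by measurable
    note [measurable] = this
    have "(\<lambda>z. emeasure (coords k) (unit_preimage k (\<lambda>i. z (\<sigma> (Suc i)) - z (\<sigma> 0)))) \<in> borel_measurable ?P"
    proof (rule C.measurable_emeasure)
      show "unit_preimage k (\<lambda>i. z (\<sigma> (Suc i)) - z (\<sigma> 0)) \<subseteq> space (coords k)" for z :: "'i \<Rightarrow> 'a"
        by (auto simp: unit_preimage_def)
      have "{x \<in> space (?P \<Otimes>\<^sub>M coords k). snd x \<in> unit_preimage k (\<lambda>i. fst x (\<sigma> (Suc i)) - fst x (\<sigma> 0))} =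
        {x \<in> space (?P \<Otimes>\<^sub>M coords k). norm (lincomb k (\<lambda>i. fst x (\<sigma> (Suc i)) - fst x (\<sigma> 0)) (snd x)) \<le> 1}"
        by (auto simp: unit_preimage_def space_pair_measure)
      also have "\<dots> \<in> sets (?P \<Otimes>\<^sub>M coords k)" by measurable
      finally show "{x \<in> space (?P \<Otimes>\<^sub>M coords k). snd x \<in> unit_preimage k (\<lambda>i. fst x (\<sigma> (Suc i)) - fst x (\<sigma> 0))} \<in> sets (?P \<Otimes>\<^sub>M coords k)" .
    qed
    then show ?thesis unfolding * by measurable
  qed
  have pred: "Measurable.pred ?P (\<lambda>z. \<forall>x\<in>z ` \<sigma> ` {..k}. \<forall>y\<in>z ` \<sigma> ` {..k}. dist x y \<le> s)"
  proof -
    have "Measurable.pred ?P (\<lambda>z. dist (z (\<sigma> i)) (z (\<sigma> j)) \<le> s)" if "i \<le> k" "j \<le> k" for i j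
      using comp[OF that(1)] comp[OF that(2)] by measurable
    then have "Measurable.pred ?P (\<lambda>z. \<forall>i\<in>{..k}. \<forall>j\<in>{..k}. dist (z (\<sigma> i)) (z (\<sigma> j)) \<le> s)"
      by (intro pred_intros_finite) auto
    then show ?thesis by simp
  qed
  have "(\<lambda>z. if \<alpha> = 0 then 1 else k_volume k (convex hull (z ` \<sigma> ` {..k})) powr \<alpha>) \<in> borel_measurable ?P"
  proof (cases "\<alpha> = 0")
    case False
    then show ?thesis using vol[OF k[OF False]] by simp
  qed simp
  then show ?thesis
    unfolding simplex_weight_def by (rule measurable_If[OF _ _ predE[OF pred]]) simp
qed

lemma measure_unit_preimage_scale:
  fixes v :: "nat \<Rightarrow> 'a::euclidean_space"
  assumes r: "r > 0"
  shows "measure (coords k) (unit_preimage k v) = r ^ k * measure (coords k) (unit_preimage k (\<lambda>i. r *\<^sub>R v i))"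
proof -
  have res: "lincomb k v (\<lambda>i\<in>{..<k}. r * c i) = lincomb k (\<lambda>i. r *\<^sub>R v i) c" for c
    by (simp add: lincomb_def mult.commute)
  have "emeasure (coords k) (unit_preimage k v) = (\<integral>\<^sup>+c. indicator (unit_preimage k v) c \<partial>coords k)" by simp
  also have "\<dots> = ennreal (\<bar>r\<bar> ^ (DIM(real) * card {..<k})) *
     (\<integral>\<^sup>+c. indicator (unit_preimage k v) (\<lambda>i\<in>{..<k}. (\<lambda>_. 0) i + r *\<^sub>R c i) \<partial>coords k)"
    using r by (intro nn_integral_PiM_lborel_affine) auto
  also have "(\<integral>\<^sup>+c. indicator (unit_preimage k v) (\<lambda>i\<in>{..<k}. (\<lambda>_. 0) i + r *\<^sub>R c i) \<partial>coords k) =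
     (\<integral>\<^sup>+c. indicator (unit_preimage k (\<lambda>i. r *\<^sub>R v i)) c \<partial>coords k)"
    by (intro nn_integral_cong) (auto simp: unit_preimage_def space_PiM res split: split_indicator)
  finally have "emeasure (coords k) (unit_preimage k v) =
    ennreal (r ^ k) * emeasure (coords k) (unit_preimage k (\<lambda>i. r *\<^sub>R v i))" using r by simp
  then show ?thesis using r by (simp add: measure_def enn2real_mult)
qed

lemma k_volume_nonneg:
  fixes x :: "nat \<Rightarrow> 'a::euclidean_space"
  assumes k: "k \<le> DIM('a)"
  shows "0 \<le> k_volume k (convex hull (x ` {..k}))"
  unfolding k_volume_simplex[OF k] by (simp add: simplex_const_def)

lemma k_volume_affine:
  fixes x :: "nat \<Rightarrow> 'a::euclidean_space"
  assumes k: "k \<le> DIM('a)" and r: "r > 0"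
  shows "k_volume k (convex hull ((\<lambda>y. a + r *\<^sub>R y) ` x ` {..k})) = r ^ k * k_volume k (convex hull (x ` {..k}))"
proof -
  have "(\<lambda>y. a + r *\<^sub>R y) ` x ` {..k} = (\<lambda>i. a + r *\<^sub>R x i) ` {..k}" by (simp add: image_image)
  moreover have "(\<lambda>i. (a + r *\<^sub>R x (Suc i)) - (a + r *\<^sub>R x 0)) = (\<lambda>i. r *\<^sub>R (x (Suc i) - x 0))"
    by (simp add: algebra_simps)
  ultimately show ?thesis
    using measure_unit_preimage_scale[OF r, of k "\<lambda>i. x (Suc i) - x 0"] r
    by (simp add: k_volume_simplex[OF k])
qed

lemma simplex_weight_affine:
  fixes S :: "'a::euclidean_space set"
  assumes r: "r > 0" and S: "S = x ` {..k}" and k: "\<alpha> \<noteq> 0 \<Longrightarrow> k \<le> DIM('a)"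
  shows "simplex_weight r k \<alpha> ((\<lambda>y. a + r *\<^sub>R y) ` S) = r powr (\<alpha> * real k) * simplex_weight 1 k \<alpha> S"
proof -
  have d: "(\<forall>x\<in>(\<lambda>y. a + r *\<^sub>R y) ` S. \<forall>y\<in>(\<lambda>y. a + r *\<^sub>R y) ` S. dist x y \<le> r) \<longleftrightarrow> (\<forall>x\<in>S. \<forall>y\<in>S. dist x y \<le> 1)"
  proof -
    have "dist (a + r *\<^sub>R x) (a + r *\<^sub>R y) = r * dist x y" for x y
      using r by (simp add: dist_norm flip: scaleR_diff_right)
    then show ?thesis using r by simp
  qed
  show ?thesis
  proof (cases "\<alpha> = 0")
    case True
    then show ?thesis unfolding simplex_weight_def d using r by simp
  next
    case False
    have "(r ^ k * k_volume k (convex hull S)) powr \<alpha> = r powr (\<alpha> * real k) * k_volume k (convex hull S) powr \<alpha>"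
      using r k_volume_nonneg[OF k[OF False], of x] unfolding S
      by (simp add: powr_mult powr_powr flip: powr_realpow) (simp add: mult.commute)
    then show ?thesis
      unfolding simplex_weight_def d using False k_volume_affine[OF k[OF False] r, of a x]
      by (simp add: S)
  qed
qed

text \<open>If the edge vectors are close to multiples of an orthonormal frame then every linear combination of
  norm at most \<open>1\<close> has coefficients at most \<open>2 / \<rho>\<close>, so the denominator in \<open>k_volume_simplex\<close> is finite.\<close>

lemma k_volume_pos:
  fixes x :: "nat \<Rightarrow> 'a::euclidean_space"
  assumes k: "k \<le> DIM('a)" and b: "orthonormal_frame k b" and \<rho>: "\<rho> > 0"
    and x: "\<And>i. i < k \<Longrightarrow> norm ((x (Suc i) - x 0) - \<rho> *\<^sub>R b i) \<le> \<rho> / (2 * real k)"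
  shows "k_volume k (convex hull (x ` {..k})) > 0"
proof -
  define v where "v = (\<lambda>i. x (Suc i) - x 0)"
  have fin: "emeasure (coords k) (unit_preimage k v) < \<infinity>"
  proof (rule emeasure_unit_preimage_finite[where K="2 / \<rho>"])
    fix c i assume c: "norm (lincomb k v c) \<le> 1" and i: "i < k"
    define m where "m = Max ((\<lambda>i. \<bar>c i\<bar>) ` {..<k})"
    have "m \<in> (\<lambda>i. \<bar>c i\<bar>) ` {..<k}" unfolding m_def using i by (intro Max_in) auto
    then obtain j where j: "j < k" "m = \<bar>c j\<bar>" by auto
    have le: "\<bar>c i\<bar> \<le> m" if "i < k" for i unfolding m_def using that by (intro Max_ge) auto
    have m0: "m \<ge> 0" using j by simp
    have nb: "norm (b j) = 1" using b j by (simp add: orthonormal_frame_def norm_eq_1)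
    have "\<rho> * m = \<bar>(\<rho> *\<^sub>R lincomb k b c) \<bullet> b j\<bar>" using frame_inner_lincomb[OF b j(1), of c] \<rho> j(2) by (simp add: abs_mult)
    also have "\<dots> \<le> norm (\<rho> *\<^sub>R lincomb k b c)" using Cauchy_Schwarz_ineq2[of "\<rho> *\<^sub>R lincomb k b c" "b j"] nb by simp
    also have "\<rho> *\<^sub>R lincomb k b c = lincomb k v c - lincomb k (\<lambda>i. v i - \<rho> *\<^sub>R b i) c"
      by (simp add: lincomb_def scaleR_diff_right sum_subtractf scaleR_sum_right mult.commute)
    also have "norm \<dots> \<le> 1 + norm (lincomb k (\<lambda>i. v i - \<rho> *\<^sub>R b i) c)"
      using c norm_triangle_ineq4[of "lincomb k v c" "lincomb k (\<lambda>i. v i - \<rho> *\<^sub>R b i) c"] by linarith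
    also have "norm (lincomb k (\<lambda>i. v i - \<rho> *\<^sub>R b i) c) \<le> (\<Sum>i<k. \<bar>c i\<bar> * norm (v i - \<rho> *\<^sub>R b i))"
      by (rule norm_lincomb_le)
    also have "\<dots> \<le> (\<Sum>i<k. m * (\<rho> / (2 * real k)))"
      using le x m0 unfolding v_def by (intro sum_mono mult_mono) auto
    also have "\<dots> = \<rho> * m / 2" using i by simp
    finally have "\<rho> * m \<le> 2" by simp
    then have "m \<le> 2 / \<rho>" using \<rho> by (simp add: field_simps)
    then show "\<bar>c i\<bar> \<le> 2 / \<rho>" using le[OF i] by simp
  qed
  have "measure (coords k) (unit_preimage k v) > 0"
    using emeasure_unit_preimage_pos[of k v] fin by (simp add: measure_def enn2real_positive_iff)
  moreover have "measure (coords k) {c \<in> space (coords k). (\<Sum>i<k. (c i)\<^sup>2) \<le> 1} > 0"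
  proof -
    have "unit_preimage k b = {c \<in> space (coords k). (\<Sum>i<k. (c i)\<^sup>2) \<le> 1}"
      unfolding unit_preimage_def frame_norm_lincomb[OF b, symmetric] by (simp add: abs_square_le_1)
    then show ?thesis
      using emeasure_unit_preimage_pos[of k b] frame_unit_preimage_finite[OF b] by (simp add: measure_def enn2real_positive_iff)
  qed
  moreover have "measure (coords k) {c \<in> space (coords k). (\<forall>i<k. 0 \<le> c i) \<and> (\<Sum>i<k. c i) \<le> 1} > 0" (is "measure _ ?S > 0")
  proof -
    have lo: "(\<Pi>\<^sub>E i\<in>{..<k}. {0..1 / (1 + real k)}) \<subseteq> ?S"
    proof
      fix c assume c: "c \<in> (\<Pi>\<^sub>E i\<in>{..<k}. {0..1 / (1 + real k)})"
      have "(\<Sum>i<k. c i) \<le> (\<Sum>i<k. 1 / (1 + real k))" using c by (intro sum_mono) (auto simp: PiE_iff)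
      also have "\<dots> \<le> 1" by (simp add: field_simps)
      finally show "c \<in> ?S" using c by (auto simp: space_PiM PiE_iff)
    qed
    have hi: "?S \<subseteq> (\<Pi>\<^sub>E i\<in>{..<k}. {0..1})"
    proof
      fix c assume c: "c \<in> ?S"
      have "c i \<le> 1" if "i < k" for i
        using member_le_sum[of i "{..<k}" c] c that by simp
      then show "c \<in> (\<Pi>\<^sub>E i\<in>{..<k}. {0..1})" using c by (auto simp: space_PiM PiE_iff)
    qed
    have "0 < (\<Prod>i<k. ennreal (1 / (1 + real k) - 0))" by (simp add: ennreal_power)
    also have "\<dots> = emeasure (coords k) (\<Pi>\<^sub>E i\<in>{..<k}. {0..1 / (1 + real k)})"
      by (rule emeasure_coords_box(2)[symmetric]) simp
    also have "\<dots> \<le> emeasure (coords k) ?S" using lo by (intro emeasure_mono) measurable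
    finally have "emeasure (coords k) ?S > 0" .
    moreover have "emeasure (coords k) ?S < \<infinity>"
    proof -
      have "emeasure (coords k) ?S \<le> emeasure (coords k) (\<Pi>\<^sub>E i\<in>{..<k}. {0..1})"
        using hi by (intro emeasure_mono emeasure_coords_box) auto
      also have "\<dots> = (\<Prod>i<k. ennreal (1 - 0))" by (rule emeasure_coords_box(2)) simp
      finally show ?thesis by (simp add: order_le_less_trans)
    qed
    ultimately show ?thesis by (simp add: measure_def enn2real_positive_iff)
  qed
  ultimately show ?thesis
    unfolding k_volume_simplex[OF k] simplex_const_def v_def[symmetric] by simp
qed

section \<open>Factorial moments of a Poisson process\<close>

definition inj_tuples :: "'i set \<Rightarrow> 'b set \<Rightarrow> ('i \<Rightarrow> 'b) set" where
  "inj_tuples I X = {z \<in> I \<rightarrow>\<^sub>E X. inj_on z I}"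

lemma finite_inj_tuples [simp]: "finite I \<Longrightarrow> finite X \<Longrightarrow> finite (inj_tuples I X)"
  unfolding inj_tuples_def by (simp add: finite_PiE)

text \<open>Points are chosen one after the other: a new coordinate has to avoid those earlier ones that lie in
  the same set, and these are the ones with the same label. Sets carry labels because several of them
  may be empty.\<close>

lemma card_inj_tuples_rectangle:
  assumes "finite I" "finite X" "finite L" "disjoint_family_on C L" "\<And>i. i \<in> I \<Longrightarrow> \<kappa> i \<in> L"
  shows "card {z \<in> inj_tuples I X. \<forall>i\<in>I. z i \<in> C (\<kappa> i)} =
           (\<Prod>l\<in>L. \<Prod>j<card {i \<in> I. \<kappa> i = l}. card (X \<inter> C l) - j)"
  using assms(1,5)
proof (induction I rule: finite_induct)
  case empty
  then show ?case by (simp add: inj_tuples_def)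
next
  case (insert i I)
  define R where "R = {z \<in> inj_tuples I X. \<forall>i\<in>I. z i \<in> C (\<kappa> i)}"
  define m where "m = card {j \<in> I. \<kappa> j = \<kappa> i}"
  have finR: "finite R" unfolding R_def using insert \<open>finite X\<close> by simp
  have "bij_betw (\<lambda>(z, y). z(i := y)) (SIGMA z:R. X \<inter> C (\<kappa> i) - z ` I) {z \<in> inj_tuples (insert i I) X. \<forall>j\<in>insert i I. z j \<in> C (\<kappa> j)}"
    (is "bij_betw ?g ?S ?T")
  proof (rule bij_betwI[where g="\<lambda>z. (restrict z I, z i)"])
    show "?g \<in> ?S \<rightarrow> ?T"
    proof (rule Pi_I, clarify)
      fix z y assume z: "z \<in> R" and y: "y \<in> X" "y \<in> C (\<kappa> i)" "y \<notin> z ` I"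
      have eq: "(z(i := y)) j = z j" if "j \<in> I" for j using that insert.hyps(2) by auto
      have "inj_on (z(i := y)) I"
        using z inj_on_cong[of I "z(i := y)" z, OF eq] by (simp add: R_def inj_tuples_def)
      moreover have "(z(i := y)) ` (I - {i}) = z ` I"
        using insert.hyps(2) by (intro image_cong) auto
      ultimately have "inj_on (z(i := y)) (insert i I)" using y(3) unfolding inj_on_insert by simp
      moreover have "z(i := y) \<in> insert i I \<rightarrow>\<^sub>E X"
        using z y(1) by (intro PiE_fun_upd) (simp_all add: R_def inj_tuples_def)
      moreover have "\<forall>j\<in>insert i I. (z(i := y)) j \<in> C (\<kappa> j)"
        using z y(2) insert.hyps(2) by (simp add: R_def)
      ultimately show "z(i := y) \<in> inj_tuples (insert i I) X \<and> (\<forall>j\<in>insert i I. (z(i := y)) j \<in> C (\<kappa> j))"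
        by (simp only: inj_tuples_def mem_Collect_eq simp_thms)
    qed
    show "(\<lambda>z. (restrict z I, z i)) \<in> ?T \<rightarrow> ?S"
    proof (rule Pi_I)
      fix z assume "z \<in> ?T"
      then have z: "z \<in> insert i I \<rightarrow>\<^sub>E X" "inj_on z (insert i I)" "\<forall>j\<in>insert i I. z j \<in> C (\<kappa> j)"
        by (simp_all add: inj_tuples_def)
      have "restrict z I \<in> R"
        using z inj_on_subset[OF z(2), of I] unfolding R_def inj_tuples_def
        by (simp add: PiE_iff subset_insertI)
      moreover have "z i \<notin> restrict z I ` I"
        using z(2) insert.hyps(2) unfolding inj_on_insert by simp
      moreover have "z i \<in> X \<inter> C (\<kappa> i)" using z(1,3) by (simp add: PiE_iff)
      ultimately show "(restrict z I, z i) \<in> ?S" by (intro SigmaI DiffI)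
    qed
    show "(restrict (?g x) I, ?g x i) = x" if "x \<in> ?S" for x
    proof -
      obtain z y where x: "x = (z, y)" by (cases x)
      have z: "z \<in> R" using that x by simp
      have "restrict (z(i := y)) I = z"
        by (rule extensionalityI[of _ I]) (use z insert.hyps(2) in \<open>auto simp: R_def inj_tuples_def PiE_iff\<close>)
      then show ?thesis by (simp add: x)
    qed
    show "?g (restrict z I, z i) = z" if "z \<in> ?T" for z
    proof -
      have "z \<in> extensional (insert i I)" using that by (simp add: inj_tuples_def PiE_iff)
      then have "(restrict z I)(i := z i) = z" by (auto simp: fun_eq_iff extensional_def)
      then show ?thesis by simp
    qed
  qed
  then have "card ?T = card ?S" by (simp add: bij_betw_same_card)
  also have "\<dots> = (\<Sum>z\<in>R. card (X \<inter> C (\<kappa> i) - z ` I))"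
    using finR \<open>finite X\<close> by (subst card_SigmaI) auto
  also have "\<dots> = (\<Sum>z\<in>R. card (X \<inter> C (\<kappa> i)) - m)"
  proof (rule sum.cong[OF refl])
    fix z assume z: "z \<in> R"
    have eq: "X \<inter> C (\<kappa> i) - z ` I = (X \<inter> C (\<kappa> i)) - z ` {j \<in> I. \<kappa> j = \<kappa> i}"
    proof -
      have "\<kappa> j = \<kappa> i" if "j \<in> I" "z j \<in> C (\<kappa> i)" for j
      proof (rule ccontr)
        assume "\<kappa> j \<noteq> \<kappa> i"
        moreover have "\<kappa> j \<in> L" "\<kappa> i \<in> L" using insert.prems that by auto
        ultimately have "C (\<kappa> j) \<inter> C (\<kappa> i) = {}"
          using \<open>disjoint_family_on C L\<close> by (simp add: disjoint_family_on_def)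
        moreover have "z j \<in> C (\<kappa> j)" using z that by (auto simp: R_def)
        ultimately show False using that by auto
      qed
      then show ?thesis by auto
    qed
    have "z ` {j \<in> I. \<kappa> j = \<kappa> i} \<subseteq> X \<inter> C (\<kappa> i)"
      using z by (auto simp: R_def inj_tuples_def PiE_iff)
    moreover have "card (z ` {j \<in> I. \<kappa> j = \<kappa> i}) = m"
      unfolding m_def using z by (intro card_image) (auto simp: R_def inj_tuples_def inj_on_def)
    ultimately show "card (X \<inter> C (\<kappa> i) - z ` I) = card (X \<inter> C (\<kappa> i)) - m"
      unfolding eq using insert.hyps(1) by (subst card_Diff_subset) auto
  qed
  also have "\<dots> = card R * (card (X \<inter> C (\<kappa> i)) - m)" by simp
  also have "card R = (\<Prod>l\<in>L. \<Prod>j<card {i \<in> I. \<kappa> i = l}. card (X \<inter> C l) - j)"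
    unfolding R_def using insert by auto
  also have "\<dots> * (card (X \<inter> C (\<kappa> i)) - m) = (\<Prod>l\<in>L. \<Prod>j<card {j \<in> insert i I. \<kappa> j = l}. card (X \<inter> C l) - j)"
  proof -
    have ki: "\<kappa> i \<in> L" using insert by auto
    have Ci: "{j \<in> insert i I. \<kappa> j = \<kappa> i} = insert i {j \<in> I. \<kappa> j = \<kappa> i}" by auto
    have card_i: "card {j \<in> insert i I. \<kappa> j = \<kappa> i} = Suc m"
      unfolding Ci m_def using insert.hyps by simp
    have other: "(\<Prod>l\<in>L - {\<kappa> i}. \<Prod>j<card {j \<in> insert i I. \<kappa> j = l}. card (X \<inter> C l) - j) =
        (\<Prod>l\<in>L - {\<kappa> i}. \<Prod>j<card {j \<in> I. \<kappa> j = l}. card (X \<inter> C l) - j)"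
    proof (rule prod.cong[OF refl])
      fix l assume "l \<in> L - {\<kappa> i}"
      then have "{j \<in> insert i I. \<kappa> j = l} = {j \<in> I. \<kappa> j = l}" by auto
      then show "(\<Prod>j<card {j \<in> insert i I. \<kappa> j = l}. card (X \<inter> C l) - j) = (\<Prod>j<card {j \<in> I. \<kappa> j = l}. card (X \<inter> C l) - j)" by simp
    qed
    show ?thesis
      unfolding prod.remove[OF \<open>finite L\<close> ki] other card_i by (simp add: m_def)
  qed
  finally show ?case .
qed

text \<open>The factor \<open>n (n - 1) \<cdots> (n - m + 1)\<close> cancels against \<open>n!\<close> and shifts the exponential series by \<open>m\<close>.\<close>

lemma poisson_factorial_moment_series:
  fixes l :: real
  assumes l: "0 \<le> l"
  shows "(\<Sum>n. ennreal (real (\<Prod>j<m. n - j)) * ennreal (l ^ n / fact n * exp (- l))) = ennreal (l ^ m)"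
proof -
  let ?a = "\<lambda>n. real (\<Prod>j<m. n - j) * (l ^ n / fact n * exp (- l))"
  have shift: "?a (n + m) = l ^ m * exp (- l) * (l ^ n /\<^sub>R fact n)" for n
  proof -
    have "(\<Prod>j<m. n + m - j) * fact n = (fact (n + m) :: nat)"
    proof (induction m)
      case (Suc m)
      have "(\<Prod>j<Suc m. n + Suc m - j) = (n + Suc m) * (\<Prod>j<m. n + m - j)"
        by (subst prod.lessThan_Suc_shift) simp
      then have "(\<Prod>j<Suc m. n + Suc m - j) * fact n = (n + Suc m) * ((\<Prod>j<m. n + m - j) * fact n)"
        by (simp only: mult.assoc)
      then show ?case unfolding Suc by simp
    qed simp
    then have "real (\<Prod>j<m. n + m - j) * fact n = fact (n + m)"
      by (metis of_nat_fact of_nat_mult)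
    then have "real (\<Prod>j<m. n + m - j) = fact (n + m) / fact n" by (simp add: field_simps)
    then show ?thesis by (simp add: power_add divide_simps)
  qed
  have zero: "?a n = 0" if "n < m" for n
  proof -
    have "(\<Prod>j<m. n - j) = 0" using that by (intro prod_zero) auto
    then show ?thesis by simp
  qed
  have "(\<lambda>n. ?a (n + m)) sums (l ^ m * exp (- l) * exp l)"
    unfolding shift by (intro sums_mult exp_converges)
  then have "?a sums (l ^ m * exp (- l) * exp l + (\<Sum>n<m. ?a n))"
    by (rule sums_iff_shift[THEN iffD1])
  moreover have "(\<Sum>n<m. ?a n) = 0" by (intro sum.neutral ballI zero) simp
  moreover have "l ^ m * exp (- l) * exp l = l ^ m" by (simp add: exp_minus)
  ultimately have s: "?a sums (l ^ m)" by (simp only: add_0_right)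
  have "(\<Sum>n. ennreal (?a n)) = ennreal (l ^ m)"
  proof (rule suminf_ennreal_eq[OF _ s])
    show "0 \<le> ?a n" for n
      using l by (intro mult_nonneg_nonneg divide_nonneg_nonneg zero_le_power of_nat_0_le_iff) auto
  qed
  moreover have "ennreal (real (\<Prod>j<m. n - j)) * ennreal (l ^ n / fact n * exp (- l)) = ennreal (?a n)" for n
    by (rule ennreal_mult'[symmetric]) (rule of_nat_0_le_iff)
  ultimately show ?thesis by (simp only:)
qed

locale poisson_process = prob_space M
  for M :: "'w measure" and \<eta> :: "'w \<Rightarrow> 'a::euclidean_space set" and W :: "'a set" and t :: real +
  assumes poisson: "poisson_process_on M \<eta> W t"
    and t_nonneg: "0 \<le> t" and W_borel [measurable, simp]: "W \<in> sets borel"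
    and W_finite: "emeasure lborel W < \<infinity>"
begin

lemma finite_points: "\<omega> \<in> space M \<Longrightarrow> finite (\<eta> \<omega>)"
  using poisson unfolding poisson_process_on_def by blast

lemma count_measurable [measurable]:
  "B \<in> sets borel \<Longrightarrow> (\<lambda>\<omega>. card (\<eta> \<omega> \<inter> B)) \<in> measurable M (count_space UNIV)"
  using poisson unfolding poisson_process_on_def by blast

text \<open>The factorial moment measure of order \<open>card I\<close> of the process.\<close>

definition intensity :: "'i set \<Rightarrow> ('i \<Rightarrow> 'a) measure" where
  "intensity I = density (\<Pi>\<^sub>M i\<in>I. lborel) (\<lambda>z. ennreal (t ^ card I) * (\<Prod>i\<in>I. indicator W (z i)))"

lemma sets_intensity [measurable_cong, simp]: "sets (intensity I) = sets (\<Pi>\<^sub>M i\<in>I. lborel)"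
  by (simp add: intensity_def)

lemma space_intensity [simp]: "space (intensity I) = (I \<rightarrow>\<^sub>E UNIV)"
  by (simp add: intensity_def space_PiM)

lemma factorial_moment_count:
  assumes B[measurable]: "B \<in> sets borel"
  shows "(\<integral>\<^sup>+\<omega>. ennreal (real (\<Prod>j<m. card (\<eta> \<omega> \<inter> B) - j)) \<partial>M) = (ennreal t * emeasure lborel (B \<inter> W)) ^ m"
proof -
  let ?N = "\<lambda>\<omega>. card (\<eta> \<omega> \<inter> B)"
  define l where "l = t * measure lborel (B \<inter> W)"
  have l: "0 \<le> l" unfolding l_def using t_nonneg by simp
  have prob: "emeasure M {\<omega> \<in> space M. ?N \<omega> = n} = ennreal (l ^ n / fact n * exp (- l))" for n
    using poisson B unfolding poisson_process_on_def l_def by (simp add: emeasure_eq_measure)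
  have "(\<integral>\<^sup>+\<omega>. ennreal (real (\<Prod>j<m. ?N \<omega> - j)) \<partial>M) =
    (\<integral>\<^sup>+\<omega>. (\<Sum>n. ennreal (real (\<Prod>j<m. n - j)) * indicator {\<omega> \<in> space M. ?N \<omega> = n} \<omega>) \<partial>M)"
  proof (rule nn_integral_cong)
    fix \<omega> assume \<omega>: "\<omega> \<in> space M"
    have "(\<Sum>n. ennreal (real (\<Prod>j<m. n - j)) * indicator {\<omega> \<in> space M. ?N \<omega> = n} \<omega>) =
       (\<Sum>n\<in>{?N \<omega>}. ennreal (real (\<Prod>j<m. n - j)) * indicator {\<omega> \<in> space M. ?N \<omega> = n} \<omega>)"
      by (rule suminf_finite) auto
    then show "ennreal (real (\<Prod>j<m. ?N \<omega> - j)) = (\<Sum>n. ennreal (real (\<Prod>j<m. n - j)) * indicator {\<omega> \<in> space M. ?N \<omega> = n} \<omega>)"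
      using \<omega> by simp
  qed
  also have "\<dots> = (\<Sum>n. \<integral>\<^sup>+\<omega>. ennreal (real (\<Prod>j<m. n - j)) * indicator {\<omega> \<in> space M. ?N \<omega> = n} \<omega> \<partial>M)"
    by (rule nn_integral_suminf) measurable
  also have "\<dots> = (\<Sum>n. ennreal (real (\<Prod>j<m. n - j)) * ennreal (l ^ n / fact n * exp (- l)))"
  proof (rule suminf_cong)
    fix n
    have "{\<omega> \<in> space M. ?N \<omega> = n} \<in> sets M" by measurable
    then show "(\<integral>\<^sup>+\<omega>. ennreal (real (\<Prod>j<m. n - j)) * indicator {\<omega> \<in> space M. ?N \<omega> = n} \<omega> \<partial>M) =
      ennreal (real (\<Prod>j<m. n - j)) * ennreal (l ^ n / fact n * exp (- l))"
      by (simp only: nn_integral_cmult_indicator prob)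
  qed
  also have "\<dots> = ennreal (l ^ m)" by (rule poisson_factorial_moment_series[OF l])
  also have "\<dots> = (ennreal t * emeasure lborel (B \<inter> W)) ^ m"
  proof -
    have "emeasure lborel (B \<inter> W) \<le> emeasure lborel W" by (intro emeasure_mono) auto
    then have "emeasure lborel (B \<inter> W) = ennreal (measure lborel (B \<inter> W))"
      using W_finite by (intro emeasure_eq_ennreal_measure) auto
    then have "ennreal t * emeasure lborel (B \<inter> W) = ennreal l"
      using t_nonneg unfolding l_def by (simp add: ennreal_mult)
    then show ?thesis using l by (simp add: ennreal_power)
  qed
  finally show ?thesis .
qed

lemma indep_counts:
  assumes "finite F" "F \<subseteq> sets borel" "disjoint F"
  shows "indep_vars (\<lambda>_. count_space UNIV) (\<lambda>B \<omega>. card (\<eta> \<omega> \<inter> B)) F"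
  using poisson assms unfolding poisson_process_on_def by blast

definition tuple_sum :: "'i set \<Rightarrow> (('i \<Rightarrow> 'a) \<Rightarrow> ennreal) \<Rightarrow> 'w \<Rightarrow> ennreal" where
  "tuple_sum I f \<omega> = (\<Sum>z\<in>inj_tuples I (\<eta> \<omega>). f z)"

text \<open>Measurability belongs to the property, so that a single monotone class argument yields it together
  with the value of the expectation.\<close>

definition campbell :: "'i set \<Rightarrow> (('i \<Rightarrow> 'a) \<Rightarrow> ennreal) \<Rightarrow> bool" where
  "campbell I f \<longleftrightarrow> tuple_sum I f \<in> borel_measurable M \<and>
     (\<integral>\<^sup>+\<omega>. tuple_sum I f \<omega> \<partial>M) = (\<integral>\<^sup>+z. f z \<partial>intensity I)"

lemma campbell_cong:
  assumes "\<And>z. z \<in> I \<rightarrow>\<^sub>E UNIV \<Longrightarrow> f z = g z"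
  shows "campbell I f \<longleftrightarrow> campbell I g"
proof -
  have "tuple_sum I f = tuple_sum I g"
    unfolding tuple_sum_def using assms by (intro ext sum.cong) (auto simp: inj_tuples_def)
  moreover have "(\<integral>\<^sup>+z. f z \<partial>intensity I) = (\<integral>\<^sup>+z. g z \<partial>intensity I)"
    using assms by (intro nn_integral_cong) auto
  ultimately show ?thesis unfolding campbell_def by simp
qed

lemma campbell_sum:
  assumes "finite A" "\<And>a. a \<in> A \<Longrightarrow> campbell I (f a)"
    and "\<And>a. a \<in> A \<Longrightarrow> f a \<in> borel_measurable (\<Pi>\<^sub>M i\<in>I. lborel)"
  shows "campbell I (\<lambda>z. \<Sum>a\<in>A. f a z)"
proof -
  have *: "tuple_sum I (\<lambda>z. \<Sum>a\<in>A. f a z) = (\<lambda>\<omega>. \<Sum>a\<in>A. tuple_sum I (f a) \<omega>)"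
    unfolding tuple_sum_def by (intro ext sum.swap)
  have [measurable]: "a \<in> A \<Longrightarrow> tuple_sum I (f a) \<in> borel_measurable M" for a
    using assms(2) unfolding campbell_def by blast
  have "(\<integral>\<^sup>+\<omega>. (\<Sum>a\<in>A. tuple_sum I (f a) \<omega>) \<partial>M) = (\<Sum>a\<in>A. \<integral>\<^sup>+\<omega>. tuple_sum I (f a) \<omega> \<partial>M)"
    by (rule nn_integral_sum) simp
  also have "\<dots> = (\<Sum>a\<in>A. \<integral>\<^sup>+z. f a z \<partial>intensity I)"
    using assms(2) unfolding campbell_def by simp
  also have "\<dots> = (\<integral>\<^sup>+z. (\<Sum>a\<in>A. f a z) \<partial>intensity I)"
    using assms(3) by (intro nn_integral_sum[symmetric]) (simp cong: measurable_cong_sets)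
  finally show ?thesis unfolding campbell_def * by simp
qed

lemma nn_integral_rectangle_intensity:
  assumes "finite I" and [measurable]: "\<And>i. i \<in> I \<Longrightarrow> B i \<in> sets borel"
  shows "(\<integral>\<^sup>+z. (\<Prod>i\<in>I. indicator (B i) (z i)) \<partial>intensity I) = (\<Prod>i\<in>I. ennreal t * emeasure lborel (B i \<inter> W))"
proof -
  have "(\<integral>\<^sup>+z. (\<Prod>i\<in>I. indicator (B i) (z i)) \<partial>intensity I) =
    (\<integral>\<^sup>+z. ennreal (t ^ card I) * (\<Prod>i\<in>I. indicator W (z i)) * (\<Prod>i\<in>I. indicator (B i) (z i)) \<partial>(\<Pi>\<^sub>M i\<in>I. lborel))"
    unfolding intensity_def using assms by (intro nn_integral_density) auto
  also have "\<dots> = (\<integral>\<^sup>+z. (\<Prod>i\<in>I. ennreal t * indicator (B i \<inter> W) (z i)) \<partial>(\<Pi>\<^sub>M i\<in>I. lborel))"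
    using t_nonneg by (intro nn_integral_cong)
      (simp add: prod.distrib indicator_inter_arith ennreal_power mult.assoc mult.commute[of "prod (\<lambda>i. indicator W _) I"] mult.left_commute, simp add: mult.commute)
  also have "\<dots> = (\<Prod>i\<in>I. \<integral>\<^sup>+x. ennreal t * indicator (B i \<inter> W) x \<partial>lborel)"
    using assms by (intro lborel_PiM.product_nn_integral_prod) auto
  also have "\<dots> = (\<Prod>i\<in>I. ennreal t * emeasure lborel (B i \<inter> W))"
    using assms by (intro prod.cong refl nn_integral_cmult_indicator) auto
  finally show ?thesis .
qed

text \<open>The number of injective tuples is a product of falling factorials of the numbers of points in
  disjoint sets. These numbers are independent Poisson variables, and the factorial moments of a
  Poisson variable are the powers of its mean.\<close>

lemma campbell_disjoint_rectangle:
  assumes I: "finite I" and F: "finite F" "F \<subseteq> sets borel" "disjoint F" and B: "\<And>i. i \<in> I \<Longrightarrow> B i \<in> F"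
  shows "campbell I (\<lambda>z. \<Prod>i\<in>I. indicator (B i) (z i))"
proof -
  define m where "m C = card {i \<in> I. B i = C}" for C
  define Y where "Y C n = ennreal (real (\<Prod>j<m C. n - j))" for C n
  have ts: "tuple_sum I (\<lambda>z. \<Prod>i\<in>I. indicator (B i) (z i)) \<omega> = (\<Prod>C\<in>F. Y C (card (\<eta> \<omega> \<inter> C)))"
    if \<omega>: "\<omega> \<in> space M" for \<omega>
  proof -
    have "tuple_sum I (\<lambda>z. \<Prod>i\<in>I. indicator (B i) (z i)) \<omega> =
      (\<Sum>z\<in>inj_tuples I (\<eta> \<omega>). if \<forall>i\<in>I. z i \<in> B i then 1 else 0)"
      unfolding tuple_sum_def using I by (intro sum.cong refl) (auto simp: indicator_def intro: prod_zero)
    also have "\<dots> = of_nat (card {z \<in> inj_tuples I (\<eta> \<omega>). \<forall>i\<in>I. z i \<in> B i})"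
      using I finite_points[OF \<omega>] by (simp add: sum.If_cases Int_def)
    also have c: "card {z \<in> inj_tuples I (\<eta> \<omega>). \<forall>i\<in>I. z i \<in> B i} =
        (\<Prod>C\<in>F. \<Prod>j<card {i \<in> I. B i = C}. card (\<eta> \<omega> \<inter> C) - j)"
      using card_inj_tuples_rectangle[of I "\<eta> \<omega>" F "\<lambda>C. C" B] I F B finite_points[OF \<omega>]
      by (simp add: disjoint_def disjoint_family_on_def)
    also have "of_nat \<dots> = (\<Prod>C\<in>F. Y C (card (\<eta> \<omega> \<inter> C)))"
      unfolding Y_def m_def
      by (simp only: ennreal_of_nat_eq_real_of_nat of_nat_prod prod_ennreal of_nat_0_le_iff prod_nonneg)
    finally show ?thesis .
  qed
  have [measurable]: "C \<in> sets borel" if "C \<in> F" for C using F that by auto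
  have meas: "(\<lambda>\<omega>. Y C (card (\<eta> \<omega> \<inter> C))) \<in> borel_measurable M" if "C \<in> F" for C
    using F(2) that by (intro measurable_compose[OF count_measurable]) auto
  have "indep_vars (\<lambda>_. borel) (\<lambda>C \<omega>. Y C (card (\<eta> \<omega> \<inter> C))) F"
    by (rule indep_vars_compose2[OF indep_counts[OF F]]) simp
  then have "(\<integral>\<^sup>+\<omega>. (\<Prod>C\<in>F. Y C (card (\<eta> \<omega> \<inter> C))) \<partial>M) = (\<Prod>C\<in>F. \<integral>\<^sup>+\<omega>. Y C (card (\<eta> \<omega> \<inter> C)) \<partial>M)"
    by (intro indep_vars_nn_integral F) auto
  also have "\<dots> = (\<Prod>C\<in>F. (ennreal t * emeasure lborel (C \<inter> W)) ^ m C)"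
    unfolding Y_def using F by (intro prod.cong refl factorial_moment_count) auto
  also have "\<dots> = (\<Prod>C\<in>F. \<Prod>i\<in>{i \<in> I. B i = C}. ennreal t * emeasure lborel (B i \<inter> W))"
    unfolding m_def by (intro prod.cong refl) simp
  also have "\<dots> = (\<Prod>i\<in>I. ennreal t * emeasure lborel (B i \<inter> W))"
    using B by (intro prod.group I F) auto
  also have "\<dots> = (\<integral>\<^sup>+z. (\<Prod>i\<in>I. indicator (B i) (z i)) \<partial>intensity I)"
    using F B by (intro nn_integral_rectangle_intensity[symmetric] I) auto
  finally have "(\<integral>\<^sup>+\<omega>. tuple_sum I (\<lambda>z. \<Prod>i\<in>I. indicator (B i) (z i)) \<omega> \<partial>M) = (\<integral>\<^sup>+z. (\<Prod>i\<in>I. indicator (B i) (z i)) \<partial>intensity I)"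
    using ts by (simp cong: nn_integral_cong)
  moreover have "tuple_sum I (\<lambda>z. \<Prod>i\<in>I. indicator (B i) (z i)) \<in> borel_measurable M"
    using meas by (subst measurable_cong[OF ts]) auto
  ultimately show ?thesis unfolding campbell_def by simp
qed

text \<open>The sides of an arbitrary rectangle are disjoint unions of the atoms that they generate, so the
  rectangle is a disjoint union of rectangles whose sides are pairwise equal or disjoint.\<close>

lemma campbell_rectangle:
  assumes I: "finite I" and B: "\<And>i. i \<in> I \<Longrightarrow> B i \<in> sets borel"
  shows "campbell I (\<lambda>z. \<Prod>i\<in>I. indicator (B i) (z i))"
proof -
  define atom where "atom S = {x. \<forall>i\<in>I. x \<in> B i \<longleftrightarrow> i \<in> S}" for S
  define F where "F = atom ` Pow I"
  define G where "G i = {C \<in> F. C \<subseteq> B i}" for i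
  have F: "finite F" "disjoint F" unfolding F_def atom_def using I by (auto simp: disjoint_def) 
  have Fb: "F \<subseteq> sets borel"
  proof -
    have "atom S \<in> sets borel" for S
    proof -
      have "{x \<in> space borel. x \<in> B i \<longleftrightarrow> i \<in> S} \<in> sets borel" if "i \<in> I" for i
      proof -
        have "{x \<in> space borel. x \<in> B i \<longleftrightarrow> i \<in> S} = (if i \<in> S then B i else - B i)" by auto
        then show ?thesis using B[OF that] by (simp add: borel_comp)
      qed
      then have "{x \<in> space borel. \<forall>i\<in>I. x \<in> B i \<longleftrightarrow> i \<in> S} \<in> sets borel"
        by (intro sets.sets_Collect_finite_All I)
      then show ?thesis by (simp add: atom_def)
    qed
    then show ?thesis unfolding F_def by auto
  qed
  have ind: "indicator (B i) x = (\<Sum>C\<in>G i. indicator C x :: ennreal)" if i: "i \<in> I" for i x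
  proof -
    define C0 where "C0 = atom {i \<in> I. x \<in> B i}"
    have x0: "x \<in> C0" unfolding C0_def atom_def by simp
    have C0: "C0 \<in> F" unfolding C0_def F_def by (rule imageI) auto
    have "(\<Sum>C\<in>G i. indicator C x :: ennreal) = (\<Sum>C\<in>G i. if C = C0 then 1 else 0)"
    proof (rule sum.cong[OF refl])
      fix C assume "C \<in> G i"
      then have "C \<in> F" by (simp add: G_def)
      then show "indicator C x = (if C = C0 then 1 else 0 :: ennreal)"
        using F(2) C0 x0 by (auto simp: disjoint_def indicator_def)
    qed
    also have "\<dots> = (if C0 \<in> G i then 1 else 0)" using F by (simp add: G_def)
    also have "C0 \<in> G i \<longleftrightarrow> x \<in> B i"
    proof
      assume "C0 \<in> G i" then show "x \<in> B i" using x0 by (auto simp: G_def)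
    next
      assume "x \<in> B i"
      then have "C0 \<subseteq> B i" unfolding C0_def atom_def using i by auto
      then show "C0 \<in> G i" using C0 by (simp add: G_def)
    qed
    finally show ?thesis by (simp add: indicator_def)
  qed
  have "campbell I (\<lambda>z. \<Sum>g\<in>PiE I G. \<Prod>i\<in>I. indicator (g i) (z i))"
  proof (rule campbell_sum)
    show "finite (PiE I G)" using I F by (intro finite_PiE) (auto simp: G_def)
    fix g assume g: "g \<in> PiE I G"
    then have gF: "g i \<in> F" if "i \<in> I" for i using that by (auto simp: G_def PiE_iff)
    show "campbell I (\<lambda>z. \<Prod>i\<in>I. indicator (g i) (z i))"
      by (rule campbell_disjoint_rectangle[OF I F(1) Fb F(2) gF])
    have [measurable]: "g i \<in> sets borel" if "i \<in> I" for i using gF[OF that] Fb by auto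
    show "(\<lambda>z. \<Prod>i\<in>I. indicator (g i) (z i) :: ennreal) \<in> borel_measurable (\<Pi>\<^sub>M i\<in>I. lborel)"
      by measurable
  qed
  moreover have "(\<lambda>z :: 'b \<Rightarrow> 'a. \<Sum>g\<in>PiE I G. \<Prod>i\<in>I. indicator (g i) (z i) :: ennreal) = (\<lambda>z. \<Prod>i\<in>I. indicator (B i) (z i))"
  proof
    fix z :: "'b \<Rightarrow> 'a"
    have "(\<Prod>i\<in>I. indicator (B i) (z i) :: ennreal) = (\<Prod>i\<in>I. \<Sum>C\<in>G i. indicator C (z i))"
      using ind by (intro prod.cong) auto
    also have "\<dots> = (\<Sum>g\<in>PiE I G. \<Prod>i\<in>I. indicator (g i) (z i))"
      using I F by (intro prod_sum_PiE) (auto simp: G_def)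
    finally show "(\<Sum>g\<in>PiE I G. \<Prod>i\<in>I. indicator (g i) (z i) :: ennreal) = (\<Prod>i\<in>I. indicator (B i) (z i))" by simp
  qed
  ultimately show ?thesis by simp
qed

text \<open>Rectangles are stable under intersection and generate the product sigma-algebra. Complements are
  handled by subtraction, which needs that the total mass is finite.\<close>

lemma campbell_indicator:
  assumes I: "finite I" and A: "A \<in> sets (\<Pi>\<^sub>M i\<in>I. (lborel :: 'a measure))"
  shows "campbell I (indicator A)"
proof -
  let ?P = "\<Pi>\<^sub>M i\<in>I. (lborel :: 'a measure)"
  let ?\<Omega> = "\<Pi>\<^sub>E i\<in>I. space (lborel :: 'a measure)"
  have A': "A \<in> sigma_sets ?\<Omega> (prod_algebra I (\<lambda>_. lborel :: 'a measure))"
    using A unfolding sets_PiM .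
  have rect: "campbell I (indicator (Pi\<^sub>E I X))" if "\<And>i. i \<in> I \<Longrightarrow> X i \<in> sets (lborel :: 'a measure)" for X
  proof -
    have "campbell I (\<lambda>z. \<Prod>i\<in>I. indicator (X i) (z i))" using that by (intro campbell_rectangle I) auto
    then show ?thesis
    proof (subst campbell_cong)
      fix z :: "_ \<Rightarrow> 'a" assume "z \<in> I \<rightarrow>\<^sub>E UNIV"
      then show "indicator (Pi\<^sub>E I X) z = (\<Prod>i\<in>I. indicator (X i) (z i) :: ennreal)"
        using I by (auto simp: indicator_def PiE_iff intro!: prod_zero[symmetric])
    qed
  qed
  have total: "campbell I (indicator ?\<Omega>)" by (rule rect) auto
  have fin: "emeasure (intensity I) ?\<Omega> < \<infinity>"
  proof -
    have "emeasure (intensity I) ?\<Omega> = (\<integral>\<^sup>+z. (\<Prod>i\<in>I. indicator UNIV (z i)) \<partial>intensity I)"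
      using emeasure_space_1 by (simp add: nn_integral_const emeasure_eq_measure2)
    also have "\<dots> = (\<Prod>i\<in>I. ennreal t * emeasure lborel (UNIV \<inter> W))"
      by (rule nn_integral_rectangle_intensity[OF I]) simp
    also have "\<dots> < \<infinity>" using W_finite by (auto simp: ennreal_mult_less_top power_less_top_ennreal)
    finally show ?thesis .
  qed
  from Int_stable_prod_algebra prod_algebra_sets_into_space A' show ?thesis
  proof (induction rule: sigma_sets_induct_disjoint)
    case (basic A)
    then obtain X where "A = Pi\<^sub>E I X" "X \<in> (\<Pi> i\<in>I. sets (lborel :: 'a measure))"
      by (rule prod_algebraE_all)
    then show ?case using rect by auto
  next
    case empty
    have "tuple_sum I (\<lambda>_. 0) = (\<lambda>_. 0)" by (simp add: tuple_sum_def fun_eq_iff)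
    then show ?case by (simp add: campbell_def)
  next
    case (compl A)
    have AP: "A \<in> sets ?P" using compl(1) unfolding sets_PiM .
    have sub: "A \<subseteq> ?\<Omega>" using sets.sets_into_space[OF AP] by (simp add: space_PiM)
    have le: "tuple_sum I (indicator A) \<omega> \<le> tuple_sum I (indicator ?\<Omega>) \<omega>" for \<omega>
      unfolding tuple_sum_def using sub by (intro sum_mono) (auto split: split_indicator)
    have finA: "tuple_sum I (indicator A) \<omega> < \<infinity>" for \<omega>
      unfolding tuple_sum_def by (cases "finite (inj_tuples I (\<eta> \<omega>))") (auto simp: indicator_def of_nat_less_top)
    have eq: "tuple_sum I (indicator (?\<Omega> - A)) = (\<lambda>\<omega>. tuple_sum I (indicator ?\<Omega>) \<omega> - tuple_sum I (indicator A) \<omega>)"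
    proof
      fix \<omega>
      have "tuple_sum I (indicator (?\<Omega> - A)) \<omega> + tuple_sum I (indicator A) \<omega> = tuple_sum I (indicator ?\<Omega>) \<omega>"
        unfolding tuple_sum_def sum.distrib[symmetric] using sub by (intro sum.cong) (auto split: split_indicator)
      then show "tuple_sum I (indicator (?\<Omega> - A)) \<omega> = tuple_sum I (indicator ?\<Omega>) \<omega> - tuple_sum I (indicator A) \<omega>"
        using finA[of \<omega>] by (metis ennreal_add_diff_cancel_right infinity_ennreal_def less_irrefl)
    qed
    have m[measurable]: "tuple_sum I (indicator A) \<in> borel_measurable M" "tuple_sum I (indicator ?\<Omega>) \<in> borel_measurable M"
      using compl total unfolding campbell_def by auto
    have iA: "(\<integral>\<^sup>+\<omega>. tuple_sum I (indicator A) \<omega> \<partial>M) = emeasure (intensity I) A"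
      using compl(2) AP unfolding campbell_def by simp
    have i\<Omega>: "(\<integral>\<^sup>+\<omega>. tuple_sum I (indicator ?\<Omega>) \<omega> \<partial>M) = emeasure (intensity I) ?\<Omega>"
    proof -
      have "?\<Omega> \<in> sets (intensity I)" using sets.top[of ?P] by (simp add: space_PiM)
      then show ?thesis using total unfolding campbell_def by simp
    qed
    have leA: "emeasure (intensity I) A \<le> emeasure (intensity I) ?\<Omega>"
      using sub sets.top[of ?P] by (intro emeasure_mono) (auto simp: space_PiM)
    have "(\<integral>\<^sup>+\<omega>. tuple_sum I (indicator (?\<Omega> - A)) \<omega> \<partial>M) = emeasure (intensity I) ?\<Omega> - emeasure (intensity I) A"
      unfolding eq using le leA fin iA i\<Omega> m by (subst nn_integral_diff) (auto simp: top_unique)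
    also have "\<dots> = emeasure (intensity I) (?\<Omega> - A)"
      using sub AP leA fin sets.top[of ?P] by (intro emeasure_Diff[symmetric]) (auto simp: space_PiM top_unique)
    also have "\<dots> = (\<integral>\<^sup>+z. indicator (?\<Omega> - A) z \<partial>intensity I)"
    proof -
      have "?\<Omega> - A \<in> sets (intensity I)" using sets.compl_sets[OF AP] by (simp add: space_PiM)
      then show ?thesis by simp
    qed
    finally show ?case unfolding campbell_def unfolding eq using m by simp
  next
    case (union A)
    have AP: "A n \<in> sets ?P" for n using union(2) unfolding sets_PiM by auto
    have ind: "indicator (\<Union>n. A n) z = (\<Sum>n. indicator (A n) z :: ennreal)" for z
      using union(1) by (intro suminf_indicator[symmetric])
    have ts: "tuple_sum I (indicator (\<Union>n. A n)) \<omega> = (\<Sum>n. tuple_sum I (indicator (A n)) \<omega>)" for \<omega>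
      unfolding tuple_sum_def ind by (rule suminf_sum[symmetric]) simp
    then have ts': "tuple_sum I (indicator (\<Union>n. A n)) = (\<lambda>\<omega>. \<Sum>n. tuple_sum I (indicator (A n)) \<omega>)" by (rule ext)
    have m[measurable]: "tuple_sum I (indicator (A n)) \<in> borel_measurable M" for n
      using union(3) unfolding campbell_def by auto
    have meas: "(\<lambda>\<omega>. \<Sum>n. tuple_sum I (indicator (A n)) \<omega>) \<in> borel_measurable M" by measurable
    have "(\<integral>\<^sup>+\<omega>. (\<Sum>n. tuple_sum I (indicator (A n)) \<omega>) \<partial>M) = (\<Sum>n. \<integral>\<^sup>+\<omega>. tuple_sum I (indicator (A n)) \<omega> \<partial>M)"
      by (rule nn_integral_suminf) measurable
    also have "\<dots> = (\<Sum>n. \<integral>\<^sup>+z. indicator (A n) z \<partial>intensity I)"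
      using union(3) unfolding campbell_def by simp
    also have "\<dots> = (\<integral>\<^sup>+z. indicator (\<Union>n. A n) z \<partial>intensity I)"
      unfolding ind using AP by (intro nn_integral_suminf[symmetric]) auto
    finally show ?case
      unfolding campbell_def ts' using meas by blast
  qed
qed

lemma campbell_formula:
  fixes f :: "('i \<Rightarrow> 'a) \<Rightarrow> ennreal"
  assumes I: "finite I" and f: "f \<in> borel_measurable (\<Pi>\<^sub>M i\<in>I. lborel)"
  shows "campbell I f"
  using f
proof (induction rule: borel_measurable_induct)
  case (cong f g)
  then show ?case by (subst campbell_cong[of I f g]) (auto simp: space_PiM)
next
  case (set A)
  then show ?case by (rule campbell_indicator[OF I])
next
  case (mult u c)
  have "tuple_sum I (\<lambda>z. c * u z) = (\<lambda>\<omega>. c * tuple_sum I u \<omega>)"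
    by (simp add: tuple_sum_def sum_distrib_left fun_eq_iff)
  moreover have [measurable]: "tuple_sum I u \<in> borel_measurable M" using mult unfolding campbell_def by simp
  moreover have "(\<lambda>\<omega>. c * tuple_sum I u \<omega>) \<in> borel_measurable M" by measurable
  moreover have "u \<in> borel_measurable (intensity I)" using mult by (simp cong: measurable_cong_sets)
  ultimately show ?case using mult unfolding campbell_def by (simp add: nn_integral_cmult)
next
  case (add u v)
  have "tuple_sum I (\<lambda>z. v z + u z) = (\<lambda>\<omega>. tuple_sum I v \<omega> + tuple_sum I u \<omega>)"
    by (simp add: tuple_sum_def sum.distrib fun_eq_iff)
  moreover have [measurable]: "tuple_sum I u \<in> borel_measurable M" "tuple_sum I v \<in> borel_measurable M"
    using add unfolding campbell_def by simp_all
  moreover have "(\<lambda>\<omega>. tuple_sum I v \<omega> + tuple_sum I u \<omega>) \<in> borel_measurable M" by measurable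
  moreover have "u \<in> borel_measurable (intensity I)" "v \<in> borel_measurable (intensity I)"
    using add by (simp_all cong: measurable_cong_sets)
  ultimately show ?case using add unfolding campbell_def by (simp add: nn_integral_add)
next
  case (seq U)
  have SU: "(SUP i. U i) = (\<lambda>z. SUP i. U i z)" by (simp add: fun_eq_iff image_comp)
  have ts: "tuple_sum I (\<lambda>z. SUP i. U i z) = (\<lambda>\<omega>. SUP i. tuple_sum I (U i) \<omega>)"
  proof
    fix \<omega>
    have "incseq (\<lambda>i. U i z)" for z using seq.hyps(3) by (auto simp: incseq_def le_fun_def)
    then show "tuple_sum I (\<lambda>z. SUP i. U i z) \<omega> = (SUP i. tuple_sum I (U i) \<omega>)"
      unfolding tuple_sum_def by (simp add: ennreal_SUP_sum image_comp)
  qed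
  have m: "tuple_sum I (U i) \<in> borel_measurable M" for i using seq.IH unfolding campbell_def by simp
  have inc: "incseq (\<lambda>i. tuple_sum I (U i))"
    using seq.hyps(3) by (auto simp: incseq_def le_fun_def tuple_sum_def intro!: sum_mono)
  have "(\<integral>\<^sup>+\<omega>. (SUP i. tuple_sum I (U i) \<omega>) \<partial>M) = (SUP i. \<integral>\<^sup>+\<omega>. tuple_sum I (U i) \<omega> \<partial>M)"
    by (rule nn_integral_monotone_convergence_SUP[OF inc m])
  also have "\<dots> = (SUP i. \<integral>\<^sup>+z. U i z \<partial>intensity I)" using seq.IH unfolding campbell_def by simp
  also have "\<dots> = (\<integral>\<^sup>+z. (SUP i. U i z) \<partial>intensity I)"
    using seq.hyps(1,3) by (intro nn_integral_monotone_convergence_SUP[symmetric]) (simp_all cong: measurable_cong_sets)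
  finally show ?case
    unfolding campbell_def ts SU using m by simp
qed

end

section \<open>Pairs of simplices sorted by their overlap\<close>

text \<open>The factor \<open>1 / (k + 1)!\<close> compensates for the orderings of each vertex set.\<close>

lemma rips_functional_eq_sum_sets:
  fixes X :: "'a::euclidean_space set"
  assumes "finite X"
  shows "rips_functional s k \<alpha> X = (\<Sum>S | S \<subseteq> X \<and> card S = k + 1. simplex_weight s k \<alpha> S)"
proof -
  let ?L = "{xs. length xs = k + 1 \<and> distinct xs \<and> set xs \<subseteq> X}"
  let ?P = "{S. S \<subseteq> X \<and> card S = k + 1}"
  have finL: "finite ?L"
    by (rule finite_subset[OF _ finite_lists_length_eq[OF assms, of "k + 1"]]) auto
  have finP: "finite ?P" using assms by simp
  have "(\<Sum>xs\<in>?L. rips_vol_pow s \<alpha> xs) = (\<Sum>S\<in>?P. \<Sum>xs\<in>{xs \<in> ?L. set xs = S}. rips_vol_pow s \<alpha> xs)"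
    by (rule sum.group[symmetric, OF finL finP]) (auto simp: distinct_card)
  also have "\<dots> = (\<Sum>S\<in>?P. fact (k + 1) * simplex_weight s k \<alpha> S)"
  proof (rule sum.cong[OF refl])
    fix S assume S: "S \<in> ?P"
    have eq: "{xs \<in> ?L. set xs = S} = permutations_of_set S"
      using S by (auto simp: permutations_of_set_def distinct_card[symmetric])
    have "(\<Sum>xs\<in>{xs \<in> ?L. set xs = S}. rips_vol_pow s \<alpha> xs) = (\<Sum>xs\<in>{xs \<in> ?L. set xs = S}. simplex_weight s k \<alpha> S)"
      by (intro sum.cong) (auto simp: rips_vol_pow_eq_weight)
    also have "\<dots> = fact (k + 1) * simplex_weight s k \<alpha> S"
    proof -
      have "finite S" using S assms finite_subset by blast
      then have "card (permutations_of_set S) = fact (k + 1)" using S by (simp only: card_permutations_of_set mem_Collect_eq)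
      then show ?thesis unfolding eq by (simp del: fact_Suc)
    qed
    finally show "(\<Sum>xs\<in>{xs \<in> ?L. set xs = S}. rips_vol_pow s \<alpha> xs) = fact (k + 1) * simplex_weight s k \<alpha> S" .
  qed
  finally show ?thesis
    unfolding rips_functional_def by (simp add: sum_distrib_left[symmetric] del: fact_Suc)
qed

text \<open>Such a tuple consists of bijections from \<open>A \<inter> B\<close>, \<open>A - B\<close> and \<open>B - A\<close> onto \<open>S \<inter> T\<close>, \<open>S - T\<close> and
  \<open>T - S\<close>. They are counted as the injective tuples in a rectangle with these three sets as sides.\<close>

lemma card_overlap_fibre:
  fixes A B :: "'i set"
  assumes fin: "finite A" "finite B" "finite X"
    and S: "S \<subseteq> X" "card S = card A" and T: "T \<subseteq> X" "card T = card B"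
    and ST: "card (S \<inter> T) = card (A \<inter> B)"
  shows "card {z \<in> inj_tuples (A \<union> B) X. z ` A = S \<and> z ` B = T} =
    fact (card (A \<inter> B)) * fact (card (A - B)) * fact (card (B - A))"
proof -
  \<comment> \<open>The labels of the positions in \<open>A \<inter> B\<close>, \<open>A - B\<close> and \<open>B - A\<close>.\<close>
  define \<kappa> where "\<kappa> i = (if i \<in> A \<inter> B then 0 else if i \<in> A then 1 else (2::nat))" for i
  define C where "C = (\<lambda>l::nat. if l = 0 then S \<inter> T else if l = 1 then S - T else T - S)"
  have finST: "finite S" "finite T" using S T fin finite_subset by auto
  have eq: "{z \<in> inj_tuples (A \<union> B) X. z ` A = S \<and> z ` B = T} =
      {z \<in> inj_tuples (A \<union> B) X. \<forall>i\<in>A \<union> B. z i \<in> C (\<kappa> i)}"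
  proof (intro Collect_cong conj_cong refl iffI ballI)
    fix z i assume z: "z \<in> inj_tuples (A \<union> B) X" "z ` A = S \<and> z ` B = T" and i: "i \<in> A \<union> B"
    have inj: "inj_on z (A \<union> B)" using z by (simp add: inj_tuples_def)
    have "i \<in> A \<longleftrightarrow> z i \<in> S" "i \<in> B \<longleftrightarrow> z i \<in> T"
      using z(2) inj_on_image_mem_iff[OF inj i, of A] inj_on_image_mem_iff[OF inj i, of B] by auto
    then show "z i \<in> C (\<kappa> i)" using i by (auto simp: C_def \<kappa>_def)
  next
    fix z assume z: "z \<in> inj_tuples (A \<union> B) X" and zi: "\<forall>i\<in>A \<union> B. z i \<in> C (\<kappa> i)"
    have inj: "inj_on z (A \<union> B)" using z by (simp add: inj_tuples_def)
    have "z i \<in> S" if "i \<in> A" for i using bspec[OF zi, of i] that by (auto simp: C_def \<kappa>_def split: if_splits)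
    moreover have "z i \<in> T" if "i \<in> B" for i using bspec[OF zi, of i] that by (auto simp: C_def \<kappa>_def split: if_splits)
    moreover have "card (z ` A) = card S" "card (z ` B) = card T"
      using S T inj_on_subset[OF inj] by (simp_all add: card_image)
    ultimately show "z ` A = S \<and> z ` B = T"
      using finST by (intro conjI card_subset_eq) auto
  qed
  have "card {z \<in> inj_tuples (A \<union> B) X. \<forall>i\<in>A \<union> B. z i \<in> C (\<kappa> i)} =
     (\<Prod>l\<in>{0,1,2}. \<Prod>j<card {i \<in> A \<union> B. \<kappa> i = l}. card (X \<inter> C l) - j)"
    by (rule card_inj_tuples_rectangle) (use fin in \<open>auto simp: disjoint_family_on_def C_def \<kappa>_def\<close>)
  also have "\<dots> = fact (card (A \<inter> B)) * fact (card (A - B)) * fact (card (B - A))"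
  proof -
    have k: "{i \<in> A \<union> B. \<kappa> i = 0} = A \<inter> B" "{i \<in> A \<union> B. \<kappa> i = 1} = A - B" "{i \<in> A \<union> B. \<kappa> i = 2} = B - A"
      by (auto simp: \<kappa>_def split: if_splits)
    have c: "X \<inter> C 0 = S \<inter> T" "X \<inter> C 1 = S - T" "X \<inter> C 2 = T - S"
      using S T by (auto simp: C_def)
    have "card (S - T) = card (A - B)" "card (T - S) = card (B - A)"
      using S(2) T(2) ST fin finST by (simp_all add: card_Diff_subset_Int Int_commute)
    moreover have "(\<Prod>j<n. n - j) = fact n" for n :: nat
      unfolding fact_prod_rev lessThan_atLeast0 by simp
    moreover have "(\<Prod>l\<in>{0, 1, 2}. h l) = h 0 * h 1 * h 2" for h :: "nat \<Rightarrow> nat"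
      by (simp add: mult.assoc)
    ultimately show ?thesis using ST by (simp only: k c)
  qed
  finally show ?thesis unfolding eq .
qed

lemma sum_inj_tuples_overlap:
  fixes A B :: "'i set" and f g :: "'b set \<Rightarrow> ennreal"
  assumes fin: "finite A" "finite B" "finite X"
  shows "(\<Sum>z\<in>inj_tuples (A \<union> B) X. f (z ` A) * g (z ` B)) =
     of_nat (fact (card (A \<inter> B)) * fact (card (A - B)) * fact (card (B - A))) *
     (\<Sum>(S, T) | S \<subseteq> X \<and> T \<subseteq> X \<and> card S = card A \<and> card T = card B \<and> card (S \<inter> T) = card (A \<inter> B). f S * g T)"
    (is "_ = ?c * sum _ ?P")
proof -
  have finP: "finite ?P"
    by (rule finite_subset[of _ "Pow X \<times> Pow X"]) (use fin in auto)
  have finI: "finite (inj_tuples (A \<union> B) X)" using fin by simp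
  have img: "(\<lambda>z. (z ` A, z ` B)) ` inj_tuples (A \<union> B) X \<subseteq> ?P"
  proof (rule image_subsetI)
    fix z assume z: "z \<in> inj_tuples (A \<union> B) X"
    have inj: "inj_on z (A \<union> B)" using z by (simp add: inj_tuples_def)
    have "z ` A \<inter> z ` B = z ` (A \<inter> B)" using inj by (intro inj_on_image_Int[symmetric]) auto
    then show "(z ` A, z ` B) \<in> ?P"
      using z inj_on_subset[OF inj Un_upper1] inj_on_subset[OF inj Un_upper2] inj_on_subset[OF inj, of "A \<inter> B"]
      by (auto simp: card_image inj_tuples_def PiE_iff le_supI1)
  qed
  have "(\<Sum>z\<in>inj_tuples (A \<union> B) X. f (z ` A) * g (z ` B)) =
     (\<Sum>y\<in>?P. \<Sum>z\<in>{z \<in> inj_tuples (A \<union> B) X. (z ` A, z ` B) = y}. f (z ` A) * g (z ` B))"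
    by (rule sum.group[symmetric, OF finI finP img])
  also have "\<dots> = (\<Sum>y\<in>?P. ?c * (case y of (S, T) \<Rightarrow> f S * g T))"
  proof (rule sum.cong[OF refl])
    fix y assume y: "y \<in> ?P"
    obtain S T where yST: "y = (S, T)" by (cases y)
    have eq: "{z \<in> inj_tuples (A \<union> B) X. (z ` A, z ` B) = y} = {z \<in> inj_tuples (A \<union> B) X. z ` A = S \<and> z ` B = T}"
      by (simp add: yST)
    have "(\<Sum>z\<in>{z \<in> inj_tuples (A \<union> B) X. (z ` A, z ` B) = y}. f (z ` A) * g (z ` B)) =
      (\<Sum>z\<in>{z \<in> inj_tuples (A \<union> B) X. z ` A = S \<and> z ` B = T}. f S * g T)"
      unfolding eq by (rule sum.cong) auto
    also have "\<dots> = of_nat (card {z \<in> inj_tuples (A \<union> B) X. z ` A = S \<and> z ` B = T}) * (f S * g T)"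
      by simp
    also have "card {z \<in> inj_tuples (A \<union> B) X. z ` A = S \<and> z ` B = T} = fact (card (A \<inter> B)) * fact (card (A - B)) * fact (card (B - A))"
      using y yST by (intro card_overlap_fibre fin) auto
    finally show "(\<Sum>z\<in>{z \<in> inj_tuples (A \<union> B) X. (z ` A, z ` B) = y}. f (z ` A) * g (z ` B)) =
       ?c * (case y of (S, T) \<Rightarrow> f S * g T)" by (simp only: yST prod.case)
  qed
  also have "\<dots> = ?c * sum (\<lambda>(S, T). f S * g T) ?P"
    by (simp only: sum_distrib_left)
  finally show ?thesis .
qed

lemma sum_inj_tuples_single:
  fixes A :: "'i set" and f :: "'b set \<Rightarrow> ennreal"
  assumes fin: "finite A" "finite X"
  shows "(\<Sum>z\<in>inj_tuples A X. f (z ` A)) = of_nat (fact (card A)) * (\<Sum>S | S \<subseteq> X \<and> card S = card A. f S)"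
proof -
  let ?P = "{(S, T). S \<subseteq> X \<and> T \<subseteq> X \<and> card S = card A \<and> card T = card ({}::'i set) \<and> card (S \<inter> T) = card (A \<inter> {})}"
  have "?P = (\<lambda>S. (S, {})) ` {S. S \<subseteq> X \<and> card S = card A}"
  proof (intro equalityI subsetI)
    fix p assume "p \<in> ?P"
    then obtain S T where p: "p = (S, T)" "S \<subseteq> X" "T \<subseteq> X" "card S = card A" "card T = 0" by auto
    have "T = {}" using p(5) finite_subset[OF p(3) fin(2)] by simp
    then show "p \<in> (\<lambda>S. (S, {})) ` {S. S \<subseteq> X \<and> card S = card A}" using p by simp
  qed auto
  then have "(\<Sum>(S, T)\<in>?P. f S * 1) = (\<Sum>(S, T)\<in>(\<lambda>S. (S, {} :: 'b set)) ` {S. S \<subseteq> X \<and> card S = card A}. f S * 1)"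
    by (rule sum.cong[OF _ refl])
  also have "\<dots> = (\<Sum>S | S \<subseteq> X \<and> card S = card A. f S)"
    by (subst sum.reindex) (simp_all add: inj_on_def)
  finally show ?thesis
    using sum_inj_tuples_overlap[OF fin(1) finite.emptyI fin(2), of f "\<lambda>_. 1"] by simp
qed

lemma product_sums_by_overlap:
  fixes f g :: "'b set \<Rightarrow> ennreal"
  assumes "finite X"
  shows "(\<Sum>S | S \<subseteq> X \<and> card S = a. f S) * (\<Sum>T | T \<subseteq> X \<and> card T = b. g T) =
    (\<Sum>m\<le>a. \<Sum>(S, T) | S \<subseteq> X \<and> T \<subseteq> X \<and> card S = a \<and> card T = b \<and> card (S \<inter> T) = m. f S * g T)"
proof -
  let ?A = "{S. S \<subseteq> X \<and> card S = a}" and ?B = "{T. T \<subseteq> X \<and> card T = b}"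
  have fin: "finite ?A" "finite ?B" using assms by auto
  have "sum f ?A * sum g ?B = (\<Sum>(S, T)\<in>?A \<times> ?B. f S * g T)"
    by (simp add: sum_product sum.cartesian_product)
  also have "\<dots> = (\<Sum>m\<le>a. \<Sum>(S, T)\<in>{p \<in> ?A \<times> ?B. card (fst p \<inter> snd p) = m}. f S * g T)"
  proof (rule sum.group[symmetric])
    show "(\<lambda>p. card (fst p \<inter> snd p)) ` (?A \<times> ?B) \<subseteq> {..a}"
    proof (rule image_subsetI)
      fix p assume "p \<in> ?A \<times> ?B"
      then have p: "fst p \<subseteq> X" "card (fst p) = a" by auto
      have "card (fst p \<inter> snd p) \<le> card (fst p)"
        by (rule card_mono[OF finite_subset[OF p(1) assms] Int_lower1])
      then show "card (fst p \<inter> snd p) \<in> {..a}" using p(2) by simp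
    qed
    show "finite (?A \<times> ?B)" using fin by (rule finite_cartesian_product)
  qed simp
  also have "\<dots> = (\<Sum>m\<le>a. \<Sum>(S, T) | S \<subseteq> X \<and> T \<subseteq> X \<and> card S = a \<and> card T = b \<and> card (S \<inter> T) = m. f S * g T)"
  proof (rule sum.cong[OF refl])
    fix m
    have "{p \<in> ?A \<times> ?B. card (fst p \<inter> snd p) = m} =
        {(S, T). S \<subseteq> X \<and> T \<subseteq> X \<and> card S = a \<and> card T = b \<and> card (S \<inter> T) = m}" (is "?L = ?R")
    proof (rule set_eqI)
      fix p show "p \<in> ?L \<longleftrightarrow> p \<in> ?R" by (cases p) auto
    qed
    then show "(\<Sum>(S, T)\<in>?L. f S * g T) = (\<Sum>(S, T)\<in>?R. f S * g T)" by (rule sum.cong[OF _ refl])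
  qed
  finally show ?thesis .
qed

section \<open>Factorisation, erosion of the window and positivity\<close>

lemma nn_integral_PiM_lborel_factor:
  fixes F :: "('i \<Rightarrow> 'b::euclidean_space) \<Rightarrow> ennreal"
  assumes fin: "finite A" "finite B" and disj: "A \<inter> B = {}"
    and F: "F \<in> borel_measurable (\<Pi>\<^sub>M i\<in>A. lborel)" and G: "G \<in> borel_measurable (\<Pi>\<^sub>M i\<in>B. lborel)"
  shows "(\<integral>\<^sup>+z. F (restrict z A) * G (restrict z B) \<partial>(\<Pi>\<^sub>M i\<in>A \<union> B. lborel)) =
    (\<integral>\<^sup>+x. F x \<partial>(\<Pi>\<^sub>M i\<in>A. lborel)) * (\<integral>\<^sup>+y. G y \<partial>(\<Pi>\<^sub>M i\<in>B. lborel))"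
proof -
  note [measurable] = F G
  have mA: "(\<lambda>z. restrict z A) \<in> measurable (\<Pi>\<^sub>M i\<in>A \<union> B. (lborel :: 'b measure)) (\<Pi>\<^sub>M i\<in>A. lborel)"
    by (rule measurable_restrict_subset) simp
  have mB: "(\<lambda>z. restrict z B) \<in> measurable (\<Pi>\<^sub>M i\<in>A \<union> B. (lborel :: 'b measure)) (\<Pi>\<^sub>M i\<in>B. lborel)"
    by (rule measurable_restrict_subset) simp
  have "(\<lambda>z. F (restrict z A) * G (restrict z B)) \<in> borel_measurable (\<Pi>\<^sub>M i\<in>A \<union> B. lborel)"
    using measurable_compose[OF mA F] measurable_compose[OF mB G] by simp
  then have "(\<integral>\<^sup>+z. F (restrict z A) * G (restrict z B) \<partial>(\<Pi>\<^sub>M i\<in>A \<union> B. lborel)) =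
    (\<integral>\<^sup>+x. (\<integral>\<^sup>+y. F (restrict (merge A B (x, y)) A) * G (restrict (merge A B (x, y)) B) \<partial>(\<Pi>\<^sub>M i\<in>B. lborel)) \<partial>(\<Pi>\<^sub>M i\<in>A. lborel))"
    by (rule lborel_PiM.product_nn_integral_fold[OF disj fin])
  also have "\<dots> = (\<integral>\<^sup>+x. (\<integral>\<^sup>+y. F x * G y \<partial>(\<Pi>\<^sub>M i\<in>B. lborel)) \<partial>(\<Pi>\<^sub>M i\<in>A. lborel))"
  proof (intro nn_integral_cong)
    fix x y assume x: "x \<in> space (\<Pi>\<^sub>M i\<in>A. (lborel :: 'b measure))" and y: "y \<in> space (\<Pi>\<^sub>M i\<in>B. (lborel :: 'b measure))"
    have "restrict (merge A B (x, y)) A = x" "restrict (merge A B (x, y)) B = y"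
      using x y disj by (auto simp: space_PiM restrict_merge extensional_restrict)
    then show "F (restrict (merge A B (x, y)) A) * G (restrict (merge A B (x, y)) B) = F x * G y" by simp
  qed
  also have "\<dots> = (\<integral>\<^sup>+x. F x * (\<integral>\<^sup>+y. G y \<partial>(\<Pi>\<^sub>M i\<in>B. lborel)) \<partial>(\<Pi>\<^sub>M i\<in>A. lborel))"
    by (intro nn_integral_cong nn_integral_cmult) measurable
  also have "\<dots> = (\<integral>\<^sup>+x. F x \<partial>(\<Pi>\<^sub>M i\<in>A. lborel)) * (\<integral>\<^sup>+y. G y \<partial>(\<Pi>\<^sub>M i\<in>B. lborel))"
    by (rule nn_integral_multc) measurable
  finally show ?thesis .
qed

definition erosion :: "'a::euclidean_space set \<Rightarrow> real \<Rightarrow> 'a set" where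
  "erosion W r = {x. cball x r \<subseteq> W}"

lemma closed_erosion:
  assumes "closed W"
  shows "closed (erosion W r)"
proof -
  have "erosion W r = (\<Inter>u\<in>cball 0 r. (\<lambda>x. x + u) -` W)"
  proof (intro set_eqI iffI)
    fix x assume "x \<in> erosion W r"
    then show "x \<in> (\<Inter>u\<in>cball 0 r. (\<lambda>x. x + u) -` W)"
      unfolding erosion_def by (auto simp: dist_norm)
  next
    fix x assume x: "x \<in> (\<Inter>u\<in>cball 0 r. (\<lambda>x. x + u) -` W)"
    have "y \<in> W" if "y \<in> cball x r" for y
    proof -
      have "y - x \<in> cball 0 r" using that by (simp add: dist_norm norm_minus_commute)
      then have "x + (y - x) \<in> W" using x by blast
      then show ?thesis by simp
    qed
    then show "x \<in> erosion W r" unfolding erosion_def by blast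
  qed
  moreover have "closed ((\<lambda>x. x + u) -` W)" for u
    using assms by (intro closed_vimage continuous_intros)
  ultimately show ?thesis by (simp add: closed_INT)
qed

lemma erosion_antimono: "r \<le> s \<Longrightarrow> erosion W s \<subseteq> erosion W r"
  unfolding erosion_def by (auto intro: subset_trans[OF cball_subset_cball_iff[THEN iffD2]])

text \<open>The erosions increase to the interior, which has full measure since the frontier of a convex set is a
  null set.\<close>

lemma measure_erosion_tendsto:
  fixes W :: "'a::euclidean_space set"
  assumes W: "compact W" "convex W"
  shows "(\<lambda>n. measure lborel (erosion W (1 / real (Suc n)))) \<longlonglongrightarrow> measure lborel W"
proof -
  have [measurable]: "W \<in> sets borel" using W by (simp add: borel_compact)
  have finW: "emeasure lborel W < \<infinity>" using emeasure_bounded_finite[OF compact_imp_bounded[OF W(1)]] by simp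
  have E: "erosion W r \<in> sets lborel" for r
    using closed_erosion[OF compact_imp_closed[OF W(1)], of r] by simp
  have sub: "erosion W r \<subseteq> W" if "r \<ge> 0" for r
    using that unfolding erosion_def by auto
  have un: "(\<Union>n. erosion W (1 / real (Suc n))) = interior W"
  proof (intro set_eqI iffI)
    fix x assume "x \<in> (\<Union>n. erosion W (1 / real (Suc n)))"
    then obtain n where "cball x (1 / real (Suc n)) \<subseteq> W" unfolding erosion_def by auto
    then show "x \<in> interior W" by (auto simp: mem_interior_cball intro!: exI[of _ "1 / real (Suc n)"])
  next
    fix x assume "x \<in> interior W"
    then obtain e where e: "e > 0" "cball x e \<subseteq> W" by (auto simp: mem_interior_cball)
    obtain n where "1 / real (Suc n) < e" using nat_approx_posE[OF e(1)] by blast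
    then have "cball x (1 / real (Suc n)) \<subseteq> W" using e(2) by (meson less_imp_le subset_cball subset_trans)
    then show "x \<in> (\<Union>n. erosion W (1 / real (Suc n)))" unfolding erosion_def by blast
  qed
  have inc: "incseq (\<lambda>n. erosion W (1 / real (Suc n)))"
    by (intro incseq_SucI erosion_antimono) (simp add: field_simps)
  have fin: "emeasure lborel (\<Union>n. erosion W (1 / real (Suc n))) \<noteq> \<infinity>"
  proof -
    have "emeasure lborel (interior W) \<le> emeasure lborel W"
      by (intro emeasure_mono interior_subset) simp
    then show ?thesis unfolding un using finW by auto
  qed
  have "(\<lambda>n. measure lborel (erosion W (1 / real (Suc n)))) \<longlonglongrightarrow> measure lborel (\<Union>n. erosion W (1 / real (Suc n)))"
    using E inc fin by (intro Lim_measure_incseq) auto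
  also have "measure lborel (\<Union>n. erosion W (1 / real (Suc n))) = measure lborel W"
  proof -
    have "emeasure lborel (frontier W) = 0"
      using negligible_convex_frontier[OF W(2)]
      by (simp add: negligible_iff_null_sets null_sets_completion_iff null_sets_def)
    then have "emeasure lborel (interior W \<union> frontier W) = emeasure lborel (interior W)"
      by (intro emeasure_Un_null_set) (auto simp: null_sets_def)
    moreover have "interior W \<union> frontier W = W"
      using compact_imp_closed[OF W(1)] interior_subset[of W] by (auto simp: frontier_def)
    ultimately show ?thesis unfolding un by (simp add: measure_def)
  qed
  finally show ?thesis .
qed

lemma measure_erosion_eventually:
  fixes W :: "'a::euclidean_space set"
  assumes W: "compact W" "convex W" and e: "e > 0"
  obtains r0 where "r0 > 0" "\<And>r. 0 < r \<Longrightarrow> r \<le> r0 \<Longrightarrow> measure lborel (erosion W r) > measure lborel W - e"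
proof -
  from order_tendstoD(1)[OF measure_erosion_tendsto[OF W], of "measure lborel W - e"] e
  obtain n where n: "measure lborel (erosion W (1 / real (Suc n))) > measure lborel W - e"
    by (auto simp: eventually_sequentially)
  show ?thesis
  proof
    show "1 / real (Suc n) > 0" by simp
    fix r :: real assume r: "0 < r" "r \<le> 1 / real (Suc n)"
    have cl: "closed W" using W(1) by (rule compact_imp_closed)
    have "erosion W r \<subseteq> W" using r unfolding erosion_def by auto
    then have "emeasure lborel (erosion W r) \<le> emeasure lborel W"
      using cl by (intro emeasure_mono) auto
    then have "emeasure lborel (erosion W r) < \<infinity>"
      using emeasure_bounded_finite[OF compact_imp_bounded[OF W(1)]] by (simp add: order_le_less_trans)
    then have "measure lborel (erosion W (1 / real (Suc n))) \<le> measure lborel (erosion W r)"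
      using erosion_antimono[OF r(2), of W] closed_erosion[OF cl]
      by (intro measure_mono_fmeasurable) (auto simp: fmeasurable_def)
    then show "measure lborel (erosion W r) > measure lborel W - e" using n by simp
  qed
qed

lemma obtain_enumeration:
  assumes "card A = Suc k"
  obtains \<sigma> where "A = \<sigma> ` {..k}"
proof -
  have "finite A" using assms card.infinite by fastforce
  then obtain f where "bij_betw f {0..<card A} A" using ex_bij_betw_nat_finite by blast
  moreover have "{0..<card A} = {..k}" using assms by auto
  ultimately show ?thesis using that[of f] by (simp add: bij_betw_def)
qed

lemma simplex_weight_image_measurable:
  assumes "finite I" "A \<subseteq> I" "card A = Suc k" "\<alpha> \<noteq> 0 \<Longrightarrow> k \<le> DIM('a)"
  shows "(\<lambda>z. simplex_weight s k \<alpha> (z ` A)) \<in> borel_measurable (\<Pi>\<^sub>M i\<in>I. (lborel :: 'a::euclidean_space measure))"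
proof -
  obtain \<sigma> where \<sigma>: "A = \<sigma> ` {..k}" by (rule obtain_enumeration[OF assms(3)])
  have "\<sigma> j \<in> I" if "j \<le> k" for j using assms(2) that \<sigma> by auto
  then show ?thesis unfolding \<sigma> using assms by (intro simplex_weight_measurable) auto
qed

lemma simplex_weight_image_affine:
  fixes z :: "'i \<Rightarrow> 'a::euclidean_space"
  assumes "r > 0" "card A = Suc k" "\<alpha> \<noteq> 0 \<Longrightarrow> k \<le> DIM('a)"
  shows "simplex_weight r k \<alpha> ((\<lambda>i. a + r *\<^sub>R z i) ` A) = r powr (\<alpha> * real k) * simplex_weight 1 k \<alpha> (z ` A)"
proof -
  obtain \<sigma> where \<sigma>: "A = \<sigma> ` {..k}" by (rule obtain_enumeration[OF assms(2)])
  have "z ` A = (\<lambda>i. z (\<sigma> i)) ` {..k}" unfolding \<sigma> by (simp add: image_image)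
  from simplex_weight_affine[OF assms(1) this assms(3), where a = a]
  show ?thesis by (simp add: image_image)
qed

lemma simplex_weight_support:
  assumes "simplex_weight s k \<alpha> S \<noteq> 0" "x \<in> S" "y \<in> S"
  shows "dist x y \<le> s"
  using assms unfolding simplex_weight_def by (auto split: if_splits)

text \<open>The integrand is positive on a product of small balls. For \<open>\<alpha> \<noteq> 0\<close> they are centred at multiples of
  the vectors of an orthonormal frame, so that a simplex with one vertex in each ball and one at the
  origin has positive volume.\<close>

lemma simplex_weight_integral_pos:
  fixes \<alpha> :: real
  assumes J: "finite J" "card J = k" and k: "\<alpha> \<noteq> 0 \<Longrightarrow> k \<le> DIM('a)"
    and b0: "b0 \<notin> J"
  shows "(\<integral>\<^sup>+x. ennreal (simplex_weight 1 k \<alpha> ((x(b0 := (0::'a::euclidean_space))) ` insert b0 J)) \<partial>(\<Pi>\<^sub>M i\<in>J. lborel)) > 0"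
proof -
  let ?P = "\<Pi>\<^sub>M i\<in>J. (lborel :: 'a measure)"
  let ?w = "\<lambda>x. simplex_weight 1 k \<alpha> ((x(b0 := (0::'a))) ` insert b0 J)"
  obtain \<tau> where \<tau>: "bij_betw \<tau> {..<k} J" using ex_bij_betw_nat_finite[OF J(1)] J(2) by (auto simp: lessThan_atLeast0)
  obtain b where b: "\<alpha> \<noteq> 0 \<Longrightarrow> orthonormal_frame k (b :: nat \<Rightarrow> 'a)"
  proof (cases "\<alpha> = 0")
    case False
    then show ?thesis using frame_exists[OF k[OF False], of "\<lambda>_. 0"] that by blast
  qed (use that in auto)
  define c where "c j = (if \<alpha> = 0 then 0 else (1 / 4) *\<^sub>R b (the_inv_into {..<k} \<tau> j))" for j
  \<comment> \<open>At most \<open>1 / 8\<close>, so that all points have norm below \<open>1 / 2\<close>, and at most \<open>\<rho> / (2 k)\<close> for the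
    length \<open>\<rho> = 1 / 4\<close> of the centres, as \<open>k_volume_pos\<close> requires.\<close>
  define \<epsilon> where "\<epsilon> = 1 / (8 * (1 + real k))"
  have \<epsilon>: "\<epsilon> > 0" "\<epsilon> \<le> 1 / 8" unfolding \<epsilon>_def by (auto simp: field_simps)
  define E where "E = (\<Pi>\<^sub>E j\<in>J. cball (c j) \<epsilon>)"
  have cnorm: "norm (c j) \<le> 1 / 4" if "j \<in> J" for j
  proof (cases "\<alpha> = 0")
    case False
    have "the_inv_into {..<k} \<tau> j < k"
      using the_inv_into_into[of \<tau> "{..<k}" j "{..<k}"] \<tau> that by (auto simp: bij_betw_def)
    then have "norm (b (the_inv_into {..<k} \<tau> j)) = 1" using b[OF False] by (simp add: orthonormal_frame_def norm_eq_1)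
    then show ?thesis using False by (simp add: c_def)
  qed (simp add: c_def)
  have pos: "?w x > 0" if x: "x \<in> E" for x
  proof -
    have xj: "norm (x j - c j) \<le> \<epsilon>" if "j \<in> J" for j
      using x that by (auto simp: E_def PiE_iff dist_norm norm_minus_commute)
    have half: "norm (x j) \<le> 1 / 2" if "j \<in> J" for j
      using xj[OF that] cnorm[OF that] \<epsilon>(2) norm_triangle_ineq[of "x j - c j" "c j"] by simp
    have "dist u v \<le> 1" if "u \<in> (x(b0 := 0)) ` insert b0 J" "v \<in> (x(b0 := 0)) ` insert b0 J" for u v
    proof -
      have "norm y \<le> 1 / 2" if "y \<in> (x(b0 := 0)) ` insert b0 J" for y
        using that half by (auto split: if_splits)
      from this[OF that(1)] this[OF that(2)] show ?thesis
        using norm_triangle_ineq4[of u v] by (simp add: dist_norm)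
    qed
    moreover have "k_volume k (convex hull ((x(b0 := 0)) ` insert b0 J)) > 0" if \<alpha>: "\<alpha> \<noteq> 0"
    proof -
      define y where "y = (\<lambda>i. case i of 0 \<Rightarrow> 0 | Suc l \<Rightarrow> x (\<tau> l))"
      have "(x(b0 := 0)) ` insert b0 J = y ` {..k}"
      proof -
        have "y ` {..k} = insert (y 0) (y ` Suc ` {..<k})"
          by (simp add: lessThan_Suc_atMost[symmetric] lessThan_Suc_eq_insert_0)
        also have "y ` Suc ` {..<k} = x ` J" using \<tau> by (auto simp: y_def bij_betw_def image_image)
        finally show ?thesis using b0 by (auto simp: y_def)
      qed
      moreover have "k_volume k (convex hull (y ` {..k})) > 0"
      proof (rule k_volume_pos[OF k[OF \<alpha>] b[OF \<alpha>], of "1 / 4"])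
        fix i assume i: "i < k"
        have "\<tau> i \<in> J" using \<tau> i by (auto simp: bij_betw_def)
        moreover have "c (\<tau> i) = (1 / 4) *\<^sub>R b i"
          using \<alpha> \<tau> i by (simp add: c_def the_inv_into_f_f bij_betw_def)
        ultimately have "norm (x (\<tau> i) - (1 / 4) *\<^sub>R b i) \<le> \<epsilon>" using xj[of "\<tau> i"] by simp
        also have "\<epsilon> \<le> 1 / 4 / (2 * real k)" using i unfolding \<epsilon>_def by (simp add: field_simps)
        finally show "norm (y (Suc i) - y 0 - (1 / 4) *\<^sub>R b i) \<le> 1 / 4 / (2 * real k)" by (simp add: y_def)
      qed simp
      ultimately show ?thesis by simp
    qed
    ultimately show ?thesis unfolding simplex_weight_def by auto
  qed
  have E_sets: "E \<in> sets ?P" unfolding E_def using J by (intro sets_PiM_I_finite) auto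
  have "emeasure ?P E = (\<Prod>j\<in>J. emeasure lborel (cball (c j) \<epsilon>))"
    unfolding E_def by (rule lborel_PiM.emeasure_PiM[OF J(1)]) simp
  also have "\<dots> \<noteq> 0"
    using J(1) \<epsilon> by (simp add: emeasure_cball less_imp_neq[OF unit_ball_vol_pos, symmetric])
  finally have E0: "emeasure ?P E \<noteq> 0" .
  have upd: "(\<lambda>x. x(b0 := 0)) \<in> measurable ?P (\<Pi>\<^sub>M i\<in>insert b0 J. (lborel :: 'a measure))"
    by (rule measurable_fun_upd[where J=J]) auto
  have meas: "(\<lambda>x. ennreal (?w x)) \<in> borel_measurable ?P"
    using measurable_compose[OF upd simplex_weight_image_measurable[of "insert b0 J" "insert b0 J" k \<alpha> 1]]
      J k b0 by simp
  show ?thesis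
  proof (rule ccontr)
    assume "\<not> ?thesis"
    then have "(\<integral>\<^sup>+x. ennreal (?w x) \<partial>?P) = 0" by simp
    then have "AE x in ?P. ennreal (?w x) = 0" using nn_integral_0_iff_AE[OF meas] by simp
    then have "AE x in ?P. x \<notin> E" by eventually_elim (use pos in force)
    then have "emeasure ?P E = 0" using E_sets AE_iff_measurable[OF E_sets, of "\<lambda>x. x \<notin> E"] sets.sets_into_space[OF E_sets]
      by (auto simp: Int_def subset_eq)
    then show False using E0 by simp
  qed
qed

section \<open>Moments of the Rips functional\<close>

text \<open>For finite \<open>R\<close> this is the usual formula for the covariance. For \<open>R = \<infinity>\<close> the product of the centred
  variables differs from \<open>X * Y\<close> by an integrable variable, so that its positive part has
  infinite mean and its negative part has not.\<close>

lemma (in prob_space) ext_cov_of_product_moment: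
  fixes X Y :: "'a \<Rightarrow> real"
  assumes X[measurable]: "X \<in> borel_measurable M" and Y[measurable]: "Y \<in> borel_measurable M"
    and nonneg: "\<And>\<omega>. 0 \<le> X \<omega>" "\<And>\<omega>. 0 \<le> Y \<omega>"
    and fin: "(\<integral>\<^sup>+\<omega>. ennreal (X \<omega>) \<partial>M) < \<infinity>" "(\<integral>\<^sup>+\<omega>. ennreal (Y \<omega>) \<partial>M) < \<infinity>"
    and prod: "(\<integral>\<^sup>+\<omega>. ennreal (X \<omega> * Y \<omega>) \<partial>M) =
       (\<integral>\<^sup>+\<omega>. ennreal (X \<omega>) \<partial>M) * (\<integral>\<^sup>+\<omega>. ennreal (Y \<omega>) \<partial>M) + R"
  shows "ext_cov M X Y = enn2ereal R"
proof -
  have iX: "integrable M X" and iY: "integrable M Y"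
    using fin nonneg by (auto intro!: integrableI_nonneg)
  define a where "a = expectation X"
  define b where "b = expectation Y"
  have a: "0 \<le> a" "(\<integral>\<^sup>+\<omega>. ennreal (X \<omega>) \<partial>M) = ennreal a"
    unfolding a_def using nonneg iX by (auto simp: nn_integral_eq_integral)
  have b: "0 \<le> b" "(\<integral>\<^sup>+\<omega>. ennreal (Y \<omega>) \<partial>M) = ennreal b"
    unfolding b_def using nonneg iY by (auto simp: nn_integral_eq_integral)
  have prod': "(\<integral>\<^sup>+\<omega>. ennreal (X \<omega> * Y \<omega>) \<partial>M) = ennreal (a * b) + R"
    using prod a b by (simp add: ennreal_mult)
  show ?thesis
  proof (cases "R < \<infinity>")
    case True
    then obtain r where r: "0 \<le> r" "R = ennreal r" by (cases R) auto
    have iXY: "integrable M (\<lambda>\<omega>. X \<omega> * Y \<omega>)"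
      using prod' r nonneg by (intro integrableI_nonneg) auto
    have "ennreal (expectation (\<lambda>\<omega>. X \<omega> * Y \<omega>)) = ennreal (a * b + r)"
      using prod' r a b nonneg iXY by (simp add: nn_integral_eq_integral)
    then have e: "expectation (\<lambda>\<omega>. X \<omega> * Y \<omega>) = a * b + r"
      using a b r nonneg by (subst (asm) ennreal_inj) auto
    have "expectation (\<lambda>\<omega>. (X \<omega> - a) * (Y \<omega> - b)) =
       expectation (\<lambda>\<omega>. X \<omega> * Y \<omega> - b * X \<omega> - a * Y \<omega> + a * b)"
      by (rule arg_cong[where f="integral\<^sup>L M"]) (simp add: fun_eq_iff algebra_simps)
    also have "\<dots> = a * b + r - b * a - a * b + a * b"
      using iX iY iXY by (simp add: e prob_space a_def[symmetric] b_def[symmetric])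
    finally have "expectation (\<lambda>\<omega>. (X \<omega> - a) * (Y \<omega> - b)) = r" by simp
    then show ?thesis
      using ext_cov_eq_covariance[OF iX iY iXY] r unfolding a_def b_def by (simp add: enn2ereal_ennreal)
  next
    case False
    then have R: "R = \<infinity>" using less_top[of R] by auto
    define Z where "Z = (\<lambda>\<omega>. (X \<omega> - a) * (Y \<omega> - b))"
    have [measurable]: "Z \<in> borel_measurable M" unfolding Z_def by measurable
    define L where "L = (\<integral>\<^sup>+\<omega>. ennreal (b * X \<omega> + a * Y \<omega>) \<partial>M)"
    have L: "L < \<infinity>"
    proof -
      have "L = (\<integral>\<^sup>+\<omega>. ennreal b * ennreal (X \<omega>) + ennreal a * ennreal (Y \<omega>) \<partial>M)"
        unfolding L_def using a b nonneg by (intro nn_integral_cong) (simp add: ennreal_mult)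
      also have "\<dots> = ennreal b * ennreal a + ennreal a * ennreal b"
        using a(2) b(2) by (simp add: nn_integral_add nn_integral_cmult)
      finally show ?thesis by (simp add: ennreal_mult_less_top)
    qed
    have neg: "(\<integral>\<^sup>+\<omega>. ennreal (- Z \<omega>) \<partial>M) \<le> L"
    proof -
      have "- Z \<omega> \<le> b * X \<omega> + a * Y \<omega>" for \<omega>
        using mult_nonneg_nonneg[OF nonneg(1) nonneg(2), of \<omega> \<omega>] mult_nonneg_nonneg[OF a(1) b(1)]
        unfolding Z_def by (simp add: algebra_simps)
      then show ?thesis unfolding L_def by (intro nn_integral_mono ennreal_leI)
    qed
    have "(\<integral>\<^sup>+\<omega>. ennreal (X \<omega> * Y \<omega>) \<partial>M) \<le> (\<integral>\<^sup>+\<omega>. ennreal (Z \<omega>) + ennreal (b * X \<omega> + a * Y \<omega>) \<partial>M)"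
    proof (rule nn_integral_mono)
      fix \<omega>
      have nn: "0 \<le> b * X \<omega> + a * Y \<omega>" using a b nonneg by simp
      have "X \<omega> * Y \<omega> \<le> max 0 (Z \<omega>) + (b * X \<omega> + a * Y \<omega>)"
        using mult_nonneg_nonneg[OF a(1) b(1)] unfolding Z_def by (simp add: algebra_simps max_def)
      then have "ennreal (X \<omega> * Y \<omega>) \<le> ennreal (max 0 (Z \<omega>) + (b * X \<omega> + a * Y \<omega>))" by (rule ennreal_leI)
      also have "\<dots> = ennreal (Z \<omega>) + ennreal (b * X \<omega> + a * Y \<omega>)"
        using nn by (subst ennreal_plus) (auto simp: max_def ennreal_neg)
      finally show "ennreal (X \<omega> * Y \<omega>) \<le> ennreal (Z \<omega>) + ennreal (b * X \<omega> + a * Y \<omega>)" .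
    qed
    also have "\<dots> = (\<integral>\<^sup>+\<omega>. ennreal (Z \<omega>) \<partial>M) + L" unfolding L_def by (rule nn_integral_add) measurable
    finally have "\<infinity> \<le> (\<integral>\<^sup>+\<omega>. ennreal (Z \<omega>) \<partial>M) + L" using prod' R by simp
    then have pos: "(\<integral>\<^sup>+\<omega>. ennreal (Z \<omega>) \<partial>M) = \<infinity>" using L by (auto simp: top_unique)
    obtain n where n: "0 \<le> n" "(\<integral>\<^sup>+\<omega>. ennreal (- Z \<omega>) \<partial>M) = ennreal n"
      using neg L by (cases "\<integral>\<^sup>+\<omega>. ennreal (- Z \<omega>) \<partial>M") (auto simp: top_unique)
    have "ext_mean M Z = \<infinity>"
      unfolding ext_mean_def pos n using n by (simp add: enn2ereal_ennreal)
    then show ?thesis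
      using iX iY R unfolding ext_cov_def Z_def a_def b_def by simp
  qed
qed

context poisson_process
begin

lemma intensity_insert_integral:
  fixes f :: "('i \<Rightarrow> 'a) \<Rightarrow> ennreal"
  assumes J: "finite J" "o' \<notin> J" and f: "f \<in> borel_measurable (\<Pi>\<^sub>M i\<in>insert o' J. lborel)"
  shows "(\<integral>\<^sup>+z. f z \<partial>intensity (insert o' J)) = ennreal (t ^ Suc (card J)) *
    (\<integral>\<^sup>+y. indicator W y * (\<integral>\<^sup>+x. (\<Prod>i\<in>J. indicator W (x i)) * f (x(o' := y)) \<partial>(\<Pi>\<^sub>M i\<in>J. lborel)) \<partial>lborel)"
proof -
  note [measurable] = f
  let ?I = "insert o' J"
  have m1: "(\<lambda>z. (\<Prod>i\<in>?I. indicator W (z i)) * f z) \<in> borel_measurable (\<Pi>\<^sub>M i\<in>?I. lborel)" by measurable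
  have "(\<integral>\<^sup>+z. f z \<partial>intensity ?I) = (\<integral>\<^sup>+z. ennreal (t ^ card ?I) * (\<Prod>i\<in>?I. indicator W (z i)) * f z \<partial>(\<Pi>\<^sub>M i\<in>?I. lborel))"
    unfolding intensity_def by (intro nn_integral_density) measurable
  also have "\<dots> = ennreal (t ^ card ?I) * (\<integral>\<^sup>+z. (\<Prod>i\<in>?I. indicator W (z i)) * f z \<partial>(\<Pi>\<^sub>M i\<in>?I. lborel))"
    unfolding mult.assoc using m1 by (rule nn_integral_cmult)
  also have "(\<integral>\<^sup>+z. (\<Prod>i\<in>?I. indicator W (z i)) * f z \<partial>(\<Pi>\<^sub>M i\<in>?I. lborel)) =
    (\<integral>\<^sup>+y. (\<integral>\<^sup>+x. (\<Prod>i\<in>?I. indicator W ((x(o' := y)) i)) * f (x(o' := y)) \<partial>(\<Pi>\<^sub>M i\<in>J. lborel)) \<partial>lborel)"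
    by (rule lborel_PiM.product_nn_integral_insert_rev[OF J m1])
  also have "\<dots> = (\<integral>\<^sup>+y. indicator W y * (\<integral>\<^sup>+x. (\<Prod>i\<in>J. indicator W (x i)) * f (x(o' := y)) \<partial>(\<Pi>\<^sub>M i\<in>J. lborel)) \<partial>lborel)"
  proof (rule nn_integral_cong)
    fix y :: 'a
    have upd: "(\<lambda>x. x(o' := y)) \<in> measurable (\<Pi>\<^sub>M i\<in>J. lborel) (\<Pi>\<^sub>M i\<in>?I. (lborel :: 'a measure))"
      by (rule measurable_fun_upd[where J=J]) auto
    have [measurable]: "(\<lambda>x. f (x(o' := y))) \<in> borel_measurable (\<Pi>\<^sub>M i\<in>J. lborel)"
      by (rule measurable_compose[OF upd f])
    have "(\<Prod>i\<in>?I. indicator W ((x(o' := y)) i)) = (indicator W y * (\<Prod>i\<in>J. indicator W (x i)) :: ennreal)" for x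
    proof -
      have "(\<Prod>i\<in>J. indicator W ((x(o' := y)) i)) = (\<Prod>i\<in>J. indicator W (x i) :: ennreal)"
        using J by (intro prod.cong) auto
      then show ?thesis using J by (subst prod.insert) auto
    qed
    then show "(\<integral>\<^sup>+x. (\<Prod>i\<in>?I. indicator W ((x(o' := y)) i)) * f (x(o' := y)) \<partial>(\<Pi>\<^sub>M i\<in>J. lborel)) =
      indicator W y * (\<integral>\<^sup>+x. (\<Prod>i\<in>J. indicator W (x i)) * f (x(o' := y)) \<partial>(\<Pi>\<^sub>M i\<in>J. lborel))"
      by (simp add: mult.assoc nn_integral_cmult)
  qed
  finally show ?thesis using J by simp
qed

text \<open>With the base point \<open>y\<close> fixed, the substitution \<open>y + r x\<close> extracts the power of \<open>r\<close>. What remains is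
  the integral \<open>\<nu>\<close> at scale \<open>1\<close>, restricted by the condition that all points lie in \<open>W\<close>. That condition
  holds on the support of \<open>h\<close> if \<open>y\<close> is in the erosion, and dropping it gives the upper bound.\<close>

lemma intensity_scaling_bounds:
  fixes h :: "real \<Rightarrow> ('i \<Rightarrow> 'a) \<Rightarrow> ennreal"
  assumes J: "finite J" "o' \<notin> J" and r: "r > 0" and W: "closed W"
    and meas: "\<And>s. h s \<in> borel_measurable (\<Pi>\<^sub>M i\<in>insert o' J. lborel)"
    and scale: "\<And>a z. h r (\<lambda>i\<in>insert o' J. a + r *\<^sub>R z i) = ennreal (r powr \<beta>) * h 1 z"
    and supp: "\<And>z i. h 1 z \<noteq> 0 \<Longrightarrow> i \<in> J \<Longrightarrow> dist (z i) (z o') \<le> 1"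
  defines "\<nu> \<equiv> (\<integral>\<^sup>+x. h 1 (x(o' := 0)) \<partial>(\<Pi>\<^sub>M i\<in>J. lborel))"
    and "C \<equiv> ennreal (t ^ Suc (card J) * r powr (real DIM('a) * real (card J) + \<beta>))"
  shows "(\<integral>\<^sup>+z. h r z \<partial>intensity (insert o' J)) \<le> C * emeasure lborel W * \<nu>"
    and "C * emeasure lborel (erosion W r) * \<nu> \<le> (\<integral>\<^sup>+z. h r z \<partial>intensity (insert o' J))"
proof -
  let ?I = "insert o' J" and ?P = "\<Pi>\<^sub>M i\<in>J. (lborel :: 'a measure)"
  have upd: "(\<lambda>x. x(o' := y)) \<in> measurable ?P (\<Pi>\<^sub>M i\<in>?I. (lborel :: 'a measure))" for y
    by (rule measurable_fun_upd[where J=J]) auto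
  have hm[measurable]: "(\<lambda>x. h s (x(o' := y))) \<in> borel_measurable ?P" for s y
    by (rule measurable_compose[OF upd meas])
  define c where "c = ennreal (r powr (real DIM('a) * real (card J) + \<beta>))"
  define K where "K y = (\<integral>\<^sup>+x. (\<Prod>i\<in>J. indicator W (y + r *\<^sub>R x i)) * h 1 (x(o' := 0)) \<partial>?P)" for y
  have inner: "(\<integral>\<^sup>+x. (\<Prod>i\<in>J. indicator W (x i)) * h r (x(o' := y)) \<partial>?P) = c * K y" for y
  proof -
    have "(\<integral>\<^sup>+x. (\<Prod>i\<in>J. indicator W (x i)) * h r (x(o' := y)) \<partial>?P) =
      ennreal (\<bar>r\<bar> ^ (DIM('a) * card J)) * (\<integral>\<^sup>+x. (\<Prod>i\<in>J. indicator W ((\<lambda>i\<in>J. (\<lambda>_. y) i + r *\<^sub>R x i) i)) *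
         h r ((\<lambda>i\<in>J. (\<lambda>_. y) i + r *\<^sub>R x i)(o' := y)) \<partial>?P)"
      using r by (intro nn_integral_PiM_lborel_affine[OF J(1)]) auto
    also have "(\<integral>\<^sup>+x. (\<Prod>i\<in>J. indicator W ((\<lambda>i\<in>J. (\<lambda>_. y) i + r *\<^sub>R x i) i)) *
         h r ((\<lambda>i\<in>J. (\<lambda>_. y) i + r *\<^sub>R x i)(o' := y)) \<partial>?P) =
       (\<integral>\<^sup>+x. ennreal (r powr \<beta>) * ((\<Prod>i\<in>J. indicator W (y + r *\<^sub>R x i)) * h 1 (x(o' := 0))) \<partial>?P)"
    proof (rule nn_integral_cong)
      fix x
      have "(\<lambda>i\<in>J. (\<lambda>_. y) i + r *\<^sub>R x i)(o' := y) = (\<lambda>i\<in>?I. y + r *\<^sub>R (x(o' := 0)) i)"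
        using J by (auto simp: fun_eq_iff)
      then have "h r ((\<lambda>i\<in>J. (\<lambda>_. y) i + r *\<^sub>R x i)(o' := y)) = ennreal (r powr \<beta>) * h 1 (x(o' := 0))"
        by (simp only: scale[of y "x(o' := 0)"])
      then show "(\<Prod>i\<in>J. indicator W ((\<lambda>i\<in>J. (\<lambda>_. y) i + r *\<^sub>R x i) i)) * h r ((\<lambda>i\<in>J. (\<lambda>_. y) i + r *\<^sub>R x i)(o' := y)) =
        ennreal (r powr \<beta>) * ((\<Prod>i\<in>J. indicator W (y + r *\<^sub>R x i)) * h 1 (x(o' := 0)))"
        by (simp add: mult_ac del: fun_upd_apply)
    qed
    also have "\<dots> = ennreal (r powr \<beta>) * K y"
      unfolding K_def by (rule nn_integral_cmult) measurable
    also have "ennreal (\<bar>r\<bar> ^ (DIM('a) * card J)) * (ennreal (r powr \<beta>) * K y) = c * K y"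
      using r unfolding c_def
      by (simp add: mult.assoc[symmetric] powr_add powr_realpow[symmetric] flip: ennreal_mult)
    finally show ?thesis .
  qed
  have K_le: "K y \<le> \<nu>" for y
  proof -
    have "(\<Prod>i\<in>J. indicator W (y + r *\<^sub>R x i)) \<le> (1 :: ennreal)" for x
      by (intro prod_le_1) (auto simp: indicator_def)
    then show ?thesis unfolding K_def \<nu>_def by (intro nn_integral_mono) (metis mult_right_mono mult_1 zero_le)
  qed
  have K_eq: "K y = \<nu>" if y: "y \<in> erosion W r" for y
    unfolding K_def \<nu>_def
  proof (rule nn_integral_cong)
    fix x
    show "(\<Prod>i\<in>J. indicator W (y + r *\<^sub>R x i)) * h 1 (x(o' := 0)) = h 1 (x(o' := 0))"
    proof (cases "h 1 (x(o' := 0)) = 0")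
      case False
      have "y + r *\<^sub>R x i \<in> W" if i: "i \<in> J" for i
      proof -
        have "i \<noteq> o'" using i J by auto
        then have "norm (x i) \<le> 1" using supp[OF False i] by (simp add: dist_norm)
        then have "y + r *\<^sub>R x i \<in> cball y r" using r by (simp add: dist_norm mult_left_le)
        then show ?thesis using y unfolding erosion_def by blast
      qed
      then have "(\<Prod>i\<in>J. indicator W (y + r *\<^sub>R x i)) = (1 :: ennreal)" by (intro prod.neutral) simp
      then show ?thesis by simp
    qed simp
  qed
  have tot: "(\<integral>\<^sup>+z. h r z \<partial>intensity ?I) = ennreal (t ^ Suc (card J)) * (\<integral>\<^sup>+y. indicator W y * (c * K y) \<partial>lborel)"
    unfolding intensity_insert_integral[OF J meas] inner ..
  have CC: "C = ennreal (t ^ Suc (card J)) * c"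
    unfolding C_def c_def using t_nonneg by (simp add: ennreal_mult)
  have "(\<integral>\<^sup>+y. indicator W y * (c * K y) \<partial>lborel) \<le> (\<integral>\<^sup>+y. (c * \<nu>) * indicator W y \<partial>lborel)"
    using K_le by (intro nn_integral_mono) (auto simp: indicator_def intro!: mult_left_mono)
  also have "\<dots> = c * \<nu> * emeasure lborel W" by (rule nn_integral_cmult_indicator) simp
  finally show "(\<integral>\<^sup>+z. h r z \<partial>intensity ?I) \<le> C * emeasure lborel W * \<nu>"
    unfolding tot CC mult.assoc by (intro mult_left_mono) (simp_all add: mult_ac)
  have "c * \<nu> * emeasure lborel (erosion W r) = (\<integral>\<^sup>+y. (c * \<nu>) * indicator (erosion W r) y \<partial>lborel)"
    using closed_erosion[OF W] by (intro nn_integral_cmult_indicator[symmetric]) simp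
  also have "\<dots> \<le> (\<integral>\<^sup>+y. indicator W y * (c * K y) \<partial>lborel)"
  proof (rule nn_integral_mono)
    fix y
    have "erosion W r \<subseteq> W" using r unfolding erosion_def by auto
    then show "c * \<nu> * indicator (erosion W r) y \<le> indicator W y * (c * K y)"
      using K_eq[of y] by (auto simp: indicator_def)
  qed
  finally show "C * emeasure lborel (erosion W r) * \<nu> \<le> (\<integral>\<^sup>+z. h r z \<partial>intensity ?I)"
    unfolding tot CC mult.assoc by (intro mult_left_mono) (simp_all add: mult_ac)
qed

lemma intensity_integral_factor:
  fixes A B :: "'i set" and f g :: "'a set \<Rightarrow> ennreal"
  assumes fin: "finite A" "finite B" and disj: "A \<inter> B = {}"
    and f: "(\<lambda>z. f (z ` A)) \<in> borel_measurable (\<Pi>\<^sub>M i\<in>A. lborel)" and g: "(\<lambda>z. g (z ` B)) \<in> borel_measurable (\<Pi>\<^sub>M i\<in>B. lborel)"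
  shows "(\<integral>\<^sup>+z. f (z ` A) * g (z ` B) \<partial>intensity (A \<union> B)) =
    (\<integral>\<^sup>+z. f (z ` A) \<partial>intensity A) * (\<integral>\<^sup>+z. g (z ` B) \<partial>intensity B)"
proof -
  note [measurable] = f g
  define F where "F = (\<lambda>z. ennreal (t ^ card A) * (\<Prod>i\<in>A. indicator W (z i)) * f (z ` A))"
  define G where "G = (\<lambda>z. ennreal (t ^ card B) * (\<Prod>i\<in>B. indicator W (z i)) * g (z ` B))"
  have FG[measurable]: "F \<in> borel_measurable (\<Pi>\<^sub>M i\<in>A. lborel)" "G \<in> borel_measurable (\<Pi>\<^sub>M i\<in>B. lborel)"
    unfolding F_def G_def by measurable
  have dens: "(\<integral>\<^sup>+z. q z \<partial>intensity I) = (\<integral>\<^sup>+z. ennreal (t ^ card I) * (\<Prod>i\<in>I. indicator W (z i)) * q z \<partial>(\<Pi>\<^sub>M i\<in>I. lborel))"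
    if "q \<in> borel_measurable (\<Pi>\<^sub>M i\<in>I. lborel)" for q and I :: "'i set"
    unfolding intensity_def by (rule nn_integral_density[OF _ that]) measurable
  have rA: "restrict z A ` A = z ` A" "restrict z B ` B = z ` B" for z :: "'i \<Rightarrow> 'a" by auto
  have mA: "(\<lambda>z. restrict z A) \<in> measurable (\<Pi>\<^sub>M i\<in>A \<union> B. (lborel :: 'a measure)) (\<Pi>\<^sub>M i\<in>A. lborel)"
    by (rule measurable_restrict_subset) simp
  have mB: "(\<lambda>z. restrict z B) \<in> measurable (\<Pi>\<^sub>M i\<in>A \<union> B. (lborel :: 'a measure)) (\<Pi>\<^sub>M i\<in>B. lborel)"
    by (rule measurable_restrict_subset) simp
  have m: "(\<lambda>z. f (z ` A) * g (z ` B)) \<in> borel_measurable (\<Pi>\<^sub>M i\<in>A \<union> B. lborel)"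
    using measurable_compose[OF mA f] measurable_compose[OF mB g] unfolding rA by (rule borel_measurable_times_ennreal)
  have "(\<integral>\<^sup>+z. f (z ` A) * g (z ` B) \<partial>intensity (A \<union> B)) = (\<integral>\<^sup>+z. F (restrict z A) * G (restrict z B) \<partial>(\<Pi>\<^sub>M i\<in>A \<union> B. lborel))"
    unfolding dens[OF m]
  proof (rule nn_integral_cong)
    fix z :: "'i \<Rightarrow> 'a"
    have "(\<Prod>i\<in>A \<union> B. indicator W (z i)) = (\<Prod>i\<in>A. indicator W (z i)) * (\<Prod>i\<in>B. indicator W (z i) :: ennreal)"
      using fin disj by (rule prod.union_disjoint)
    moreover have "ennreal (t ^ card (A \<union> B)) = ennreal (t ^ card A) * ennreal (t ^ card B)"
      using fin disj t_nonneg by (simp add: card_Un_disjoint power_add ennreal_mult)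
    ultimately show "ennreal (t ^ card (A \<union> B)) * (\<Prod>i\<in>A \<union> B. indicator W (z i)) * (f (z ` A) * g (z ` B)) =
       F (restrict z A) * G (restrict z B)"
      unfolding F_def G_def rA by (simp add: mult_ac)
  qed
  also have "\<dots> = (\<integral>\<^sup>+x. F x \<partial>(\<Pi>\<^sub>M i\<in>A. lborel)) * (\<integral>\<^sup>+y. G y \<partial>(\<Pi>\<^sub>M i\<in>B. lborel))"
    by (rule nn_integral_PiM_lborel_factor[OF fin disj FG])
  also have "\<dots> = (\<integral>\<^sup>+z. f (z ` A) \<partial>intensity A) * (\<integral>\<^sup>+z. g (z ` B) \<partial>intensity B)"
    unfolding dens[OF f] dens[OF g] F_def G_def ..
  finally show ?thesis .
qed

lemma rips_eq_tuple_sum: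
  fixes A :: "'i set"
  assumes A: "finite A" "card A = Suc k" and \<omega>: "\<omega> \<in> space M"
  shows "ennreal (rips_functional s k \<alpha> (\<eta> \<omega>)) =
    ennreal (1 / fact (k + 1)) * tuple_sum A (\<lambda>z. ennreal (simplex_weight s k \<alpha> (z ` A))) \<omega>"
proof -
  have "tuple_sum A (\<lambda>z. ennreal (simplex_weight s k \<alpha> (z ` A))) \<omega> = of_nat (fact (k + 1)) * ennreal (rips_functional s k \<alpha> (\<eta> \<omega>))"
    unfolding tuple_sum_def
    using sum_inj_tuples_single[OF A(1) finite_points[OF \<omega>], of "\<lambda>S. ennreal (simplex_weight s k \<alpha> S)"] A(2)
    by (simp add: rips_functional_eq_sum_sets[OF finite_points[OF \<omega>]] sum_ennreal del: fact_Suc)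
  then have "ennreal (1 / fact (k + 1)) * tuple_sum A (\<lambda>z. ennreal (simplex_weight s k \<alpha> (z ` A))) \<omega> =
     (ennreal (1 / fact (k + 1)) * of_nat (fact (k + 1))) * ennreal (rips_functional s k \<alpha> (\<eta> \<omega>))"
    by (simp only: mult.assoc)
  also have "ennreal (1 / fact (k + 1)) * of_nat (fact (k + 1)) = ennreal (1 / fact (k + 1) * fact (k + 1))"
    unfolding ennreal_of_nat_eq_real_of_nat by (subst ennreal_mult) (simp_all del: fact_Suc)
  also have "\<dots> = 1" by (simp del: fact_Suc)
  finally show ?thesis by simp
qed

lemma rips_nonneg: "0 \<le> rips_functional s k \<alpha> (X :: 'a set)"
  unfolding rips_functional_def by (simp add: sum_nonneg rips_vol_pow_eq_weight)

lemma rips_measurable_expectation: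
  fixes A :: "'i set"
  assumes A: "finite A" "card A = Suc k" and k: "\<alpha> \<noteq> 0 \<Longrightarrow> k \<le> DIM('a)"
  shows "(\<lambda>\<omega>. rips_functional s k \<alpha> (\<eta> \<omega>)) \<in> borel_measurable M"
    and "(\<integral>\<^sup>+\<omega>. ennreal (rips_functional s k \<alpha> (\<eta> \<omega>)) \<partial>M) =
      ennreal (1 / fact (k + 1)) * (\<integral>\<^sup>+z. ennreal (simplex_weight s k \<alpha> (z ` A)) \<partial>intensity A)"
proof -
  let ?f = "\<lambda>z. ennreal (simplex_weight s k \<alpha> (z ` A))"
  have "(\<lambda>z. simplex_weight s k \<alpha> (z ` A)) \<in> borel_measurable (\<Pi>\<^sub>M i\<in>A. (lborel :: 'a measure))"
    using A k by (intro simplex_weight_image_measurable) auto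
  then have "?f \<in> borel_measurable (\<Pi>\<^sub>M i\<in>A. (lborel :: 'a measure))" by measurable
  from campbell_formula[OF A(1) this] have m: "tuple_sum A ?f \<in> borel_measurable M"
    and e: "(\<integral>\<^sup>+\<omega>. tuple_sum A ?f \<omega> \<partial>M) = (\<integral>\<^sup>+z. ?f z \<partial>intensity A)" unfolding campbell_def by auto
  have eq: "rips_functional s k \<alpha> (\<eta> \<omega>) = enn2real (ennreal (1 / fact (k + 1)) * tuple_sum A ?f \<omega>)" if "\<omega> \<in> space M" for \<omega>
    using rips_eq_tuple_sum[OF A that, of s \<alpha>] rips_nonneg[of s k \<alpha> "\<eta> \<omega>"] by (metis enn2real_ennreal)
  show "(\<lambda>\<omega>. rips_functional s k \<alpha> (\<eta> \<omega>)) \<in> borel_measurable M"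
    using m by (subst measurable_cong[OF eq]) (assumption, measurable)
  show "(\<integral>\<^sup>+\<omega>. ennreal (rips_functional s k \<alpha> (\<eta> \<omega>)) \<partial>M) =
      ennreal (1 / fact (k + 1)) * (\<integral>\<^sup>+z. ?f z \<partial>intensity A)"
    using m by (subst nn_integral_cong[OF rips_eq_tuple_sum[OF A]]) (auto simp: nn_integral_cmult e)
qed

text \<open>For each size \<open>m\<close> of the overlap, \<open>A m\<close> and \<open>B m\<close> are the positions of the vertices of the two simplices
  in a tuple of all their vertices.\<close>

lemma rips_product_expectation:
  fixes A B :: "nat \<Rightarrow> 'i set"
  assumes A: "\<And>m. m \<le> k1 + 1 \<Longrightarrow> finite (A m)" "\<And>m. m \<le> k1 + 1 \<Longrightarrow> card (A m) = Suc k1"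
    and B: "\<And>m. m \<le> k1 + 1 \<Longrightarrow> finite (B m)" "\<And>m. m \<le> k1 + 1 \<Longrightarrow> card (B m) = Suc k2"
    and AB: "\<And>m. m \<le> k1 + 1 \<Longrightarrow> card (A m \<inter> B m) = m"
    and k: "\<alpha>1 \<noteq> 0 \<Longrightarrow> k1 \<le> DIM('a)" "\<alpha>2 \<noteq> 0 \<Longrightarrow> k2 \<le> DIM('a)"
  shows "(\<integral>\<^sup>+\<omega>. ennreal (rips_functional s k1 \<alpha>1 (\<eta> \<omega>) * rips_functional s k2 \<alpha>2 (\<eta> \<omega>)) \<partial>M) =
    (\<Sum>m\<le>k1 + 1. ennreal (1 / (fact m * fact (k1 + 1 - m) * fact (k2 + 1 - m))) *
      (\<integral>\<^sup>+z. ennreal (simplex_weight s k1 \<alpha>1 (z ` A m)) * ennreal (simplex_weight s k2 \<alpha>2 (z ` B m)) \<partial>intensity (A m \<union> B m)))"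
proof -
  let ?f = "\<lambda>S. ennreal (simplex_weight s k1 \<alpha>1 S)" and ?g = "\<lambda>S. ennreal (simplex_weight s k2 \<alpha>2 S)"
  let ?c = "\<lambda>m. fact m * fact (k1 + 1 - m) * fact (k2 + 1 - m) :: nat"
  let ?F = "\<lambda>m z. ?f (z ` A m) * ?g (z ` B m)"
  have mF: "?F m \<in> borel_measurable (\<Pi>\<^sub>M i\<in>A m \<union> B m. (lborel :: 'a measure))" if m: "m \<le> k1 + 1" for m
  proof -
    have "(\<lambda>z. simplex_weight s k1 \<alpha>1 (z ` A m)) \<in> borel_measurable (\<Pi>\<^sub>M i\<in>A m \<union> B m. (lborel :: 'a measure))"
      using A[OF m] B[OF m] k(1) by (intro simplex_weight_image_measurable) auto
    moreover have "(\<lambda>z. simplex_weight s k2 \<alpha>2 (z ` B m)) \<in> borel_measurable (\<Pi>\<^sub>M i\<in>A m \<union> B m. (lborel :: 'a measure))"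
      using A[OF m] B[OF m] k(2) by (intro simplex_weight_image_measurable) auto
    ultimately show ?thesis by measurable
  qed
  have campbell_F: "campbell (A m \<union> B m) (?F m)" if m: "m \<le> k1 + 1" for m
    using mF[OF m] A[OF m] B[OF m] by (intro campbell_formula) auto
  have pt: "ennreal (rips_functional s k1 \<alpha>1 (\<eta> \<omega>) * rips_functional s k2 \<alpha>2 (\<eta> \<omega>)) =
     (\<Sum>m\<le>k1 + 1. ennreal (1 / real (?c m)) * tuple_sum (A m \<union> B m) (?F m) \<omega>)" if \<omega>: "\<omega> \<in> space M" for \<omega>
  proof -
    let ?X = "\<eta> \<omega>"
    have fX: "finite ?X" by (rule finite_points[OF \<omega>])
    have "ennreal (rips_functional s k1 \<alpha>1 ?X * rips_functional s k2 \<alpha>2 ?X) =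
      (\<Sum>S | S \<subseteq> ?X \<and> card S = k1 + 1. ?f S) * (\<Sum>T | T \<subseteq> ?X \<and> card T = k2 + 1. ?g T)"
      unfolding rips_functional_eq_sum_sets[OF fX] by (simp add: ennreal_mult sum_nonneg)
    also have "\<dots> = (\<Sum>m\<le>k1 + 1. \<Sum>(S, T) | S \<subseteq> ?X \<and> T \<subseteq> ?X \<and> card S = k1 + 1 \<and> card T = k2 + 1 \<and> card (S \<inter> T) = m. ?f S * ?g T)"
      by (rule product_sums_by_overlap[OF fX])
    also have "\<dots> = (\<Sum>m\<le>k1 + 1. ennreal (1 / real (?c m)) * tuple_sum (A m \<union> B m) (?F m) \<omega>)"
    proof (rule sum.cong[OF refl])
      fix m assume "m \<in> {..k1 + 1}"
      then have m: "m \<le> k1 + 1" by simp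
      let ?S = "\<Sum>(S, T) | S \<subseteq> ?X \<and> T \<subseteq> ?X \<and> card S = k1 + 1 \<and> card T = k2 + 1 \<and> card (S \<inter> T) = m. ?f S * ?g T"
      have dA: "card (A m - B m) = k1 + 1 - m" using A[OF m] AB[OF m] by (simp add: card_Diff_subset_Int)
      have dB: "card (B m - A m) = k2 + 1 - m" using B[OF m] AB[OF m] by (simp add: card_Diff_subset_Int Int_commute)
      have "tuple_sum (A m \<union> B m) (?F m) \<omega> = of_nat (?c m) * ?S"
        unfolding tuple_sum_def sum_inj_tuples_overlap[OF A(1)[OF m] B(1)[OF m] fX, of ?f ?g] dA dB
        by (simp only: A(2)[OF m] B(2)[OF m] AB[OF m] Suc_eq_plus1)
      then have "ennreal (1 / real (?c m)) * tuple_sum (A m \<union> B m) (?F m) \<omega> = (ennreal (1 / real (?c m)) * of_nat (?c m)) * ?S"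
        by (simp only: mult.assoc)
      also have "ennreal (1 / real (?c m)) * of_nat (?c m) = ennreal (1 / real (?c m) * real (?c m))"
        unfolding ennreal_of_nat_eq_real_of_nat by (subst ennreal_mult) simp_all
      also have "1 / real (?c m) * real (?c m) = 1" by simp
      finally show "?S = ennreal (1 / real (?c m)) * tuple_sum (A m \<union> B m) (?F m) \<omega>" by simp
    qed
    finally show ?thesis .
  qed
  have "(\<integral>\<^sup>+\<omega>. ennreal (rips_functional s k1 \<alpha>1 (\<eta> \<omega>) * rips_functional s k2 \<alpha>2 (\<eta> \<omega>)) \<partial>M) =
    (\<integral>\<^sup>+\<omega>. (\<Sum>m\<le>k1 + 1. ennreal (1 / real (?c m)) * tuple_sum (A m \<union> B m) (?F m) \<omega>) \<partial>M)"
    by (rule nn_integral_cong) (rule pt)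
  also have "\<dots> = (\<Sum>m\<le>k1 + 1. \<integral>\<^sup>+\<omega>. ennreal (1 / real (?c m)) * tuple_sum (A m \<union> B m) (?F m) \<omega> \<partial>M)"
    using campbell_F by (intro nn_integral_sum borel_measurable_times_ennreal) (auto simp: campbell_def)
  also have "\<dots> = (\<Sum>m\<le>k1 + 1. ennreal (1 / real (?c m)) * (\<integral>\<^sup>+z. ?F m z \<partial>intensity (A m \<union> B m)))"
  proof (rule sum.cong[OF refl])
    fix m assume "m \<in> {..k1 + 1}"
    then have "campbell (A m \<union> B m) (?F m)" by (intro campbell_F) simp
    then show "(\<integral>\<^sup>+\<omega>. ennreal (1 / real (?c m)) * tuple_sum (A m \<union> B m) (?F m) \<omega> \<partial>M) =
       ennreal (1 / real (?c m)) * (\<integral>\<^sup>+z. ?F m z \<partial>intensity (A m \<union> B m))"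
      unfolding campbell_def by (simp only: nn_integral_cmult)
  qed
  finally show ?thesis by simp
qed

end

section \<open>Bounds for the covariance\<close>

definition overlap_weight ::
  "real \<Rightarrow> nat \<Rightarrow> nat \<Rightarrow> real \<Rightarrow> real \<Rightarrow> 'i set \<Rightarrow> 'i set \<Rightarrow> ('i \<Rightarrow> 'a::euclidean_space) \<Rightarrow> ennreal" where
  "overlap_weight s k1 k2 \<alpha>1 \<alpha>2 A B z =
     ennreal (simplex_weight s k1 \<alpha>1 (z ` A)) * ennreal (simplex_weight s k2 \<alpha>2 (z ` B))"

text \<open>Each variable is a vertex of one of the two simplices, both of which contain the origin, and the
  weights vanish unless they have diameter at most \<open>1\<close>. So the indicator of the unit balls is redundant.\<close>

lemma rips_mu_eq:
  assumes m: "1 \<le> m" "m \<le> k1 + 1"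
  shows "rips_mu TYPE('a::euclidean_space) k1 k2 m \<alpha>1 \<alpha>2 =
    (\<integral>\<^sup>+x. overlap_weight 1 k1 k2 \<alpha>1 \<alpha>2 {..k1} (insert 0 {k1 + 2 - m..k1 + k2 + 1 - m}) (x(0 := (0::'a)))
      \<partial>(\<Pi>\<^sub>M l\<in>{1..k1 + k2 + 1 - m}. lborel))"
  unfolding rips_mu_def
proof (rule nn_integral_cong)
  fix x :: "nat \<Rightarrow> 'a"
  let ?J = "{1..k1 + k2 + 1 - m}" and ?y = "x(0 := 0)"
  let ?B = "insert 0 {k1 + 2 - m..k1 + k2 + 1 - m}"
  assume x: "x \<in> space (\<Pi>\<^sub>M l\<in>?J. (lborel :: 'a measure))"
  have s1: "set ((0::'a) # map x [1..<k1 + 1]) = ?y ` {..k1}"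
  proof -
    have "{..k1} = insert 0 {1..<k1 + 1}" by auto
    moreover have "?y ` {1..<k1 + 1} = x ` {1..<k1 + 1}" by (rule image_cong) auto
    ultimately show ?thesis by (simp only: list.set set_map set_upt image_insert fun_upd_same)
  qed
  have s2: "set ((0::'a) # map x [k1 + 2 - m..<k1 + k2 + 2 - m]) = ?y ` ?B"
  proof -
    have "{k1 + 2 - m..<k1 + k2 + 2 - m} = {k1 + 2 - m..k1 + k2 + 1 - m}" using m by auto
    moreover have "?y ` {k1 + 2 - m..k1 + k2 + 1 - m} = x ` {k1 + 2 - m..k1 + k2 + 1 - m}"
      using m by (intro image_cong) auto
    ultimately show ?thesis by (simp only: list.set set_map set_upt image_insert fun_upd_same)
  qed
  have w1: "rips_vol_pow 1 \<alpha>1 ((0::'a) # map x [1..<k1 + 1]) = simplex_weight 1 k1 \<alpha>1 (?y ` {..k1})"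
    unfolding rips_vol_pow_eq_weight s1 by (simp only: list.size length_map length_upt) simp
  have len: "k1 + k2 + 2 - m - (k1 + 2 - m) = k2" using m by simp
  have w2: "rips_vol_pow 1 \<alpha>2 ((0::'a) # map x [k1 + 2 - m..<k1 + k2 + 2 - m]) = simplex_weight 1 k2 \<alpha>2 (?y ` ?B)"
    unfolding rips_vol_pow_eq_weight s2 by (simp only: list.size length_map length_upt len) simp
  show "ennreal (rips_vol_pow 1 \<alpha>1 ((0::'a) # map x [1..<k1 + 1]) *
       rips_vol_pow 1 \<alpha>2 ((0::'a) # map x [k1 + 2 - m..<k1 + k2 + 2 - m])) *
     indicator (?J \<rightarrow>\<^sub>E cball 0 1) x = overlap_weight 1 k1 k2 \<alpha>1 \<alpha>2 {..k1} ?B ?y"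
  proof (cases "simplex_weight 1 k1 \<alpha>1 (?y ` {..k1}) = 0 \<or> simplex_weight 1 k2 \<alpha>2 (?y ` ?B) = 0")
    case True
    then show ?thesis unfolding w1 w2 overlap_weight_def by auto
  next
    case False
    have "x l \<in> cball 0 1" if l: "l \<in> ?J" for l
    proof -
      have yl: "?y l = x l" using l by simp
      have "l \<in> {..k1} \<or> l \<in> ?B" using l m by auto
      then have "dist (?y l) (?y 0) \<le> 1"
      proof
        assume "l \<in> {..k1}"
        then show ?thesis using False by (intro simplex_weight_support[of 1 k1 \<alpha>1 "?y ` {..k1}"] imageI) auto
      next
        assume "l \<in> ?B"
        then show ?thesis using False by (intro simplex_weight_support[of 1 k2 \<alpha>2 "?y ` ?B"] imageI) auto
      qed
      then show ?thesis unfolding yl by (simp add: dist_commute)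
    qed
    then have "x \<in> ?J \<rightarrow>\<^sub>E cball 0 1" using x by (auto simp: space_PiM PiE_iff)
    then show ?thesis unfolding w1 w2 overlap_weight_def by (simp add: ennreal_mult)
  qed
qed

lemma overlap_weight_measurable:
  assumes "finite I" "A \<subseteq> I" "B \<subseteq> I" "card A = Suc k1" "card B = Suc k2"
    and "\<alpha>1 \<noteq> 0 \<Longrightarrow> k1 \<le> DIM('a)" "\<alpha>2 \<noteq> 0 \<Longrightarrow> k2 \<le> DIM('a)"
  shows "overlap_weight s k1 k2 \<alpha>1 \<alpha>2 A B \<in> borel_measurable (\<Pi>\<^sub>M i\<in>I. (lborel :: 'a::euclidean_space measure))"
proof -
  have "(\<lambda>z. simplex_weight s k1 \<alpha>1 (z ` A)) \<in> borel_measurable (\<Pi>\<^sub>M i\<in>I. (lborel :: 'a measure))"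
    using assms by (intro simplex_weight_image_measurable) auto
  moreover have "(\<lambda>z. simplex_weight s k2 \<alpha>2 (z ` B)) \<in> borel_measurable (\<Pi>\<^sub>M i\<in>I. (lborel :: 'a measure))"
    using assms by (intro simplex_weight_image_measurable) auto
  ultimately show ?thesis unfolding overlap_weight_def[abs_def] by measurable
qed

lemma simplex_weight_restrict_affine:
  fixes z :: "'i \<Rightarrow> 'a::euclidean_space"
  assumes "r > 0" "card A = Suc k" "\<alpha> \<noteq> 0 \<Longrightarrow> k \<le> DIM('a)" "A \<subseteq> I"
  shows "simplex_weight r k \<alpha> ((\<lambda>i\<in>I. a + r *\<^sub>R z i) ` A) = r powr (\<alpha> * real k) * simplex_weight 1 k \<alpha> (z ` A)"
proof -
  have "(\<lambda>i\<in>I. a + r *\<^sub>R z i) ` A = (\<lambda>i. a + r *\<^sub>R z i) ` A"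
    using assms(4) by (intro image_cong) auto
  then show ?thesis using simplex_weight_image_affine[OF assms(1,2,3), where a=a and z=z] by simp
qed

text \<open>If the origin is the only common vertex then the simplices have no integration variable in common.\<close>

lemma rips_mu_one_factor:
  assumes k: "\<alpha>1 \<noteq> 0 \<Longrightarrow> k1 \<le> DIM('a::euclidean_space)" "\<alpha>2 \<noteq> 0 \<Longrightarrow> k2 \<le> DIM('a)"
  shows "rips_mu TYPE('a) k1 k2 1 \<alpha>1 \<alpha>2 =
    (\<integral>\<^sup>+x. ennreal (simplex_weight 1 k1 \<alpha>1 ((x(0 := (0::'a))) ` insert 0 {1..k1})) \<partial>(\<Pi>\<^sub>M i\<in>{1..k1}. lborel)) *
    (\<integral>\<^sup>+x. ennreal (simplex_weight 1 k2 \<alpha>2 ((x(0 := (0::'a))) ` insert 0 {k1 + 1..k1 + k2})) \<partial>(\<Pi>\<^sub>M i\<in>{k1 + 1..k1 + k2}. lborel))"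
proof -
  let ?A = "{1..k1}" and ?B = "{k1 + 1..k1 + k2}"
  let ?F = "\<lambda>x. ennreal (simplex_weight 1 k1 \<alpha>1 ((x(0 := (0::'a))) ` insert 0 ?A))"
  let ?G = "\<lambda>x. ennreal (simplex_weight 1 k2 \<alpha>2 ((x(0 := (0::'a))) ` insert 0 ?B))"
  have meas: "(\<lambda>x. ennreal (simplex_weight 1 k \<alpha> ((x(0 := (0::'a))) ` insert 0 J))) \<in> borel_measurable (\<Pi>\<^sub>M i\<in>J. lborel)"
    if J: "finite J" "0 \<notin> J" "card J = k" and k: "\<alpha> \<noteq> 0 \<Longrightarrow> k \<le> DIM('a)" for J :: "nat set" and k \<alpha>
  proof -
    have upd: "(\<lambda>x. x(0 := 0)) \<in> measurable (\<Pi>\<^sub>M i\<in>J. lborel) (\<Pi>\<^sub>M i\<in>insert 0 J. (lborel :: 'a measure))"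
      by (rule measurable_fun_upd[where J=J]) auto
    have "(\<lambda>z. simplex_weight 1 k \<alpha> (z ` insert 0 J)) \<in> borel_measurable (\<Pi>\<^sub>M i\<in>insert 0 J. (lborel :: 'a measure))"
      using J k by (intro simplex_weight_image_measurable) auto
    from measurable_compose[OF upd this] show ?thesis by measurable
  qed
  have restr: "((restrict z J)(0 := (0::'a))) ` insert 0 J = (z(0 := 0)) ` insert 0 J" for z and J :: "nat set"
    by (rule image_cong) auto
  have AB: "?A \<union> ?B = {1..k1 + k2}" by auto
  have "rips_mu TYPE('a) k1 k2 1 \<alpha>1 \<alpha>2 = (\<integral>\<^sup>+z. ?F (restrict z ?A) * ?G (restrict z ?B) \<partial>(\<Pi>\<^sub>M i\<in>?A \<union> ?B. lborel))"
  proof -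
    have eA: "{..k1} = insert 0 ?A" by auto
    have eB: "{k1 + 2 - 1..k1 + k2 + 1 - 1} = ?B" by auto
    have eJ: "{1..k1 + k2 + 1 - 1} = {1..k1 + k2}" by simp
    have "rips_mu TYPE('a) k1 k2 1 \<alpha>1 \<alpha>2 =
      (\<integral>\<^sup>+x. overlap_weight 1 k1 k2 \<alpha>1 \<alpha>2 {..k1} (insert 0 {k1 + 2 - 1..k1 + k2 + 1 - 1}) (x(0 := (0::'a)))
        \<partial>(\<Pi>\<^sub>M l\<in>{1..k1 + k2 + 1 - 1}. lborel))"
      by (rule rips_mu_eq) auto
    then show ?thesis
      by (simp only: overlap_weight_def restr AB eA eB eJ)
  qed
  also have "\<dots> = (\<integral>\<^sup>+x. ?F x \<partial>(\<Pi>\<^sub>M i\<in>?A. lborel)) * (\<integral>\<^sup>+y. ?G y \<partial>(\<Pi>\<^sub>M i\<in>?B. lborel))"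
    by (intro nn_integral_PiM_lborel_factor meas k) auto
  finally show ?thesis .
qed

context poisson_process
begin

lemma overlap_integral_bounds:
  fixes A B :: "'i set"
  assumes J: "finite J" "o' \<notin> J" and AB: "A \<union> B = insert o' J" "o' \<in> A" "o' \<in> B"
    and card: "card A = Suc k1" "card B = Suc k2"
    and k: "\<alpha>1 \<noteq> 0 \<Longrightarrow> k1 \<le> DIM('a)" "\<alpha>2 \<noteq> 0 \<Longrightarrow> k2 \<le> DIM('a)"
    and r: "r > 0" and W: "closed W"
  defines "\<nu> \<equiv> (\<integral>\<^sup>+x. overlap_weight 1 k1 k2 \<alpha>1 \<alpha>2 A B (x(o' := (0::'a))) \<partial>(\<Pi>\<^sub>M i\<in>J. lborel))"
    and "C \<equiv> ennreal (t ^ Suc (card J) * r powr (real DIM('a) * real (card J) + (\<alpha>1 * real k1 + \<alpha>2 * real k2)))"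
  shows "(\<integral>\<^sup>+z. overlap_weight r k1 k2 \<alpha>1 \<alpha>2 A B z \<partial>intensity (A \<union> B)) \<le> C * emeasure lborel W * \<nu>"
    and "C * emeasure lborel (erosion W r) * \<nu> \<le> (\<integral>\<^sup>+z. overlap_weight r k1 k2 \<alpha>1 \<alpha>2 A B z \<partial>intensity (A \<union> B))"
proof -
  have sub: "A \<subseteq> insert o' J" "B \<subseteq> insert o' J" using AB by auto
  have meas: "overlap_weight s k1 k2 \<alpha>1 \<alpha>2 A B \<in> borel_measurable (\<Pi>\<^sub>M i\<in>insert o' J. (lborel :: 'a measure))" for s
    using J sub card k by (intro overlap_weight_measurable) auto
  have scale: "overlap_weight r k1 k2 \<alpha>1 \<alpha>2 A B (\<lambda>i\<in>insert o' J. a + r *\<^sub>R z i) =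
      ennreal (r powr (\<alpha>1 * real k1 + \<alpha>2 * real k2)) * overlap_weight 1 k1 k2 \<alpha>1 \<alpha>2 A B z" for a :: 'a and z
  proof -
    have "simplex_weight r k1 \<alpha>1 ((\<lambda>i\<in>insert o' J. a + r *\<^sub>R z i) ` A) = r powr (\<alpha>1 * real k1) * simplex_weight 1 k1 \<alpha>1 (z ` A)"
      by (rule simplex_weight_restrict_affine[OF r card(1) k(1) sub(1)])
    moreover have "simplex_weight r k2 \<alpha>2 ((\<lambda>i\<in>insert o' J. a + r *\<^sub>R z i) ` B) = r powr (\<alpha>2 * real k2) * simplex_weight 1 k2 \<alpha>2 (z ` B)"
      by (rule simplex_weight_restrict_affine[OF r card(2) k(2) sub(2)])
    ultimately show ?thesis
      unfolding overlap_weight_def by (simp only:) (simp add: powr_add ennreal_mult mult_ac)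
  qed
  have supp: "dist (z i) (z o') \<le> 1"
    if z: "overlap_weight 1 k1 k2 \<alpha>1 \<alpha>2 A B z \<noteq> 0" and i: "i \<in> J" for z :: "'i \<Rightarrow> 'a" and i
  proof -
    have nz: "simplex_weight 1 k1 \<alpha>1 (z ` A) \<noteq> 0" "simplex_weight 1 k2 \<alpha>2 (z ` B) \<noteq> 0"
      using z unfolding overlap_weight_def by auto
    have "i \<in> A \<or> i \<in> B" using AB(1) i by auto
    then show ?thesis
      using simplex_weight_support[OF nz(1), of "z i" "z o'"] simplex_weight_support[OF nz(2), of "z i" "z o'"] AB(2,3)
      by auto
  qed
  show "(\<integral>\<^sup>+z. overlap_weight r k1 k2 \<alpha>1 \<alpha>2 A B z \<partial>intensity (A \<union> B)) \<le> C * emeasure lborel W * \<nu>"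
    and "C * emeasure lborel (erosion W r) * \<nu> \<le> (\<integral>\<^sup>+z. overlap_weight r k1 k2 \<alpha>1 \<alpha>2 A B z \<partial>intensity (A \<union> B))"
    unfolding AB(1) C_def \<nu>_def
    using intensity_scaling_bounds[where h="\<lambda>s. overlap_weight s k1 k2 \<alpha>1 \<alpha>2 A B" and \<beta>="\<alpha>1 * real k1 + \<alpha>2 * real k2",
        OF J r W meas scale supp] by blast+
qed

lemma rips_expectation_finite:
  fixes J :: "nat set"
  assumes J: "finite J" "0 \<notin> J" "card J = k" and k: "\<alpha> \<noteq> 0 \<Longrightarrow> k \<le> DIM('a)"
    and r: "r > 0" and W: "closed W"
    and fin: "(\<integral>\<^sup>+x. ennreal (simplex_weight 1 k \<alpha> ((x(0 := (0::'a))) ` insert 0 J)) \<partial>(\<Pi>\<^sub>M i\<in>J. lborel)) < \<infinity>"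
  shows "(\<integral>\<^sup>+\<omega>. ennreal (rips_functional r k \<alpha> (\<eta> \<omega>)) \<partial>M) < \<infinity>"
proof -
  let ?I = "insert 0 J"
  have cI: "finite ?I" "card ?I = Suc k" using J by auto
  have meas: "(\<lambda>z. ennreal (simplex_weight s k \<alpha> (z ` ?I))) \<in> borel_measurable (\<Pi>\<^sub>M i\<in>?I. (lborel :: 'a measure))" for s
  proof -
    have "(\<lambda>z. simplex_weight s k \<alpha> (z ` ?I)) \<in> borel_measurable (\<Pi>\<^sub>M i\<in>?I. (lborel :: 'a measure))"
      using cI k by (intro simplex_weight_image_measurable) auto
    then show ?thesis by measurable
  qed
  have scale: "ennreal (simplex_weight r k \<alpha> ((\<lambda>i\<in>?I. a + r *\<^sub>R z i) ` ?I)) =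
      ennreal (r powr (\<alpha> * real k)) * ennreal (simplex_weight 1 k \<alpha> (z ` ?I))" for a :: 'a and z
  proof -
    have "simplex_weight r k \<alpha> ((\<lambda>i\<in>?I. a + r *\<^sub>R z i) ` ?I) = r powr (\<alpha> * real k) * simplex_weight 1 k \<alpha> (z ` ?I)"
      by (rule simplex_weight_restrict_affine[OF r cI(2) k subset_refl])
    then show ?thesis by (simp only:) (simp add: ennreal_mult)
  qed
  have supp: "dist (z i) (z 0) \<le> 1" if "ennreal (simplex_weight 1 k \<alpha> (z ` ?I)) \<noteq> 0" "i \<in> J" for z :: "nat \<Rightarrow> 'a" and i
  proof -
    have "simplex_weight 1 k \<alpha> (z ` ?I) \<noteq> 0" using that(1) by (metis ennreal_0)
    then show ?thesis by (rule simplex_weight_support) (use that(2) in auto)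
  qed
  have "(\<integral>\<^sup>+z. ennreal (simplex_weight r k \<alpha> (z ` ?I)) \<partial>intensity ?I) \<le>
      ennreal (t ^ Suc (card J) * r powr (real DIM('a) * real (card J) + \<alpha> * real k)) * emeasure lborel W *
      (\<integral>\<^sup>+x. ennreal (simplex_weight 1 k \<alpha> ((x(0 := (0::'a))) ` ?I)) \<partial>(\<Pi>\<^sub>M i\<in>J. lborel))"
    using intensity_scaling_bounds(1)[where h="\<lambda>s z. ennreal (simplex_weight s k \<alpha> (z ` ?I))",
        OF J(1,2) r W meas scale supp] by blast
  also have "\<dots> < \<infinity>" using fin W_finite by (simp add: ennreal_mult_less_top)
  finally have "(\<integral>\<^sup>+z. ennreal (simplex_weight r k \<alpha> (z ` ?I)) \<partial>intensity ?I) < \<infinity>" .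
  moreover have "(\<integral>\<^sup>+\<omega>. ennreal (rips_functional r k \<alpha> (\<eta> \<omega>)) \<partial>M) =
      ennreal (1 / fact (k + 1)) * (\<integral>\<^sup>+z. ennreal (simplex_weight r k \<alpha> (z ` ?I)) \<partial>intensity ?I)"
    by (rule rips_measurable_expectation(2)[OF cI k])
  ultimately show ?thesis by (simp only:) (simp add: ennreal_mult_less_top)
qed

text \<open>In \<open>[0,\<infinity>]\<close> the second mixed moment is the product of the means plus \<open>R\<close>, the contribution of the pairs
  that overlap. If a mean is infinite then the covariance is \<open>\<infinity>\<close> by convention, and \<open>D\<close> is infinite
  because its term for \<open>m = 1\<close> is.\<close>

lemma rips_covariance_bounds:
  assumes k12: "k1 \<le> k2" and k: "\<alpha>1 \<noteq> 0 \<Longrightarrow> k1 \<le> DIM('a)" "\<alpha>2 \<noteq> 0 \<Longrightarrow> k2 \<le> DIM('a)"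
    and r: "r > 0" and t: "t > 0" and W: "closed W" and Wpos: "emeasure lborel W > 0"
  defines "D \<equiv> (\<Sum>m = 1..k1 + 1. ennreal (1 / (fact m * fact (k1 + 1 - m) * fact (k2 + 1 - m))) *
      (ennreal (t ^ (k1 + k2 + 2 - m) * r powr ((real DIM('a) + \<alpha>1) * real k1 + (real DIM('a) + \<alpha>2) * real k2
          - real DIM('a) * (real m - 1))) * rips_mu TYPE('a) k1 k2 m \<alpha>1 \<alpha>2))"
  shows "\<exists>R. ext_cov M (\<lambda>\<omega>. rips_functional r k1 \<alpha>1 (\<eta> \<omega>)) (\<lambda>\<omega>. rips_functional r k2 \<alpha>2 (\<eta> \<omega>)) = enn2ereal R \<and>
      emeasure lborel (erosion W r) * D \<le> R \<and> R \<le> emeasure lborel W * D"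
proof -
  let ?X = "\<lambda>\<omega>. rips_functional r k1 \<alpha>1 (\<eta> \<omega>)" and ?Y = "\<lambda>\<omega>. rips_functional r k2 \<alpha>2 (\<eta> \<omega>)"
  define A where "A = (\<lambda>m::nat. {..k1})"
  \<comment> \<open>The positions of the second simplex. Position \<open>0\<close> is common to both simplices if \<open>m \<ge> 1\<close>, and the
    other \<open>m - 1\<close> common positions are the last ones of the first simplex.\<close>
  define B where "B = (\<lambda>m. if m = 0 then {k1 + 1..k1 + k2 + 1} else insert 0 {k1 + 2 - m..k1 + k2 + 1 - m})"
  define J where "J = (\<lambda>m. {1..k1 + k2 + 1 - m})"
  define c where "c = (\<lambda>m. ennreal (1 / (fact m * fact (k1 + 1 - m) * fact (k2 + 1 - m))))"
  define C where "C = (\<lambda>m. ennreal (t ^ (k1 + k2 + 2 - m) * r powr ((real DIM('a) + \<alpha>1) * real k1 + (real DIM('a) + \<alpha>2) * real k2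
          - real DIM('a) * (real m - 1))))"
  define \<mu> where "\<mu> = (\<lambda>m. rips_mu TYPE('a) k1 k2 m \<alpha>1 \<alpha>2)"
  define Q where "Q = (\<lambda>m. \<integral>\<^sup>+z. overlap_weight r k1 k2 \<alpha>1 \<alpha>2 (A m) (B m) z \<partial>intensity (A m \<union> B m))"
  define R where "R = (\<Sum>m = 1..k1 + 1. c m * Q m)"
  have D: "D = (\<Sum>m = 1..k1 + 1. c m * (C m * \<mu> m))"
    unfolding D_def c_def C_def \<mu>_def ..
  have AB: "finite (A m)" "card (A m) = Suc k1" "finite (B m)" "card (B m) = Suc k2" "card (A m \<inter> B m) = m"
    if m: "m \<le> k1 + 1" for m
  proof -
    show "finite (A m)" "card (A m) = Suc k1" "finite (B m)" by (simp_all add: A_def B_def)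
    show "card (B m) = Suc k2" using m by (auto simp: B_def)
    show "card (A m \<inter> B m) = m"
    proof (cases "m = 0")
      case True
      then have "A m \<inter> B m = {}" by (auto simp: A_def B_def)
      then show ?thesis using True by simp
    next
      case False
      then have "A m \<inter> B m = insert 0 {k1 + 2 - m..k1}" using m k12 by (auto simp: A_def B_def)
      then show ?thesis using m False by auto
    qed
  qed
  have X: "?X \<in> borel_measurable M"
      "(\<integral>\<^sup>+\<omega>. ennreal (?X \<omega>) \<partial>M) = ennreal (1 / fact (k1 + 1)) * (\<integral>\<^sup>+z. ennreal (simplex_weight r k1 \<alpha>1 (z ` A 0)) \<partial>intensity (A 0))"
    by (rule rips_measurable_expectation[OF AB(1)[of 0] AB(2)[of 0] k(1)]; simp)+
  have Y: "?Y \<in> borel_measurable M"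
      "(\<integral>\<^sup>+\<omega>. ennreal (?Y \<omega>) \<partial>M) = ennreal (1 / fact (k2 + 1)) * (\<integral>\<^sup>+z. ennreal (simplex_weight r k2 \<alpha>2 (z ` B 0)) \<partial>intensity (B 0))"
    by (rule rips_measurable_expectation[OF AB(3)[of 0] AB(4)[of 0] k(2)]; simp)+
  have "(\<integral>\<^sup>+\<omega>. ennreal (?X \<omega> * ?Y \<omega>) \<partial>M) = (\<Sum>m\<le>k1 + 1. c m * Q m)"
    unfolding c_def Q_def overlap_weight_def by (intro rips_product_expectation AB k)
  also have "\<dots> = c 0 * Q 0 + R"
  proof -
    have "{..k1 + 1} = insert 0 {1..k1 + 1}" by auto
    then show ?thesis unfolding R_def by simp
  qed
  \<comment> \<open>Disjoint simplices contribute the product of the means.\<close>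
  also have "c 0 * Q 0 = (\<integral>\<^sup>+\<omega>. ennreal (?X \<omega>) \<partial>M) * (\<integral>\<^sup>+\<omega>. ennreal (?Y \<omega>) \<partial>M)"
  proof -
    have "Q 0 = (\<integral>\<^sup>+z. ennreal (simplex_weight r k1 \<alpha>1 (z ` A 0)) \<partial>intensity (A 0)) *
       (\<integral>\<^sup>+z. ennreal (simplex_weight r k2 \<alpha>2 (z ` B 0)) \<partial>intensity (B 0))"
      unfolding Q_def overlap_weight_def
    proof (rule intensity_integral_factor)
      have "(\<lambda>z. simplex_weight r k1 \<alpha>1 (z ` A 0)) \<in> borel_measurable (\<Pi>\<^sub>M i\<in>A 0. (lborel :: 'a measure))"
        using AB[of 0] k(1) by (intro simplex_weight_image_measurable) auto
      then show "(\<lambda>z. ennreal (simplex_weight r k1 \<alpha>1 (z ` A 0))) \<in> borel_measurable (\<Pi>\<^sub>M i\<in>A 0. (lborel :: 'a measure))"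
        by measurable
      have "(\<lambda>z. simplex_weight r k2 \<alpha>2 (z ` B 0)) \<in> borel_measurable (\<Pi>\<^sub>M i\<in>B 0. (lborel :: 'a measure))"
        using AB[of 0] k(2) by (intro simplex_weight_image_measurable) auto
      then show "(\<lambda>z. ennreal (simplex_weight r k2 \<alpha>2 (z ` B 0))) \<in> borel_measurable (\<Pi>\<^sub>M i\<in>B 0. (lborel :: 'a measure))"
        by measurable
    qed (use AB[of 0] in \<open>auto simp: A_def B_def\<close>)
    moreover have "c 0 = ennreal (1 / fact (k1 + 1)) * ennreal (1 / fact (k2 + 1))"
      unfolding c_def by (simp add: ennreal_mult[symmetric] del: fact_Suc)
    ultimately show ?thesis unfolding X(2) Y(2) by (simp only: mult_ac)
  qed
  finally have prod: "(\<integral>\<^sup>+\<omega>. ennreal (?X \<omega> * ?Y \<omega>) \<partial>M) = (\<integral>\<^sup>+\<omega>. ennreal (?X \<omega>) \<partial>M) * (\<integral>\<^sup>+\<omega>. ennreal (?Y \<omega>) \<partial>M) + R" .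
  have bounds: "C m * emeasure lborel (erosion W r) * \<mu> m \<le> Q m" "Q m \<le> C m * emeasure lborel W * \<mu> m"
    if "m \<in> {1..k1 + 1}" for m
  proof -
    have m: "1 \<le> m" "m \<le> k1 + 1" using that by auto
    have un: "A m \<union> B m = insert 0 (J m)" using m k12 by (auto simp: A_def B_def J_def)
    have \<mu>: "\<mu> m = (\<integral>\<^sup>+x. overlap_weight 1 k1 k2 \<alpha>1 \<alpha>2 (A m) (B m) (x(0 := (0::'a))) \<partial>(\<Pi>\<^sub>M i\<in>J m. lborel))"
      unfolding \<mu>_def rips_mu_eq[OF m] A_def B_def J_def using m by simp
    have "Suc (card (J m)) = k1 + k2 + 2 - m" using m by (simp add: J_def)
    moreover have "real DIM('a) * real (card (J m)) + (\<alpha>1 * real k1 + \<alpha>2 * real k2) =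
        (real DIM('a) + \<alpha>1) * real k1 + (real DIM('a) + \<alpha>2) * real k2 - real DIM('a) * (real m - 1)"
      using m by (simp add: J_def of_nat_diff algebra_simps)
    ultimately have Cm: "C m = ennreal (t ^ Suc (card (J m)) * r powr (real DIM('a) * real (card (J m)) + (\<alpha>1 * real k1 + \<alpha>2 * real k2)))"
      unfolding C_def by (simp only:)
    have J0: "finite (J m)" "0 \<notin> J m" by (auto simp: J_def)
    have 0: "0 \<in> A m" "0 \<in> B m" using m by (auto simp: A_def B_def)
    show "C m * emeasure lborel (erosion W r) * \<mu> m \<le> Q m"
      unfolding Q_def Cm \<mu>
      by (rule overlap_integral_bounds(2)[OF J0 un 0 AB(2)[OF m(2)] AB(4)[OF m(2)] k r W])
    show "Q m \<le> C m * emeasure lborel W * \<mu> m"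
      unfolding Q_def Cm \<mu>
      by (rule overlap_integral_bounds(1)[OF J0 un 0 AB(2)[OF m(2)] AB(4)[OF m(2)] k r W])
  qed
  have lower: "emeasure lborel (erosion W r) * D \<le> R"
    unfolding D R_def sum_distrib_left
  proof (rule sum_mono)
    fix m assume "m \<in> {1..k1 + 1}"
    from mult_left_mono[OF bounds(1)[OF this] zero_le[of "c m"]]
    show "emeasure lborel (erosion W r) * (c m * (C m * \<mu> m)) \<le> c m * Q m" by (simp only: mult_ac)
  qed
  have upper: "R \<le> emeasure lborel W * D"
    unfolding D R_def sum_distrib_left
  proof (rule sum_mono)
    fix m assume "m \<in> {1..k1 + 1}"
    from mult_left_mono[OF bounds(2)[OF this] zero_le[of "c m"]]
    show "c m * Q m \<le> emeasure lborel W * (c m * (C m * \<mu> m))" by (simp only: mult_ac)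
  qed
  show ?thesis
  proof (cases "(\<integral>\<^sup>+\<omega>. ennreal (?X \<omega>) \<partial>M) < \<infinity> \<and> (\<integral>\<^sup>+\<omega>. ennreal (?Y \<omega>) \<partial>M) < \<infinity>")
    case True
    have "ext_cov M ?X ?Y = enn2ereal R"
      by (rule ext_cov_of_product_moment[OF X(1) Y(1) rips_nonneg rips_nonneg conjunct1[OF True] conjunct2[OF True] prod])
    then show ?thesis using lower upper by blast
  next
    case False
    define \<nu>1 where "\<nu>1 = (\<integral>\<^sup>+x. ennreal (simplex_weight 1 k1 \<alpha>1 ((x(0 := (0::'a))) ` insert 0 {1..k1})) \<partial>(\<Pi>\<^sub>M i\<in>{1..k1}. lborel))"
    define \<nu>2 where "\<nu>2 = (\<integral>\<^sup>+x. ennreal (simplex_weight 1 k2 \<alpha>2 ((x(0 := (0::'a))) ` insert 0 {k1 + 1..k1 + k2})) \<partial>(\<Pi>\<^sub>M i\<in>{k1 + 1..k1 + k2}. lborel))"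
    have J1: "finite {1..k1}" "0 \<notin> {1..k1}" "card {1..k1} = k1" by simp_all
    have J2: "finite {k1 + 1..k1 + k2}" "0 \<notin> {k1 + 1..k1 + k2}" "card {k1 + 1..k1 + k2} = k2" by simp_all
    have fin1: "(\<integral>\<^sup>+\<omega>. ennreal (?X \<omega>) \<partial>M) < \<infinity>" if "\<nu>1 < \<infinity>"
      by (rule rips_expectation_finite[OF J1 k(1) r W that[unfolded \<nu>1_def]])
    have fin2: "(\<integral>\<^sup>+\<omega>. ennreal (?Y \<omega>) \<partial>M) < \<infinity>" if "\<nu>2 < \<infinity>"
      by (rule rips_expectation_finite[OF J2 k(2) r W that[unfolded \<nu>2_def]])
    have pos1: "\<nu>1 > 0" unfolding \<nu>1_def by (rule simplex_weight_integral_pos[OF J1(1,3) k(1) J1(2)])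
    have pos2: "\<nu>2 > 0" unfolding \<nu>2_def by (rule simplex_weight_integral_pos[OF J2(1,3) k(2) J2(2)])
    have prod\<nu>: "\<mu> 1 = \<nu>1 * \<nu>2" unfolding \<mu>_def \<nu>1_def \<nu>2_def by (rule rips_mu_one_factor[OF k])
    have "\<not> (\<nu>1 < \<infinity> \<and> \<nu>2 < \<infinity>)" using False fin1 fin2 by blast
    then have "\<nu>1 = \<infinity> \<or> \<nu>2 = \<infinity>" by (simp add: less_top[symmetric])
    then have \<mu>1: "\<mu> 1 = \<infinity>" unfolding prod\<nu> using pos1 pos2 by (auto simp: ennreal_mult_eq_top_iff)
    have "c 1 > 0" unfolding c_def by (simp add: ennreal_less_zero_iff del: fact_Suc)
    moreover have "C 1 > 0" unfolding C_def using t r by (simp add: ennreal_less_zero_iff)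
    ultimately have "c 1 * (C 1 * \<mu> 1) = \<infinity>" unfolding \<mu>1 by (simp add: ennreal_mult_eq_top_iff)
    moreover have "c 1 * (C 1 * \<mu> 1) \<le> D" unfolding D by (rule member_le_sum) simp_all
    ultimately have "D = \<infinity>" by (simp add: top_unique)
    then have WD: "emeasure lborel W * D = \<infinity>" using Wpos by (simp add: ennreal_mult_eq_top_iff)
    have "(\<integral>\<^sup>+\<omega>. ennreal (?X \<omega>) \<partial>M) < \<infinity>" if "integrable M ?X"
      using that by (simp add: integrable_iff_bounded rips_nonneg)
    moreover have "(\<integral>\<^sup>+\<omega>. ennreal (?Y \<omega>) \<partial>M) < \<infinity>" if "integrable M ?Y"
      using that by (simp add: integrable_iff_bounded rips_nonneg)
    ultimately have "\<not> (integrable M ?X \<and> integrable M ?Y)" using False by blast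
    then have "ext_cov M ?X ?Y = enn2ereal \<infinity>" unfolding ext_cov_def by (simp only: if_False) simp
    then show ?thesis using WD by (intro exI[of _ \<infinity>]) simp
  qed
qed

end

section \<open>Asymptotics\<close>

text \<open>If \<open>D t\<close> is \<open>0\<close> or \<open>\<infinity>\<close> then the bounds leave no choice for \<open>V t\<close>, and \<open>\<epsilon> t = 0\<close> will do. Otherwise \<open>1 + \<epsilon> t\<close>
  is the quotient of two real numbers.\<close>

lemma asymptotic_factor:
  fixes V :: "real \<Rightarrow> ereal" and D :: "real \<Rightarrow> ennreal"
  assumes "\<And>e. e > 0 \<Longrightarrow> \<forall>\<^sub>F t in at_top. \<exists>R. V t = enn2ereal R \<and> ennreal (1 - e) * D t \<le> R \<and> R \<le> D t"
  shows "\<exists>\<epsilon>. (\<epsilon> \<longlongrightarrow> 0) at_top \<and> (\<forall>\<^sub>F t in at_top. V t = enn2ereal (D t) * ereal (1 + \<epsilon> t))"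
proof -
  define \<epsilon> where "\<epsilon> t = (if D t = 0 \<or> D t = \<infinity> then 0 else real_of_ereal (V t) / enn2real (D t) - 1)" for t
  have main: "\<bar>\<epsilon> t\<bar> \<le> e \<and> V t = enn2ereal (D t) * ereal (1 + \<epsilon> t)"
    if e: "0 < e" "e < 1" and R: "V t = enn2ereal R" "ennreal (1 - e) * D t \<le> R" "R \<le> D t" for e t R
  proof (cases "D t = 0 \<or> D t = \<infinity>")
    case True
    then have "R = D t"
    proof
      assume "D t = 0" then show ?thesis using R(3) by simp
    next
      assume "D t = \<infinity>" then show ?thesis using R(2) e by (simp add: ennreal_mult_top top_unique)
    qed
    then show ?thesis using True R(1) e by (auto simp: \<epsilon>_def)
  next
    case False
    then obtain d where d: "d > 0" "D t = ennreal d" by (cases "D t") (auto simp: less_le)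
    then obtain q where q: "q \<ge> 0" "R = ennreal q" using R(3) by (cases R) (auto simp: top_unique)
    have lo: "(1 - e) * d \<le> q" using R(2) d e q by (simp add: ennreal_mult[symmetric])
    have hi: "q \<le> d" using R(3) d q by simp
    have eps: "\<epsilon> t = q / d - 1" using False R(1) d q by (simp add: \<epsilon>_def enn2ereal_ennreal)
    have "- e \<le> \<epsilon> t" "\<epsilon> t \<le> 0" unfolding eps using lo hi d by (simp_all add: field_simps)
    moreover have "V t = enn2ereal (D t) * ereal (1 + \<epsilon> t)"
      unfolding eps using R(1) d q by (simp add: enn2ereal_ennreal)
    ultimately show ?thesis using e by auto
  qed
  have "(\<epsilon> \<longlongrightarrow> 0) at_top"
  proof (rule tendstoI)
    fix e :: real assume e: "e > 0"
    define e' where "e' = min (e / 2) (1 / 2)"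
    have e': "0 < e'" "e' < 1" "e' < e" using e by (auto simp: e'_def)
    from assms[OF e'(1)] show "\<forall>\<^sub>F t in at_top. dist (\<epsilon> t) 0 < e"
      by eventually_elim (use main[OF e'(1,2)] e'(3) in fastforce)
  qed
  moreover have "\<forall>\<^sub>F t in at_top. V t = enn2ereal (D t) * ereal (1 + \<epsilon> t)"
  proof (rule eventually_mono)
    show "\<forall>\<^sub>F t in at_top. \<exists>R. V t = enn2ereal R \<and> ennreal (1 - 1 / 2) * D t \<le> R \<and> R \<le> D t"
      by (rule assms) simp
    fix t assume "\<exists>R. V t = enn2ereal R \<and> ennreal (1 - 1 / 2) * D t \<le> R \<and> R \<le> D t"
    then obtain R where R: "V t = enn2ereal R" "ennreal (1 - 1 / 2) * D t \<le> R" "R \<le> D t" by blast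
    show "V t = enn2ereal (D t) * ereal (1 + \<epsilon> t)" using main[OF _ _ R] by simp
  qed
  ultimately show ?thesis by blast
qed

lemma enn2ereal_sum_terms:
  fixes c p :: "nat \<Rightarrow> real" and \<mu> :: "nat \<Rightarrow> ennreal"
  assumes "\<And>m. m \<in> S \<Longrightarrow> c m > 0" "\<And>m. m \<in> S \<Longrightarrow> p m \<ge> 0"
  shows "enn2ereal (\<Sum>m\<in>S. ennreal (1 / c m) * (ennreal (p m) * \<mu> m)) = (\<Sum>m\<in>S. enn2ereal (\<mu> m) / ereal (c m) * ereal (p m))"
proof -
  have "enn2ereal (\<Sum>m\<in>S. ennreal (1 / c m) * (ennreal (p m) * \<mu> m)) = (\<Sum>m\<in>S. enn2ereal (ennreal (1 / c m) * (ennreal (p m) * \<mu> m)))"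
    by (simp add: sum_enn2ereal)
  also have "\<dots> = (\<Sum>m\<in>S. enn2ereal (\<mu> m) / ereal (c m) * ereal (p m))"
  proof (rule sum.cong[OF refl])
    fix m assume m: "m \<in> S"
    have "enn2ereal (ennreal (1 / c m) * (ennreal (p m) * \<mu> m)) = ereal (1 / c m) * (ereal (p m) * enn2ereal (\<mu> m))"
      using assms[OF m] less_imp_le[OF assms(1)[OF m]] by (simp add: times_ennreal.rep_eq enn2ereal_ennreal)
    also have "\<dots> = enn2ereal (\<mu> m) / ereal (c m) * ereal (p m)"
      using assms(1)[OF m] by (simp add: divide_ereal_def inverse_eq_divide mult_ac)
    finally show "enn2ereal (ennreal (1 / c m) * (ennreal (p m) * \<mu> m)) = enn2ereal (\<mu> m) / ereal (c m) * ereal (p m)" .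
  qed
  finally show ?thesis .
qed

text \<open>The lower bound of \<open>rips_covariance_bounds\<close> has the factor \<open>1 - o(1)\<close> since the volume of the erosion
  tends to that of \<open>W\<close>.\<close>

lemma rips_covariance_asymptotics:
  fixes W :: "'a::euclidean_space set"
    and \<delta> :: "real \<Rightarrow> real" and M :: "real \<Rightarrow> 'w measure" and \<eta> :: "real \<Rightarrow> 'w \<Rightarrow> 'a set"
  assumes W: "compact W" "convex W" "measure lborel W = 1"
    and pp: "\<And>t. t > 0 \<Longrightarrow> poisson_process_on (M t) (\<eta> t) W t"
    and \<delta>: "\<And>t. t > 0 \<Longrightarrow> \<delta> t > 0" "(\<delta> \<longlongrightarrow> 0) at_top"
    and k12: "k1 \<le> k2" and k: "k1 > DIM('a) \<longrightarrow> \<alpha>1 = 0" "k2 > DIM('a) \<longrightarrow> \<alpha>2 = 0"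
  shows "\<exists>\<epsilon> :: real \<Rightarrow> real. (\<epsilon> \<longlongrightarrow> 0) at_top \<and>
          (\<forall>\<^sub>F t in at_top.
             ext_cov (M t) (\<lambda>\<omega>. rips_functional (\<delta> t) k1 \<alpha>1 (\<eta> t \<omega>))
                           (\<lambda>\<omega>. rips_functional (\<delta> t) k2 \<alpha>2 (\<eta> t \<omega>)) =
             (\<Sum>m = 1..k1 + 1.
                enn2ereal (rips_mu TYPE('a) k1 k2 m \<alpha>1 \<alpha>2)
                / ereal (fact m * fact (k1 + 1 - m) * fact (k2 + 1 - m))
                * ereal (t ^ (k1 + k2 + 2 - m)
                  * \<delta> t powr ((real DIM('a) + \<alpha>1) * real k1 + (real DIM('a) + \<alpha>2) * real k2
                              - real DIM('a) * (real m - 1))))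
             * ereal (1 + \<epsilon> t))"
proof -
  define V where "V = (\<lambda>t. ext_cov (M t) (\<lambda>\<omega>. rips_functional (\<delta> t) k1 \<alpha>1 (\<eta> t \<omega>))
                           (\<lambda>\<omega>. rips_functional (\<delta> t) k2 \<alpha>2 (\<eta> t \<omega>)))"
  define p where "p = (\<lambda>t m. t ^ (k1 + k2 + 2 - m) * \<delta> t powr ((real DIM('a) + \<alpha>1) * real k1 + (real DIM('a) + \<alpha>2) * real k2
                              - real DIM('a) * (real m - 1)))"
  define c :: "nat \<Rightarrow> real" where "c = (\<lambda>m. fact m * fact (k1 + 1 - m) * fact (k2 + 1 - m))"
  define D where "D = (\<lambda>t. \<Sum>m = 1..k1 + 1. ennreal (1 / c m) * (ennreal (p t m) * rips_mu TYPE('a) k1 k2 m \<alpha>1 \<alpha>2))"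
  have cl: "closed W" using W(1) by (rule compact_imp_closed)
  have finW: "emeasure lborel W < \<infinity>" using emeasure_bounded_finite[OF compact_imp_bounded[OF W(1)]] by simp
  have W1: "emeasure lborel W = 1" using finW W(3) by (simp add: emeasure_eq_ennreal_measure)
  have "\<exists>\<epsilon>. (\<epsilon> \<longlongrightarrow> 0) at_top \<and> (\<forall>\<^sub>F t in at_top. V t = enn2ereal (D t) * ereal (1 + \<epsilon> t))"
  proof (rule asymptotic_factor)
    fix e :: real assume e: "e > 0"
    obtain r0 where r0: "r0 > 0" "\<And>r. 0 < r \<Longrightarrow> r \<le> r0 \<Longrightarrow> measure lborel (erosion W r) > measure lborel W - e"
      using measure_erosion_eventually[OF W(1,2) e] by blast
    have "\<forall>\<^sub>F t in at_top. \<delta> t < r0" using order_tendstoD(2)[OF \<delta>(2) r0(1)] .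
    moreover have "\<forall>\<^sub>F t::real in at_top. t > 0" by (rule eventually_gt_at_top)
    ultimately show "\<forall>\<^sub>F t in at_top. \<exists>R. V t = enn2ereal R \<and> ennreal (1 - e) * D t \<le> R \<and> R \<le> D t"
    proof eventually_elim
      case (elim t)
      have "prob_space (M t)" using pp[OF elim(2)] unfolding poisson_process_on_def by blast
      then interpret poisson_process "M t" "\<eta> t" W t
        using pp[OF elim(2)] elim(2) cl finW
        by (intro poisson_process.intro poisson_process_axioms.intro) auto
      obtain R where R: "V t = enn2ereal R" "emeasure lborel (erosion W (\<delta> t)) * D t \<le> R" "R \<le> emeasure lborel W * D t"
        using rips_covariance_bounds[OF k12 _ _ \<delta>(1)[OF elim(2)] elim(2) cl, of \<alpha>1 \<alpha>2] k W1
        unfolding V_def D_def p_def c_def by fastforce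
      have "erosion W (\<delta> t) \<subseteq> W" using \<delta>(1)[OF elim(2)] unfolding erosion_def by auto
      then have "emeasure lborel (erosion W (\<delta> t)) \<le> emeasure lborel W" using cl by (intro emeasure_mono) auto
      then have "emeasure lborel (erosion W (\<delta> t)) = ennreal (measure lborel (erosion W (\<delta> t)))"
        using finW by (intro emeasure_eq_ennreal_measure) (auto simp: top_unique)
      moreover have "measure lborel (erosion W (\<delta> t)) > 1 - e"
        using r0(2)[of "\<delta> t"] \<delta>(1)[OF elim(2)] elim(1) W(3) by simp
      ultimately have "ennreal (1 - e) * D t \<le> emeasure lborel (erosion W (\<delta> t)) * D t"
        by (intro mult_right_mono) (auto intro: ennreal_leI)
      then have "ennreal (1 - e) * D t \<le> R" using R(2) by (rule order_trans)
      then show ?case using R(1,3) W1 by auto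
    qed
  qed
  then obtain \<epsilon> where \<epsilon>: "(\<epsilon> \<longlongrightarrow> 0) at_top" "\<forall>\<^sub>F t in at_top. V t = enn2ereal (D t) * ereal (1 + \<epsilon> t)" by blast
  have "\<forall>\<^sub>F t in at_top. V t = (\<Sum>m = 1..k1 + 1. enn2ereal (rips_mu TYPE('a) k1 k2 m \<alpha>1 \<alpha>2) / ereal (c m) * ereal (p t m)) * ereal (1 + \<epsilon> t)"
    using \<epsilon>(2) eventually_gt_at_top[of "0::real"]
  proof eventually_elim
    case (elim t)
    have "enn2ereal (D t) = (\<Sum>m = 1..k1 + 1. enn2ereal (rips_mu TYPE('a) k1 k2 m \<alpha>1 \<alpha>2) / ereal (c m) * ereal (p t m))"
      unfolding D_def using elim(2) by (intro enn2ereal_sum_terms) (auto simp: c_def p_def)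
    then show ?case using elim(1) by simp
  qed
  then show ?thesis using \<epsilon>(1) unfolding V_def c_def p_def by blast
qed

theorem theorem3p3:
  fixes W :: "'a::euclidean_space set"
    and \<delta> :: "real \<Rightarrow> real"
    and M :: "real \<Rightarrow> 'w measure"
    and \<eta> :: "real \<Rightarrow> 'w \<Rightarrow> 'a set"
  assumes "compact W" and "convex W" and "measure lborel W = 1"
    and "\<And>t. t > 0 \<Longrightarrow> poisson_process_on (M t) (\<eta> t) W t"
    and "\<And>t. t > 0 \<Longrightarrow> \<delta> t > 0"
    and "(\<delta> \<longlongrightarrow> 0) at_top"
  shows
    "(\<forall>k\<^sub>1 k\<^sub>2 \<alpha>\<^sub>1 \<alpha>\<^sub>2.
        k\<^sub>1 \<le> k\<^sub>2 \<and> min (min \<alpha>\<^sub>1 \<alpha>\<^sub>2) (\<alpha>\<^sub>1 + \<alpha>\<^sub>2) > - real DIM('a) \<and>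
        (k\<^sub>1 > DIM('a) \<longrightarrow> \<alpha>\<^sub>1 = 0) \<and> (k\<^sub>2 > DIM('a) \<longrightarrow> \<alpha>\<^sub>2 = 0) \<longrightarrow>
        (\<exists>\<epsilon> :: real \<Rightarrow> real. (\<epsilon> \<longlongrightarrow> 0) at_top \<and>
          (\<forall>\<^sub>F t in at_top.
             ext_cov (M t) (\<lambda>\<omega>. rips_functional (\<delta> t) k\<^sub>1 \<alpha>\<^sub>1 (\<eta> t \<omega>))
                           (\<lambda>\<omega>. rips_functional (\<delta> t) k\<^sub>2 \<alpha>\<^sub>2 (\<eta> t \<omega>)) =
             (\<Sum>m = 1..k\<^sub>1 + 1.
                enn2ereal (rips_mu TYPE('a) k\<^sub>1 k\<^sub>2 m \<alpha>\<^sub>1 \<alpha>\<^sub>2)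
                / ereal (fact m * fact (k\<^sub>1 + 1 - m) * fact (k\<^sub>2 + 1 - m))
                * ereal (t ^ (k\<^sub>1 + k\<^sub>2 + 2 - m)
                  * \<delta> t powr ((real DIM('a) + \<alpha>\<^sub>1) * real k\<^sub>1 + (real DIM('a) + \<alpha>\<^sub>2) * real k\<^sub>2
                              - real DIM('a) * (real m - 1))))
             * ereal (1 + \<epsilon> t)))) \<and>
     (\<forall>k \<alpha>.
        2 * \<alpha> > - real DIM('a) \<and> (k > DIM('a) \<longrightarrow> \<alpha> = 0) \<longrightarrow>
        (\<exists>\<epsilon> :: real \<Rightarrow> real. (\<epsilon> \<longlongrightarrow> 0) at_top \<and>
          (\<forall>\<^sub>F t in at_top.
             ext_var (M t) (\<lambda>\<omega>. rips_functional (\<delta> t) k \<alpha> (\<eta> t \<omega>)) =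
             (\<Sum>m = 1..k + 1.
                enn2ereal (rips_mu TYPE('a) k k m \<alpha> \<alpha>)
                / ereal (fact m * (fact (k + 1 - m))\<^sup>2)
                * ereal (t ^ (2 * k + 2 - m)
                  * \<delta> t powr (2 * (real DIM('a) + \<alpha>) * real k
                              - real DIM('a) * (real m - 1))))
             * ereal (1 + \<epsilon> t))))"
proof (intro conjI allI impI, goal_cases)
  case (1 k1 k2 a1 a2)
  then have k: "k1 \<le> k2" "k1 > DIM('a) \<longrightarrow> a1 = 0" "k2 > DIM('a) \<longrightarrow> a2 = 0" by blast+
  show ?case by (rule rips_covariance_asymptotics[OF assms k])
next
  case (2 k a)
  then have k: "k > DIM('a) \<longrightarrow> a = 0" by simp
  have eq: "(real DIM('a) + a) * real k + (real DIM('a) + a) * real k = 2 * (real DIM('a) + a) * real k"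
    "k + k = 2 * k" by simp_all
  show ?case
    using rips_covariance_asymptotics[OF assms order_refl k k]
    unfolding power2_eq_square mult.assoc[symmetric] eq .
qed

end
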